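(* Let $m\ge2$, $n\ge0$, $0\le k\le n$, input $\rho=|\vec n_0\rangle\langle\vec n_0|$ with $N_0=N(\vec n_0)$, with $g$ Haar-distributed on $\mathrm{SU}(m)$ and $\vec n$ distributed according to $p(\vec n|g)=|\langle\vec n|\tau_n^m(g)|\vec n_0\rangle|^2$. Then the second moment of the PNR filter function is $$\mathbb E[f_{\lambda_k}^2]=\frac{1}{s_{\lambda_k}^2}(-1)^{\varphi(N_0)}\sum_{N\in\mathrm{GT}(\tau_n^m)}(-1)^{\varphi(N)}\,g_k(N,N_0),$$ where $$g_k(N,N_0)=\sum_{l=0}^{\min(n,2k)}\frac{1}{d_{\lambda_l}}\sum_{r=1}^{m_l}\sum_{\substack{M,M',L,L'\in\mathrm{GT}(\lambda_k)\\ R,R'\in\mathrm{GT}(\lambda_l)}}C^{M}_{N_0,\bar N_0}C^{M'}_{N_0,\bar N_0}C^{R}_{N_0,\bar N_0}\,C^{L}_{N,\bar N}C^{L'}_{N,\bar N}C^{R'}_{N,\bar N}\,C^{R,r}_{M,M'}\,C^{R',r}_{L,L'},$$ $m_l$ is the multiplicity of $\lambda_l$ in $\lambda_k\otimes\lambda_k$ (empty inner sum if $m_l=0$), and $C^{R,r}_{M,M'}:=\langle M,M'|R,r\rangle$ are real Clebsch–Gordan coefficients of $\lambda_k\otimes\lambda_k$ onto the GT basis $\{|R,r\rangle\}_{R\in\mathrm{GT}(\lambda_l)}$ of the $r$-th copy of $\lambda_l$ (with respect to a fixed real orthogonal decomposition into copies).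
   Context: Fix integers $m\ge 2$, $n\ge0$. $\mathcal H_n^m$ is the span of Fock states $|\vec n\rangle=|n_1,\dots,n_m\rangle$, $\vec n\in\mathbb N^m$, $\sum_in_i=n$. $\tau_n^m$ is the totally symmetric irrep of $\mathrm{SU}(m)$ on $\mathcal H_n^m$ given by passive transformations; $\bar\tau_n^m$ its complex conjugate in the Fock basis; $\omega_n^m(g)(X)=\tau_n^m(g)X\tau_n^m(g)^\dagger\cong\tau_n^m\otimes\bar\tau_n^m$ via vectorization $|A\rangle\!\rangle=\sum\langle\vec n|A|\vec m\rangle|\vec n\rangle\otimes|\vec m\rangle$. $\lambda_k$ is the irrep with Young diagram $(2k,k,\dots,k,0)$ (first row $2k$ boxes, rows $2,\dots,m-1$ with $k$ boxes, empty last row), $d_{\lambda_k}$ its dimension; $\tau_n^m\otimes\bar\tau_n^m\cong\bigoplus_{k=0}^n\lambda_k$ multiplicity-free, $P_{\lambda_k}$ is the orthogonal projector onto the $\lambda_k$ component and $\lambda_k(g)$ the action of $g$ on it. Gelfand–Tsetlin (GT) patterns: for an irrep $\lambda=(\lambda_1,\dots,\lambda_m)$, $\lambda_m=0$, a GT pattern $M=(M_{i,j})_{1\le i\le j\le m}$ has $M_{i,m}=\lambda_i$ and $M_{i,j+1}\ge M_{i,j}\ge M_{i+1,j+1}$; $\mathrm{GT}(\lambda)$ is the set of such patterns and $\{|M\rangle\}$ the orthonormal GT basis of $\lambda$ (Condon–Shortley convention). The Fock state $|\vec n\rangle$ is identified with the GT basis vector $|N\rangle$ of $\tau_n^m$ with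 $N_{1,j}=n_1+\dots+n_j$, $N_{i,j}=0$ for $i\ge2$; write $N=N(\vec n)$. The dual pattern of $M$ is $\bar M_{i,l}:=M_{1,m}-M_{l-i+1,l}$, a GT basis label of the dual irrep. With $s_M(k)=\sum_{j=1}^k\sum_{i=1}^jM_{i,j}$ and $M_{\max}$ the highest-weight pattern ($M_{i,j}=M_{i,m}$), set $\varphi(M):=s_M(m-1)-s_{M_{\max}}(m-1)\in\mathbb Z$; then, regarding the Fock basis vector as a basis vector of $\bar\tau_n^m$, $|N\rangle=(-1)^{\varphi(N)}|\bar N\rangle$. For $N_1,N_2\in\mathrm{GT}(\tau_n^m)$ and $M\in\mathrm{GT}(\lambda_k)$, the real SU($m$) Clebsch–Gordan coefficients are $C^M_{N_1,\bar N_2}:=\langle N_1,\bar N_2|M\rangle$, i.e. $|N_1\rangle\otimes|\bar N_2\rangle=\sum_k\sum_{M\in\mathrm{GT}(\lambda_k)}C^M_{N_1,\bar N_2}|M\rangle$; they vanish unless the weight of $M$ is the sum of the weights of $N_1$ and $\bar N_2$. Filter function: for input $\rho=|\vec n_0\rangle\langle\vec n_0|$, $f_{\lambda}(\vec n,g):=s_{\lambda}^{-1}\langle\vec n|\tau_n^m(g)\,[P_{\lambda}(\rho)]\,\tau_n^m(g)^\dagger|\vec n\rangle$, with $s_\lambda:=d_\lambda^{-1}\sum_{\vec n\in\mathbb N^m}\langle\!\langle\vec n,\vec n|P_\lambda|\vec n,\vec n\rangle\!\rangle$. $\mathbb E[f^2]:=\int dg\sum_{|\vec n|=n}p(\vec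 n|g)f(\vec n,g)^2$ with $dg$ the normalized Haar measure on $\mathrm{SU}(m)$. *)

theory Defs
  imports "HOL-Probability.Probability"
begin

definition fock :: "nat \<Rightarrow> nat \<Rightarrow> (nat \<Rightarrow> nat) set" where
  "fock m n = {v. (\<forall>i. v i \<noteq> 0 \<longrightarrow> i \<in> {1..m}) \<and> (\<Sum>i\<in>{1..m}. v i) = n}"

text \<open>Square complex matrices indexed by 1..m (entries outside are zero).\<close>
type_synonym cmat = "nat \<Rightarrow> nat \<Rightarrow> complex"

definition cdet :: "nat \<Rightarrow> cmat \<Rightarrow> complex" where
  "cdet m g = (\<Sum>\<sigma> | \<sigma> permutes {1..m}. of_int (sign \<sigma>) * (\<Prod>i\<in>{1..m}. g i (\<sigma> i)))"

definition SU :: "nat \<Rightarrow> cmat set" where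
  "SU m = {g. (\<forall>i j. g i j \<noteq> 0 \<longrightarrow> i \<in> {1..m} \<and> j \<in> {1..m})
            \<and> (\<forall>i\<in>{1..m}. \<forall>j\<in>{1..m}. (\<Sum>t\<in>{1..m}. cnj (g t i) * g t j) = (if i = j then 1 else 0))
            \<and> cdet m g = 1}"

definition cmatmul :: "nat \<Rightarrow> cmat \<Rightarrow> cmat \<Rightarrow> cmat" where
  "cmatmul m g h = (\<lambda>i j. \<Sum>t\<in>{1..m}. g i t * h t j)"

definition haar_SU :: "nat \<Rightarrow> cmat measure \<Rightarrow> bool" where
  "haar_SU m \<mu> \<longleftrightarrow> prob_space \<mu> \<and> space \<mu> = SU m
     \<and> sets \<mu> = sets (restrict_space borel (SU m))
     \<and> (\<forall>h\<in>SU m. distr \<mu> \<mu> (cmatmul m h) = \<mu>)"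

definition modeseq :: "nat \<Rightarrow> (nat \<Rightarrow> nat) \<Rightarrow> nat list" where
  "modeseq m v = concat (map (\<lambda>i. replicate (v i) i) [1..<m+1])"

text \<open>Matrix elements of the passive transformation tau_n^m(g) in the Fock basis:
  <u| tau(g) |v> = perm(g[u,v]) / sqrt(prod u_i! prod v_i!), corresponding to
  a_j^dagger |-> sum_i g_ij a_i^dagger.\<close>
definition tau :: "nat \<Rightarrow> nat \<Rightarrow> cmat \<Rightarrow> (nat \<Rightarrow> nat) \<Rightarrow> (nat \<Rightarrow> nat) \<Rightarrow> complex" where
  "tau m n g u v =
     (\<Sum>\<sigma> | \<sigma> permutes {..<n}. \<Prod>t<n. g (modeseq m u ! t) (modeseq m v ! \<sigma> t))
     / complex_of_real (sqrt (real ((\<Prod>i\<in>{1..m}. fact (u i)) * (\<Prod>i\<in>{1..m}. fact (v i)))))"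

text \<open>A GT pattern is M :: nat => nat => nat with M i j the entry in row i of level j
  (1 <= i <= j <= m), zero outside this triangle. Irrep labels lam :: nat => nat give
  lam i for i = 1..m.\<close>
type_synonym gtpat = "nat \<Rightarrow> nat \<Rightarrow> nat"

definition GT :: "nat \<Rightarrow> (nat \<Rightarrow> nat) \<Rightarrow> gtpat set" where
  "GT m lam = {M. (\<forall>i j. M i j \<noteq> 0 \<longrightarrow> 1 \<le> i \<and> i \<le> j \<and> j \<le> m)
        \<and> (\<forall>i\<in>{1..m}. M i m = lam i)
        \<and> (\<forall>i j. 1 \<le> i \<and> i \<le> j \<and> j < m \<longrightarrow> M i j \<le> M i (j+1) \<and> M (i+1) (j+1) \<le> M i j)}"

definition lam_tau :: "nat \<Rightarrow> nat \<Rightarrow> nat" where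
  "lam_tau n i = (if i = 1 then n else 0)"

definition lam_k :: "nat \<Rightarrow> nat \<Rightarrow> nat \<Rightarrow> nat" where
  "lam_k m k i = (if i = 1 then 2*k else if i < m then k else 0)"

definition dim_irrep :: "nat \<Rightarrow> (nat \<Rightarrow> nat) \<Rightarrow> nat" where
  "dim_irrep m lam = card (GT m lam)"

definition incr_pat :: "gtpat \<Rightarrow> nat \<Rightarrow> nat \<Rightarrow> gtpat" where
  "incr_pat M i l = M(i := (M i)(l := M i l + 1))"

text \<open>Gelfand-Tsetlin coefficient <M + e_{k,l}| E_{l,l+1} |M> (Condon-Shortley convention).\<close>
definition gt_coef :: "gtpat \<Rightarrow> nat \<Rightarrow> nat \<Rightarrow> real" where
  "gt_coef M k l = sqrt (
     - (\<Prod>k'\<in>{1..l+1}. real_of_int (int (M k' (l+1)) - int (M k l) - int k' + int k))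
     * (\<Prod>k'\<in>{1..<l}. real_of_int (int (M k' (l-1)) - int (M k l) - int k' + int k - 1))
     / (\<Prod>k'\<in>{1..l} - {k}. real_of_int (int (M k' l) - int (M k l) - int k' + int k)
                           * real_of_int (int (M k' l) - int (M k l) - int k' + int k - 1)))"

text \<open>Matrix elements <M'| X |M> in the GT basis of the irrep lam, for
  X = E_{l,l+1} (raising), E_{l+1,l} (lowering), E_{l,l} - E_{l+1,l+1} (Cartan).\<close>
definition gt_up :: "nat \<Rightarrow> (nat \<Rightarrow> nat) \<Rightarrow> nat \<Rightarrow> gtpat \<Rightarrow> gtpat \<Rightarrow> complex" where
  "gt_up m lam l M' M = (if M \<in> GT m lam \<and> M' \<in> GT m lam
      then (\<Sum>i\<in>{1..l}. if M' = incr_pat M i l then complex_of_real (gt_coef M i l) else 0)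
      else 0)"

definition gt_down :: "nat \<Rightarrow> (nat \<Rightarrow> nat) \<Rightarrow> nat \<Rightarrow> gtpat \<Rightarrow> gtpat \<Rightarrow> complex" where
  "gt_down m lam l M' M = cnj (gt_up m lam l M M')"

definition gt_wt :: "gtpat \<Rightarrow> nat \<Rightarrow> int" where
  "gt_wt M j = (\<Sum>i\<in>{1..j}. int (M i j)) - (\<Sum>i\<in>{1..<j}. int (M i (j-1)))"

definition gt_h :: "nat \<Rightarrow> (nat \<Rightarrow> nat) \<Rightarrow> nat \<Rightarrow> gtpat \<Rightarrow> gtpat \<Rightarrow> complex" where
  "gt_h m lam l M' M = (if M \<in> GT m lam \<and> M' = M
      then of_int (gt_wt M l - gt_wt M (l+1)) else 0)"

text \<open>Vectors are functions 'a => complex supported on a finite index set B with the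
  standard inner product; an sl(m) action is given by the matrices of E_{l,l+1},
  E_{l+1,l} and E_{l,l} - E_{l+1,l+1}, l = 1..m-1.\<close>

definition cinner :: "'a set \<Rightarrow> ('a \<Rightarrow> complex) \<Rightarrow> ('a \<Rightarrow> complex) \<Rightarrow> complex" where
  "cinner B x y = (\<Sum>a\<in>B. cnj (x a) * y a)"

definition matapp :: "'a set \<Rightarrow> ('a \<Rightarrow> 'a \<Rightarrow> complex) \<Rightarrow> ('a \<Rightarrow> complex) \<Rightarrow> 'a \<Rightarrow> complex" where
  "matapp B A x = (\<lambda>a. if a \<in> B then (\<Sum>b\<in>B. A a b * x b) else 0)"

definition cspan :: "('a \<Rightarrow> complex) set \<Rightarrow> ('a \<Rightarrow> complex) set" where
  "cspan S = {x. \<exists>F c. finite F \<and> F \<subseteq> S \<and> x = (\<lambda>a. \<Sum>v\<in>F. c v * v a)}"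

definition oproj :: "'a set \<Rightarrow> ('a \<Rightarrow> complex) set \<Rightarrow> ('a \<Rightarrow> complex) \<Rightarrow> ('a \<Rightarrow> complex)" where
  "oproj B S x = (THE y. y \<in> S \<and> (\<forall>z\<in>S. cinner B z (\<lambda>a. x a - y a) = 0))"

text \<open>v is an (orthonormal) Gelfand-Tsetlin basis of a copy of the irrep lam inside the
  representation (B, U, D, H): the sl(m) generators act on v exactly as on |M>.\<close>
definition gt_family :: "nat \<Rightarrow> 'a set \<Rightarrow> (nat \<Rightarrow> 'a \<Rightarrow> 'a \<Rightarrow> complex) \<Rightarrow> (nat \<Rightarrow> 'a \<Rightarrow> 'a \<Rightarrow> complex)
      \<Rightarrow> (nat \<Rightarrow> 'a \<Rightarrow> 'a \<Rightarrow> complex) \<Rightarrow> (nat \<Rightarrow> nat) \<Rightarrow> (gtpat \<Rightarrow> 'a \<Rightarrow> complex) \<Rightarrow> bool" where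
  "gt_family m B U D H lam v \<longleftrightarrow>
     (\<forall>M\<in>GT m lam. \<forall>a. a \<notin> B \<longrightarrow> v M a = 0)
   \<and> (\<forall>M\<in>GT m lam. \<forall>M'\<in>GT m lam. cinner B (v M) (v M') = (if M = M' then 1 else 0))
   \<and> (\<forall>l\<in>{1..<m}. \<forall>M\<in>GT m lam.
        matapp B (U l) (v M) = (\<lambda>a. \<Sum>M'\<in>GT m lam. gt_up m lam l M' M * v M' a)
      \<and> matapp B (D l) (v M) = (\<lambda>a. \<Sum>M'\<in>GT m lam. gt_down m lam l M' M * v M' a)
      \<and> matapp B (H l) (v M) = (\<lambda>a. \<Sum>M'\<in>GT m lam. gt_h m lam l M' M * v M' a))"

definition isotypic :: "nat \<Rightarrow> 'a set \<Rightarrow> (nat \<Rightarrow> 'a \<Rightarrow> 'a \<Rightarrow> complex) \<Rightarrow> (nat \<Rightarrow> 'a \<Rightarrow> 'a \<Rightarrow> complex)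
      \<Rightarrow> (nat \<Rightarrow> 'a \<Rightarrow> 'a \<Rightarrow> complex) \<Rightarrow> (nat \<Rightarrow> nat) \<Rightarrow> ('a \<Rightarrow> complex) set" where
  "isotypic m B U D H lam = cspan {v M | v M. gt_family m B U D H lam v \<and> M \<in> GT m lam}"

section \<open>The representation omega = tau (x) conj tau on operators\<close>

definition adag_a :: "nat \<Rightarrow> nat \<Rightarrow> (nat \<Rightarrow> nat) \<Rightarrow> (nat \<Rightarrow> nat) \<Rightarrow> complex" where
  "adag_a i j u w =
     (if i = j then (if u = w then of_nat (w i) else 0)
      else if 1 \<le> w j \<and> u = w(i := w i + 1, j := w j - 1)
           then complex_of_real (sqrt (real (w j * (w i + 1)))) else 0)"

text \<open>Operators X on H_n^m are vectorized: X (u,v) = <u|X|v>. The Lie algebra acts by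
  commutators, X |-> [A, X].\<close>
definition ad_mat :: "((nat \<Rightarrow> nat) \<Rightarrow> (nat \<Rightarrow> nat) \<Rightarrow> complex)
    \<Rightarrow> (nat \<Rightarrow> nat) \<times> (nat \<Rightarrow> nat) \<Rightarrow> (nat \<Rightarrow> nat) \<times> (nat \<Rightarrow> nat) \<Rightarrow> complex" where
  "ad_mat A = (\<lambda>(u1, v1) (u2, v2).
      A u1 u2 * (if v1 = v2 then 1 else 0) - (if u1 = u2 then 1 else 0) * A v2 v1)"

definition om_B :: "nat \<Rightarrow> nat \<Rightarrow> ((nat \<Rightarrow> nat) \<times> (nat \<Rightarrow> nat)) set" where
  "om_B m n = fock m n \<times> fock m n"

definition om_U :: "nat \<Rightarrow> ((nat \<Rightarrow> nat) \<times> (nat \<Rightarrow> nat)) \<Rightarrow> ((nat \<Rightarrow> nat) \<times> (nat \<Rightarrow> nat)) \<Rightarrow> complex" where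
  "om_U l = ad_mat (adag_a l (l+1))"

definition om_D :: "nat \<Rightarrow> ((nat \<Rightarrow> nat) \<times> (nat \<Rightarrow> nat)) \<Rightarrow> ((nat \<Rightarrow> nat) \<times> (nat \<Rightarrow> nat)) \<Rightarrow> complex" where
  "om_D l = ad_mat (adag_a (l+1) l)"

definition om_H :: "nat \<Rightarrow> ((nat \<Rightarrow> nat) \<times> (nat \<Rightarrow> nat)) \<Rightarrow> ((nat \<Rightarrow> nat) \<times> (nat \<Rightarrow> nat)) \<Rightarrow> complex" where
  "om_H l = ad_mat (\<lambda>u w. adag_a l l u w - adag_a (l+1) (l+1) u w)"

definition P_lam :: "nat \<Rightarrow> nat \<Rightarrow> nat \<Rightarrow> ((nat \<Rightarrow> nat) \<times> (nat \<Rightarrow> nat) \<Rightarrow> complex)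
                     \<Rightarrow> ((nat \<Rightarrow> nat) \<times> (nat \<Rightarrow> nat) \<Rightarrow> complex)" where
  "P_lam m n k X = oproj (om_B m n) (isotypic m (om_B m n) om_U om_D om_H (lam_k m k)) X"

definition s_lam :: "nat \<Rightarrow> nat \<Rightarrow> nat \<Rightarrow> complex" where
  "s_lam m n k = (\<Sum>v\<in>fock m n.
       P_lam m n k (\<lambda>(a, b). if a = v \<and> b = v then 1 else 0) (v, v)) / of_nat (dim_irrep m (lam_k m k))"

definition filt :: "nat \<Rightarrow> nat \<Rightarrow> nat \<Rightarrow> (nat \<Rightarrow> nat) \<Rightarrow> (nat \<Rightarrow> nat) \<Rightarrow> cmat \<Rightarrow> complex" where
  "filt m n k n0 v g = (\<Sum>a\<in>fock m n. \<Sum>b\<in>fock m n.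
       tau m n g v a * P_lam m n k (\<lambda>(x, y). if x = n0 \<and> y = n0 then 1 else 0) (a, b)
       * cnj (tau m n g v b)) / s_lam m n k"

definition prob_out :: "nat \<Rightarrow> nat \<Rightarrow> (nat \<Rightarrow> nat) \<Rightarrow> (nat \<Rightarrow> nat) \<Rightarrow> cmat \<Rightarrow> real" where
  "prob_out m n n0 v g = (cmod (tau m n g v n0))\<^sup>2"

definition second_moment :: "nat \<Rightarrow> nat \<Rightarrow> nat \<Rightarrow> (nat \<Rightarrow> nat) \<Rightarrow> cmat measure \<Rightarrow> complex" where
  "second_moment m n k n0 \<mu> = (\<integral>g. (\<Sum>v\<in>fock m n.
        complex_of_real (prob_out m n n0 v g) * (filt m n k n0 v g)\<^sup>2) \<partial>\<mu>)"

definition pat_of_fock :: "nat \<Rightarrow> (nat \<Rightarrow> nat) \<Rightarrow> gtpat" where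
  "pat_of_fock m v = (\<lambda>i j. if i = 1 \<and> 1 \<le> j \<and> j \<le> m then (\<Sum>t\<in>{1..j}. v t) else 0)"

definition fock_of_pat :: "nat \<Rightarrow> gtpat \<Rightarrow> nat \<Rightarrow> nat" where
  "fock_of_pat m N = (\<lambda>t. if 1 \<le> t \<and> t \<le> m then N 1 t - N 1 (t - 1) else 0)"

definition s_pat :: "gtpat \<Rightarrow> nat \<Rightarrow> int" where
  "s_pat M k = (\<Sum>j\<in>{1..k}. \<Sum>i\<in>{1..j}. int (M i j))"

definition phi :: "nat \<Rightarrow> gtpat \<Rightarrow> int" where
  "phi m M = s_pat M (m - 1) - s_pat (\<lambda>i j. M i m) (m - 1)"

text \<open>Clebsch-Gordan coefficient C^M_{N1, bar N2} = <N1, bar N2 | M> for a GT basis X of a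
  component of omega. Using |N2> = (-1)^phi(N2) |bar N2> (Fock vector regarded in conj tau)
  and vectorization, |N1> (x) |bar N2> = (-1)^phi(N2) vec(|N1><N2|).\<close>
definition CG_om :: "nat \<Rightarrow> (gtpat \<Rightarrow> ((nat \<Rightarrow> nat) \<times> (nat \<Rightarrow> nat)) \<Rightarrow> complex)
                     \<Rightarrow> gtpat \<Rightarrow> gtpat \<Rightarrow> gtpat \<Rightarrow> complex" where
  "CG_om m X M N1 N2 = (-1) powi (phi m N2) * X M (fock_of_pat m N1, fock_of_pat m N2)"

definition tens_B :: "nat \<Rightarrow> (nat \<Rightarrow> nat) \<Rightarrow> (gtpat \<times> gtpat) set" where
  "tens_B m lam = GT m lam \<times> GT m lam"

definition tens_mat :: "(gtpat \<Rightarrow> gtpat \<Rightarrow> complex) \<Rightarrow> gtpat \<times> gtpat \<Rightarrow> gtpat \<times> gtpat \<Rightarrow> complex" where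
  "tens_mat A = (\<lambda>(M1, M2) (P1, P2).
      A M1 P1 * (if M2 = P2 then 1 else 0) + (if M1 = P1 then 1 else 0) * A M2 P2)"

end

theory Submission
  imports Defs
begin

text \<open>The outcome probability and the two filter functions are matrix elements of three copies of the
  operator representation, one of them conjugated, so the Haar average is a matrix element of the
  projector onto the invariants of the triple tensor product. Invariance under the group is equivalent
  to invariance under the Lie algebra, because plane rotations generate SU(m). Restricted to the
  components k, k and the dual of l, an invariant is an intertwiner from the component l to the tensor
  square of the component k; by Schur's lemma these are spanned by the Clebsch-Gordan vectors of the
  copies r, each of squared norm equal to the dimension of l, whence the factor 1/d. Components with
  l > 2k do not occur in the tensor square by comparing weights. The operator representation is
  exhausted by the components l = 0..n, since a highest-weight operator is determined by its value on
  the lowest Fock state. Schur's lemma itself only needs that raising coefficients between patterns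
  are nonzero, which makes the highest-weight vector unique. All signs cancel.\<close>

section \<open>Gelfand-Tsetlin patterns\<close>

text \<open>The components are described only by matrices of sl(m) generators, whereas the average
  runs over the group. The one-parameter subgroups \<open>rot\<close> are the bridge in both
  directions: an averaged vector is fixed by them, so their derivatives kill it; a vector killed by
  the generators stays constant along them.

  The conjugated copy carries the outcome probability, which is real and may be written as its own
  conjugate. An invariant of V (x) V (x) V* is then an intertwiner V -> V (x) V in one and the same
  bases, so no dual irrep and no dual GT basis with its phases has to be handled; the phases of the
  statement enter only through \<open>CG_om\<close> at the end.

  The obstacle is that the families \<open>X\<close> are merely given as orthonormal copies. The
  probability is not projected onto a component, so it has to be expanded over all l, and for this
  the copies must be shown to exhaust the operator space. Counting highest-weight operators does
  this without any dimension formula for patterns.\<close>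

lemma GT_support: "M \<in> GT m lam \<Longrightarrow> M i j \<noteq> 0 \<Longrightarrow> 1 \<le> i \<and> i \<le> j \<and> j \<le> m"
  unfolding GT_def by blast

lemma GT_top: "M \<in> GT m lam \<Longrightarrow> 1 \<le> i \<Longrightarrow> i \<le> m \<Longrightarrow> M i m = lam i"
  unfolding GT_def using atLeastAtMost_iff by blast

lemma GT_interlace:
  assumes "M \<in> GT m lam" "1 \<le> i" "i \<le> j" "j < m"
  shows "M i j \<le> M i (Suc j)" "M (Suc i) (Suc j) \<le> M i j"
  using assms unfolding GT_def Suc_eq_plus1 by blast+

lemma GT_mono_level:
  assumes M: "M \<in> GT m lam" and "1 \<le> i" "i \<le> j" "j \<le> j'" "j' \<le> m"
  shows "M i j \<le> M i j'"
  using assms(4,5)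
proof (induction j' rule: dec_induct)
  case (step q)
  then show ?case using GT_interlace(1)[OF M assms(2), of q] assms(3) by simp
qed simp

text \<open>Two neighbours within a level are compared through the entry between them one level
  lower, which bounds the right one from above and the left one from below.\<close>

lemma GT_antimono_row:
  assumes M: "M \<in> GT m lam" and "1 \<le> i" "i \<le> i'" "i' \<le> j" "j \<le> m"
  shows "M i' j \<le> M i j"
  using assms(3,4)
proof (induction i' rule: dec_induct)
  case (step q)
  have "M (Suc q) (Suc (j - 1)) \<le> M q (j - 1)"
    by (rule GT_interlace(2)[OF M]) (use step assms in auto)
  moreover have "M q (j - 1) \<le> M q j"
    by (rule GT_mono_level[OF M]) (use step assms in auto)
  ultimately show ?case using step by simp
qed simp

lemma finite_GT [simp]: "finite (GT m lam)"
proof -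
  let ?f = "\<lambda>M. restrict (\<lambda>(i, j). M i j) ({1..m} \<times> {1..m})"
  have "inj_on ?f (GT m lam)"
  proof (rule inj_onI, rule ext, rule ext)
    fix M P i j assume M: "M \<in> GT m lam" and P: "P \<in> GT m lam" and eq: "?f M = ?f P"
    show "M i j = (P i j :: nat)"
    proof (cases "i \<in> {1..m} \<and> j \<in> {1..m}")
      case True
      then show ?thesis using fun_cong[OF eq, of "(i, j)"] by simp
    next
      case False
      then have "\<not> (1 \<le> i \<and> i \<le> j \<and> j \<le> m)" by auto
      then have "M i j = 0" "P i j = 0" using GT_support[OF M, of i j] GT_support[OF P, of i j] by blast+
      then show ?thesis by simp
    qed
  qed
  moreover have "?f ` GT m lam \<subseteq> PiE ({1..m} \<times> {1..m}) (\<lambda>(i, j). {..lam i})"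
  proof (rule image_subsetI, rule PiE_I)
    fix M z assume M: "M \<in> GT m lam" and z: "z \<in> {1..m} \<times> {1..m}"
    obtain i j where ij: "z = (i, j)" by fastforce
    have "M i j \<le> lam i"
    proof (cases "i \<le> j")
      case True
      then show ?thesis using GT_mono_level[OF M, of i j m] GT_top[OF M, of i] z ij by auto
    next
      case False
      then have "M i j = 0" using GT_support[OF M, of i j] by blast
      then show ?thesis by simp
    qed
    then show "?f M z \<in> (case z of (i, j) \<Rightarrow> {..lam i})" using z ij by auto
  qed auto
  moreover have "finite (PiE ({1..m} \<times> {1..m}) (\<lambda>(i, j). {..lam i}))"
    by (rule finite_PiE) auto
  ultimately show ?thesis by (meson finite_imageD finite_subset)
qed

definition max_pat :: "nat \<Rightarrow> (nat \<Rightarrow> nat) \<Rightarrow> gtpat" where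
  "max_pat m lam = (\<lambda>i j. if 1 \<le> i \<and> i \<le> j \<and> j \<le> m then lam i else 0)"

lemma max_pat_in_GT:
  assumes "\<And>i. 1 \<le> i \<Longrightarrow> i < m \<Longrightarrow> lam (Suc i) \<le> lam i"
  shows "max_pat m lam \<in> GT m lam"
  using assms by (auto simp: GT_def max_pat_def)

lemma max_pat_lam_k [simp]: "m \<ge> 2 \<Longrightarrow> max_pat m (lam_k m k) \<in> GT m (lam_k m k)"
  by (rule max_pat_in_GT) (auto simp: lam_k_def)

lemma incr_pat_apply: "incr_pat M i l i' l' = (if i' = i \<and> l' = l then Suc (M i l) else M i' l')"
  by (simp add: incr_pat_def)

lemma incr_pat_inj: "incr_pat M i l = incr_pat P i l \<longleftrightarrow> M = P"
proof
  assume eq: "incr_pat M i l = incr_pat P i l"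
  show "M = P"
  proof (rule ext, rule ext)
    fix a b show "M a b = P a b"
      using fun_cong[OF fun_cong[OF eq, of a], of b] by (auto simp: incr_pat_apply split: if_splits)
  qed
qed simp

text \<open>Every factor is a difference of shifted entries \<open>M i j - i\<close>, up to a
  further shift by 1. These strictly decrease along a level, and interlacing of the raised pattern
  makes the critical inequalities strict for \<open>M\<close>. Denominators have to be checked as
  well, since division by zero yields 0. Nonvanishing of the radicand suffices because
  \<open>sqrt\<close> vanishes only at 0, also among negative reals.\<close>

lemma gt_coef_nonzero:
  assumes M: "M \<in> GT m lam" and I: "incr_pat M k l \<in> GT m lam"
    and k: "1 \<le> k" "k \<le> l" "l < m"
  shows "gt_coef M k l \<noteq> 0"
proof -
  have up: "M k l < M k (Suc l)"
    using GT_interlace(1)[OF I, of k l] k by (simp add: incr_pat_apply)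
  have left: "M k l < M k' (l - 1)" if "1 \<le> k'" "k' < k" for k'
  proof -
    have "incr_pat M k l k l \<le> incr_pat M k l (k - 1) (l - 1)"
      using GT_interlace(2)[OF I, of "k - 1" "l - 1"] k that by auto
    then have "M k l < M (k - 1) (l - 1)" using that k by (auto simp: incr_pat_apply split: if_splits)
    also have "\<dots> \<le> M k' (l - 1)" by (rule GT_antimono_row[OF M]) (use that k in auto)
    finally show ?thesis .
  qed
  have a: "real_of_int (int (M k' (l+1)) - int (M k l) - int k' + int k) \<noteq> 0"
    if "k' \<in> {1..l+1}" for k'
  proof (cases "k' \<le> k")
    case True
    have "M k (Suc l) \<le> M k' (Suc l)" by (rule GT_antimono_row[OF M]) (use that True k in auto)
    then show ?thesis using up True by (simp add: of_int_eq_0_iff del: of_int_diff of_int_add)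
  next
    case False
    have "M k' (Suc l) \<le> M (Suc k) (Suc l)" by (rule GT_antimono_row[OF M]) (use that False k in auto)
    also have "\<dots> \<le> M k l" by (rule GT_interlace(2)[OF M]) (use k in auto)
    finally show ?thesis using False by (simp add: of_int_eq_0_iff del: of_int_diff of_int_add)
  qed
  have b: "real_of_int (int (M k' (l-1)) - int (M k l) - int k' + int k - 1) \<noteq> 0"
    if "k' \<in> {1..<l}" for k'
  proof (cases "k' < k")
    case True
    then show ?thesis using left[of k'] that by (simp add: of_int_eq_0_iff del: of_int_diff of_int_add)
  next
    case False
    have "M k' (l - 1) \<le> M k' l" by (rule GT_mono_level[OF M]) (use that False k in auto)
    also have "\<dots> \<le> M k l" by (rule GT_antimono_row[OF M]) (use that False k in auto)
    finally show ?thesis using False by (simp add: of_int_eq_0_iff del: of_int_diff of_int_add)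
  qed
  have c: "real_of_int (int (M k' l) - int (M k l) - int k' + int k) \<noteq> 0 \<and>
     real_of_int (int (M k' l) - int (M k l) - int k' + int k - 1) \<noteq> 0"
    if "k' \<in> {1..l} - {k}" for k'
  proof (cases "k' < k")
    case True
    have "M k' (l - 1) \<le> M k' l" by (rule GT_mono_level[OF M]) (use that True k in auto)
    then have "M k l < M k' l" using left[of k'] that True by simp
    then show ?thesis using True by (simp add: of_int_eq_0_iff del: of_int_diff of_int_add)
  next
    case False
    have "M k' l \<le> M k l" by (rule GT_antimono_row[OF M]) (use that False k in auto)
    then show ?thesis using False that by (simp add: of_int_eq_0_iff del: of_int_diff of_int_add)
  qed
  have "(\<Prod>k'\<in>{1..l+1}. real_of_int (int (M k' (l+1)) - int (M k l) - int k' + int k)) \<noteq> 0"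
    "(\<Prod>k'\<in>{1..<l}. real_of_int (int (M k' (l-1)) - int (M k l) - int k' + int k - 1)) \<noteq> 0"
    "(\<Prod>k'\<in>{1..l} - {k}. real_of_int (int (M k' l) - int (M k l) - int k' + int k)
        * real_of_int (int (M k' l) - int (M k l) - int k' + int k - 1)) \<noteq> 0"
    subgoal using a by (subst prod_zero_iff) (simp, blast)
    subgoal using b by (subst prod_zero_iff) (simp, blast)
    subgoal using c by (subst prod_zero_iff) (simp, unfold mult_eq_0_iff, blast)
    done
  then show ?thesis
    unfolding gt_coef_def real_sqrt_eq_0_iff divide_eq_0_iff mult_eq_0_iff neg_equal_0_iff_equal by blast
qed

lemma gt_up_nonzeroD:
  assumes "gt_up m lam l P M \<noteq> 0"
  obtains i where "i \<in> {1..l}" "P = incr_pat M i l" "M \<in> GT m lam" "P \<in> GT m lam"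
proof -
  have "M \<in> GT m lam" "P \<in> GT m lam" using assms by (auto simp: gt_up_def split: if_splits)
  moreover have "\<exists>i\<in>{1..l}. P = incr_pat M i l"
  proof (rule ccontr)
    assume "\<not> ?thesis"
    then have "(\<Sum>i\<in>{1..l}. if P = incr_pat M i l then complex_of_real (gt_coef M i l) else 0) = 0"
      by (intro sum.neutral) auto
    then show False using assms by (auto simp: gt_up_def split: if_splits)
  qed
  ultimately show thesis using that by blast
qed

text \<open>A raised pattern and its source determine the raised row, so a single term of the sum in
  \<open>gt_up\<close> survives.\<close>

lemma gt_up_incr_pat:
  assumes "M \<in> GT m lam" "incr_pat M i l \<in> GT m lam" "i \<in> {1..l}"
  shows "gt_up m lam l (incr_pat M i l) M = gt_coef M i l"
proof -
  have "incr_pat M i l = incr_pat M i' l \<longleftrightarrow> i = i'" for i'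
  proof
    assume "incr_pat M i l = incr_pat M i' l"
    from fun_cong[OF fun_cong[OF this, of i], of l] show "i = i'"
      by (auto simp: incr_pat_apply split: if_splits)
  qed simp
  then show ?thesis using assms by (simp add: gt_up_def)
qed

text \<open>Going through the positions level by level, and within a level from left to right, an
  entry below its upper bound could be raised; the raised pattern is reached from no other
  pattern in the support, so its coefficient would have to vanish.\<close>
lemma gt_highest_unique:
  fixes x :: "gtpat \<Rightarrow> complex"
  assumes hw: "\<And>l P. l \<in> {1..<m} \<Longrightarrow> P \<in> GT m lam \<Longrightarrow> (\<Sum>M\<in>GT m lam. gt_up m lam l P M * x M) = 0"
    and M: "M \<in> GT m lam" and xM: "x M \<noteq> 0"
  shows "M = max_pat m lam"
proof -
  have tight: "\<forall>i M. 1 \<le> i \<longrightarrow> i \<le> l \<longrightarrow> l < m \<longrightarrow> M \<in> GT m lam \<longrightarrow> x M \<noteq> 0 \<longrightarrow> M i l = M i (Suc l)" for l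
  proof (induction l rule: less_induct)
    case (less l)
    have "\<forall>M. 1 \<le> i \<longrightarrow> i \<le> l \<longrightarrow> l < m \<longrightarrow> M \<in> GT m lam \<longrightarrow> x M \<noteq> 0 \<longrightarrow> M i l = M i (Suc l)" for i
    proof (induction i rule: less_induct)
      case (less i)
      note IHl = \<open>\<And>y. y < l \<Longrightarrow> \<forall>i M. 1 \<le> i \<longrightarrow> i \<le> y \<longrightarrow> y < m \<longrightarrow> M \<in> GT m lam \<longrightarrow> x M \<noteq> 0 \<longrightarrow> M i y = M i (Suc y)\<close>
      note IHi = less.IH
      show ?case
      proof (intro allI impI, rule ccontr)
        fix M assume i: "1 \<le> i" "i \<le> l" "l < m" and M: "M \<in> GT m lam" and xM: "x M \<noteq> 0"
          and ne: "M i l \<noteq> M i (Suc l)"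
        have lt: "M i l < M i (Suc l)" using GT_interlace(1)[OF M i] ne by simp
        let ?Q = "incr_pat M i l"
        have Q: "?Q \<in> GT m lam"
        proof -
          \<comment> \<open>Raising must not break interlacing with level \<open>l - 1\<close>.
            There row \<open>i - 1\<close> already equals its upper neighbour by tightness at level
            \<open>l - 1\<close>, so the slack of \<open>M i l\<close> below
            \<open>M i (Suc l)\<close> carries over.\<close>
          have below: "M i l < M (i - 1) (l - 1)" if "i \<ge> 2"
          proof -
            have "M i (Suc l) \<le> M (i - 1) l" using GT_interlace(2)[OF M, of "i - 1" l] i that by auto
            moreover have "M (i - 1) (l - 1) = M (i - 1) l"
              using IHl[of "l - 1"] i that M xM by fastforce
            ultimately show ?thesis using lt by simp
          qed
          have "incr_pat M i l a b \<le> incr_pat M i l a (b + 1)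
              \<and> incr_pat M i l (a + 1) (b + 1) \<le> incr_pat M i l a b"
            if ab: "1 \<le> a" "a \<le> b" "b < m" for a b
            using GT_interlace[OF M ab] lt below ab by (auto simp: incr_pat_apply)
          moreover have "incr_pat M i l a b \<noteq> 0 \<Longrightarrow> 1 \<le> a \<and> a \<le> b \<and> b \<le> m" for a b
            using GT_support[OF M, of a b] i by (auto simp: incr_pat_apply split: if_splits)
          moreover have "incr_pat M i l a m = lam a" if "a \<in> {1..m}" for a
            using GT_top[OF M, of a] i that by (simp add: incr_pat_apply)
          ultimately show ?thesis unfolding GT_def by blast
        qed
        have only: "P = M" if P: "P \<in> GT m lam" "gt_up m lam l ?Q P * x P \<noteq> 0" for P
        proof -
          have xP: "x P \<noteq> 0" using P(2) by (metis mult_zero_right)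
          have "gt_up m lam l ?Q P \<noteq> 0" using P(2) by (metis mult_zero_left)
          then obtain i' where i': "i' \<in> {1..l}" and QP: "?Q = incr_pat P i' l"
            by (rule gt_up_nonzeroD)
          have e: "incr_pat M i l a b = incr_pat P i' l a b" for a b using QP by simp
          \<comment> \<open>A source raised in another row differs from \<open>M\<close> at level
            \<open>l\<close>. For an earlier row this contradicts tightness of that row at level
            \<open>l\<close>; for a later row it contradicts tightness of row \<open>i\<close> at
            level \<open>l - 1\<close>, where both patterns agree.\<close>
          consider "i' = i" | "i' < i" | "i' > i" by linarith
          then show "P = M"
          proof cases
            case 1
            then show ?thesis using QP incr_pat_inj by metis
          next
            case 2
            have "P i' l = P i' (Suc l)" using IHi[OF 2] i i' P xP by auto
            moreover have "M i' l = M i' (Suc l)" using IHi[OF 2] i i' M xM by auto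
            ultimately show ?thesis using e[of i' l] e[of i' "Suc l"] 2 by (simp add: incr_pat_apply)
          next
            case 3
            then have "l - 1 \<noteq> l" using i' by auto
            have "P i (l - 1) = P i (Suc (l - 1))" using IHl[of "l - 1"] i i' 3 P xP by auto
            moreover have "M i (l - 1) = M i (Suc (l - 1))" using IHl[of "l - 1"] i i' 3 M xM by auto
            ultimately show ?thesis using e[of i "l - 1"] e[of i l] 3 i i' \<open>l - 1 \<noteq> l\<close>
              by (simp add: incr_pat_apply)
          qed
        qed
        have "0 = (\<Sum>P\<in>GT m lam. gt_up m lam l ?Q P * x P)" using hw[OF _ Q, of l] i by simp
        also have "\<dots> = (\<Sum>P\<in>{M}. gt_up m lam l ?Q P * x P)"
          by (rule sum.mono_neutral_right) (use M only in auto)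
        also have "\<dots> = gt_coef M i l * x M" using gt_up_incr_pat[OF M Q] i by simp
        finally show False using gt_coef_nonzero[OF M Q] i xM by simp
      qed
    qed
    then show ?case by blast
  qed
  have "M i j = lam i" if ij: "1 \<le> i" "i \<le> j" "j \<le> m" for i j
    using ij(3,2)
  proof (induction j rule: inc_induct)
    case base
    then show ?case using GT_top[OF M] ij by simp
  next
    case (step q)
    have "M i q = M i (Suc q)" using tight[of q] M xM ij(1) step(2) step.prems by blast
    then show ?case using step by simp
  qed
  moreover have "M i j = 0" if "\<not> (1 \<le> i \<and> i \<le> j \<and> j \<le> m)" for i j
    using GT_support[OF M, of i j] that by blast
  ultimately show ?thesis unfolding max_pat_def by (intro ext) auto
qed

lemma gt_up_max_pat:
  assumes "l < m"
  shows "gt_up m lam l P (max_pat m lam) = 0"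
proof (rule ccontr)
  assume "gt_up m lam l P (max_pat m lam) \<noteq> 0"
  then obtain i where i: "i \<in> {1..l}" and "P = incr_pat (max_pat m lam) i l" and P: "P \<in> GT m lam"
    by (rule gt_up_nonzeroD)
  then have "P i l = Suc (lam i)" using assms by (simp add: incr_pat_apply max_pat_def)
  moreover have "P i l \<le> P i m" by (rule GT_mono_level[OF P]) (use i assms in auto)
  moreover have "P i m = lam i" by (rule GT_top[OF P]) (use i assms in auto)
  ultimately show False by simp
qed

text \<open>Each raising operator strictly increases the grade of every index in the support, and
  grades are bounded on the finite set \<open>B\<close>; hence repeated raising of a nonzero vector
  must stop at one killed by all of them. Applied to patterns in Schur's lemma and to operators for
  completeness.\<close>

lemma exists_highest:
  fixes U :: "'l \<Rightarrow> 'a \<Rightarrow> 'a \<Rightarrow> complex" and gr :: "'a \<Rightarrow> nat"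
  assumes fin: "finite B"
    and closed: "\<And>y l. y \<in> S \<Longrightarrow> l \<in> L \<Longrightarrow> matapp B (U l) y \<in> S"
    and grade: "\<And>a b l. l \<in> L \<Longrightarrow> a \<in> B \<Longrightarrow> b \<in> B \<Longrightarrow> U l a b \<noteq> 0 \<Longrightarrow> gr b < gr a"
    and y0: "y0 \<in> S" "a0 \<in> B" "y0 a0 \<noteq> 0"
  obtains y a where "y \<in> S" "a \<in> B" "y a \<noteq> 0" "\<And>l a. l \<in> L \<Longrightarrow> matapp B (U l) y a = 0"
proof (rule ccontr)
  assume no: "\<not> thesis"
  have "\<exists>y\<in>S. (\<exists>a\<in>B. y a \<noteq> 0) \<and> (\<forall>a\<in>B. y a \<noteq> 0 \<longrightarrow> d \<le> gr a)" for d
  proof (induction d)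
    case 0
    then show ?case using y0 by auto
  next
    case (Suc d)
    then obtain y where y: "y \<in> S" "\<exists>a\<in>B. y a \<noteq> 0" "\<forall>a\<in>B. y a \<noteq> 0 \<longrightarrow> d \<le> gr a" by blast
    have "\<exists>l\<in>L. \<exists>a. matapp B (U l) y a \<noteq> 0"
    proof (rule ccontr)
      assume "\<not> ?thesis"
      then show False using no that[of y] y by blast
    qed
    then obtain l a where l: "l \<in> L" and a: "matapp B (U l) y a \<noteq> 0" by blast
    have aB: "a \<in> B" using a by (auto simp: matapp_def split: if_splits)
    have "Suc d \<le> gr c" if c: "c \<in> B" "matapp B (U l) y c \<noteq> 0" for c
    proof -
      have "\<exists>b\<in>B. U l c b * y b \<noteq> 0"
      proof (rule ccontr)
        assume "\<not> ?thesis"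
        then have "(\<Sum>b\<in>B. U l c b * y b) = 0" by (intro sum.neutral) blast
        then show False using c by (simp add: matapp_def)
      qed
      then obtain b where "b \<in> B" "U l c b \<noteq> 0" "y b \<noteq> 0" by auto
      then show ?thesis using grade[OF l c(1)] y(3) by fastforce
    qed
    then show ?case using closed[OF y(1) l] a aB by blast
  qed
  from this[of "Suc (Max (gr ` B))"] obtain a where "a \<in> B" "Suc (Max (gr ` B)) \<le> gr a" by blast
  moreover have "gr a \<le> Max (gr ` B)" using fin \<open>a \<in> B\<close> by simp
  ultimately show False by simp
qed

definition pat_grade :: "nat \<Rightarrow> gtpat \<Rightarrow> nat" where
  "pat_grade m M = (\<Sum>i\<in>{1..m}. \<Sum>j\<in>{1..m}. M i j)"

lemma pat_grade_incr:
  assumes "i \<in> {1..m}" "l \<in> {1..m}"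
  shows "pat_grade m (incr_pat M i l) = Suc (pat_grade m M)"
proof -
  have "pat_grade m (incr_pat M i l) = (\<Sum>a\<in>{1..m}. \<Sum>b\<in>{1..m}. M a b + (if a = i then if b = l then 1 else 0 else 0))"
    unfolding pat_grade_def by (intro sum.cong refl) (simp add: incr_pat_apply)
  also have "\<dots> = pat_grade m M + (\<Sum>a\<in>{1..m}. \<Sum>b\<in>{1..m}. (if a = i then if b = l then 1 else 0 else 0))"
    by (simp add: sum.distrib pat_grade_def)
  also have "(\<Sum>a\<in>{1..m}. \<Sum>b\<in>{1..m}. (if a = i then if b = l then 1 else 0 else 0)) = (\<Sum>a\<in>{1..m}. (if a = i then 1 else 0 :: nat))"
    by (intro sum.cong refl) (use assms in auto)
  finally show ?thesis using assms by simp
qed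

text \<open>Schur's lemma in Gelfand-Tsetlin bases. The row of the intertwiner at the top pattern
  vanishes, while a nonzero image would contain a highest-weight vector, that is, the top pattern.\<close>
lemma gt_schur_zero:
  fixes G :: "gtpat \<Rightarrow> gtpat \<Rightarrow> complex"
  assumes up: "\<And>l P M. l \<in> {1..<m} \<Longrightarrow> P \<in> GT m lam' \<Longrightarrow> M \<in> GT m lam \<Longrightarrow>
      (\<Sum>Q\<in>GT m lam'. gt_up m lam' l P Q * G Q M) = (\<Sum>Q\<in>GT m lam. G P Q * gt_up m lam l Q M)"
    and down: "\<And>l P M. l \<in> {1..<m} \<Longrightarrow> P \<in> GT m lam' \<Longrightarrow> M \<in> GT m lam \<Longrightarrow>
      (\<Sum>Q\<in>GT m lam'. gt_down m lam' l P Q * G Q M) = (\<Sum>Q\<in>GT m lam. G P Q * gt_down m lam l Q M)"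
    and mx: "max_pat m lam' \<in> GT m lam'"
    and zero: "G (max_pat m lam') (max_pat m lam) = 0"
    and P: "P \<in> GT m lam'" and M: "M \<in> GT m lam"
  shows "G P M = 0"
proof (rule ccontr)
  assume nz: "G P M \<noteq> 0"
  let ?T = "max_pat m lam'"
  \<comment> \<open>Lowering onto \<open>?T\<close> is adjoint to raising out of \<open>?T\<close>,
    which is zero. So the conjugated row at \<open>?T\<close> is a highest-weight vector and lives
    on \<open>max_pat m lam\<close> alone, where \<open>zero\<close> kills it.\<close>
  have row: "G ?T Q = 0" if Q: "Q \<in> GT m lam" for Q
  proof (rule ccontr)
    assume "G ?T Q \<noteq> 0"
    have "Q = max_pat m lam"
    proof (rule gt_highest_unique[where x = "\<lambda>Q. cnj (G ?T Q)"])
      fix l R assume l: "l \<in> {1..<m}" and R: "R \<in> GT m lam"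
      have "(\<Sum>Q\<in>GT m lam. G ?T Q * gt_down m lam l Q R) = (\<Sum>Q\<in>GT m lam'. gt_down m lam' l ?T Q * G Q R)"
        using down[OF l mx R] by simp
      also have "\<dots> = 0" using l by (intro sum.neutral) (simp add: gt_down_def gt_up_max_pat)
      finally have "cnj (\<Sum>Q\<in>GT m lam. G ?T Q * gt_down m lam l Q R) = 0" by simp
      then show "(\<Sum>Q\<in>GT m lam. gt_up m lam l R Q * cnj (G ?T Q)) = 0"
        by (simp add: gt_down_def mult.commute)
    qed (use Q \<open>G ?T Q \<noteq> 0\<close> in auto)
    then show False using zero \<open>G ?T Q \<noteq> 0\<close> by simp
  qed
  define im where "im x = (\<lambda>P. if P \<in> GT m lam' then \<Sum>M\<in>GT m lam. G P M * x M else 0)" for x :: "gtpat \<Rightarrow> complex"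
  obtain y a where y: "y \<in> range im" "a \<in> GT m lam'" "y a \<noteq> 0"
      and hw: "\<And>l a. l \<in> {1..<m} \<Longrightarrow> matapp (GT m lam') (gt_up m lam' l) y a = 0"
  proof (rule exists_highest[where B = "GT m lam'" and S = "range im" and L = "{1..<m}" and U = "gt_up m lam'"
        and gr = "pat_grade m" and ?y0.0 = "im (\<lambda>Q. if Q = M then 1 else 0)" and ?a0.0 = P])
    fix y l assume "y \<in> range im" and l: "l \<in> {1..<m}"
    then obtain x where x: "y = im x" by auto
    have "matapp (GT m lam') (gt_up m lam' l) y = im (\<lambda>Q. \<Sum>M\<in>GT m lam. gt_up m lam l Q M * x M)"
    proof
      fix R
      show "matapp (GT m lam') (gt_up m lam' l) y R = im (\<lambda>Q. \<Sum>M\<in>GT m lam. gt_up m lam l Q M * x M) R"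
      proof (cases "R \<in> GT m lam'")
        case True
        have "matapp (GT m lam') (gt_up m lam' l) y R
            = (\<Sum>Q\<in>GT m lam'. \<Sum>M\<in>GT m lam. gt_up m lam' l R Q * G Q M * x M)"
          using True by (simp add: matapp_def x im_def sum_distrib_left mult.assoc)
        also have "\<dots> = (\<Sum>M\<in>GT m lam. (\<Sum>Q\<in>GT m lam'. gt_up m lam' l R Q * G Q M) * x M)"
          by (subst sum.swap) (simp add: sum_distrib_right)
        also have "\<dots> = (\<Sum>M\<in>GT m lam. \<Sum>Q\<in>GT m lam. G R Q * (gt_up m lam l Q M * x M))"
          using up[OF l True] by (simp add: sum_distrib_right mult.assoc)
        also have "\<dots> = im (\<lambda>Q. \<Sum>M\<in>GT m lam. gt_up m lam l Q M * x M) R"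
          using True by (subst sum.swap) (simp add: im_def sum_distrib_left)
        finally show ?thesis .
      qed (simp add: matapp_def im_def)
    qed
    then show "matapp (GT m lam') (gt_up m lam' l) y \<in> range im" by simp
  next
    fix a b l assume l: "l \<in> {1..<m}" and "gt_up m lam' l a b \<noteq> 0"
    then obtain i where "i \<in> {1..l}" "a = incr_pat b i l" by (metis gt_up_nonzeroD)
    then show "pat_grade m b < pat_grade m a" using l pat_grade_incr[of i m l b] by auto
  next
    show "im (\<lambda>Q. if Q = M then 1 else 0) P \<noteq> 0" using P M nz by (simp add: im_def if_distrib cong: if_cong)
  qed (use P in auto)
  have "a = ?T"
  proof (rule gt_highest_unique[where x = y])
    fix l P assume "l \<in> {1..<m}" "P \<in> GT m lam'"
    then show "(\<Sum>M\<in>GT m lam'. gt_up m lam' l P M * y M) = 0" using hw[of l P] by (simp add: matapp_def)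
  qed (use y in auto)
  moreover obtain x where "y = im x" using y(1) by auto
  ultimately have "y a = 0" using row by (simp add: im_def)
  then show False using y(3) by simp
qed

lemma sum_mult_delta:
  fixes f :: "'a \<Rightarrow> complex"
  assumes "finite A" "a \<in> A"
  shows "(\<Sum>q\<in>A. f q * (if q = a then c else 0)) = f a * c"
    "(\<Sum>q\<in>A. f q * (if a = q then c else 0)) = f a * c"
    "(\<Sum>q\<in>A. (if q = a then c else 0) * f q) = c * f a"
    "(\<Sum>q\<in>A. (if a = q then c else 0) * f q) = c * f a"
  using assms by (simp_all add: if_distrib if_distribR cong: if_cong)

text \<open>Subtracting the scalar matrix with the same top entry reduces this to the vanishing
  criterion.\<close>

lemma gt_schur_scalar:
  fixes G :: "gtpat \<Rightarrow> gtpat \<Rightarrow> complex"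
  assumes up: "\<And>l P M. l \<in> {1..<m} \<Longrightarrow> P \<in> GT m lam \<Longrightarrow> M \<in> GT m lam \<Longrightarrow>
      (\<Sum>Q\<in>GT m lam. gt_up m lam l P Q * G Q M) = (\<Sum>Q\<in>GT m lam. G P Q * gt_up m lam l Q M)"
    and down: "\<And>l P M. l \<in> {1..<m} \<Longrightarrow> P \<in> GT m lam \<Longrightarrow> M \<in> GT m lam \<Longrightarrow>
      (\<Sum>Q\<in>GT m lam. gt_down m lam l P Q * G Q M) = (\<Sum>Q\<in>GT m lam. G P Q * gt_down m lam l Q M)"
    and mx: "max_pat m lam \<in> GT m lam"
    and P: "P \<in> GT m lam" and M: "M \<in> GT m lam"
  shows "G P M = (if P = M then G (max_pat m lam) (max_pat m lam) else 0)"
proof -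
  let ?c = "G (max_pat m lam) (max_pat m lam)"
  let ?G = "\<lambda>P M. G P M - (if P = M then ?c else 0)"
  have "?G P M = 0"
  proof (rule gt_schur_zero[where G = ?G and lam = lam and lam' = lam and m = m])
    fix l P M assume a: "l \<in> {1..<m}" "P \<in> GT m lam" "M \<in> GT m lam"
    show "(\<Sum>Q\<in>GT m lam. gt_up m lam l P Q * ?G Q M) = (\<Sum>Q\<in>GT m lam. ?G P Q * gt_up m lam l Q M)"
      using up[OF a] a by (simp add: right_diff_distrib left_diff_distrib sum_subtractf sum_mult_delta)
    show "(\<Sum>Q\<in>GT m lam. gt_down m lam l P Q * ?G Q M) = (\<Sum>Q\<in>GT m lam. ?G P Q * gt_down m lam l Q M)"
      using down[OF a] a by (simp add: right_diff_distrib left_diff_distrib sum_subtractf sum_mult_delta)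
  qed (use mx P M in auto)
  then show ?thesis by (simp split: if_splits)
qed

section \<open>Gelfand-Tsetlin families and their tensor products\<close>

text \<open>The matrix identity A v = v \<alpha> for arbitrary index sets, imposed on
  \<open>B\<close> only. In this weak form it passes to tensor products, adjoints and contractions,
  which are neither normalized nor supported on \<open>B\<close> in general.\<close>

definition intertwines :: "'a set \<Rightarrow> ('a \<Rightarrow> 'a \<Rightarrow> complex) \<Rightarrow> 'b set \<Rightarrow> ('b \<Rightarrow> 'b \<Rightarrow> complex) \<Rightarrow> ('b \<Rightarrow> 'a \<Rightarrow> complex) \<Rightarrow> bool" where
  "intertwines B A \<Gamma> \<alpha> v \<longleftrightarrow> (\<forall>M\<in>\<Gamma>. \<forall>a\<in>B. (\<Sum>b\<in>B. A a b * v M b) = (\<Sum>M'\<in>\<Gamma>. \<alpha> M' M * v M' a))"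

lemma intertwinesD:
  "intertwines B A \<Gamma> \<alpha> v \<Longrightarrow> M \<in> \<Gamma> \<Longrightarrow> a \<in> B \<Longrightarrow> (\<Sum>b\<in>B. A a b * v M b) = (\<Sum>M'\<in>\<Gamma>. \<alpha> M' M * v M' a)"
  by (auto simp: intertwines_def)

text \<open>An equivariant map out of the irrep, possibly zero: \<open>gt_family\<close> stripped of
  orthonormality and support. Schur's lemma is applied to such maps.\<close>

definition gt_map :: "nat \<Rightarrow> 'a set \<Rightarrow> (nat \<Rightarrow> 'a \<Rightarrow> 'a \<Rightarrow> complex) \<Rightarrow> (nat \<Rightarrow> 'a \<Rightarrow> 'a \<Rightarrow> complex)
      \<Rightarrow> (nat \<Rightarrow> 'a \<Rightarrow> 'a \<Rightarrow> complex) \<Rightarrow> (nat \<Rightarrow> nat) \<Rightarrow> (gtpat \<Rightarrow> 'a \<Rightarrow> complex) \<Rightarrow> bool" where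
  "gt_map m B U D H lam v \<longleftrightarrow> (\<forall>l\<in>{1..<m}.
      intertwines B (U l) (GT m lam) (gt_up m lam l) v
    \<and> intertwines B (D l) (GT m lam) (gt_down m lam l) v
    \<and> intertwines B (H l) (GT m lam) (gt_h m lam l) v)"

definition adjoint_gens :: "nat \<Rightarrow> 'a set \<Rightarrow> (nat \<Rightarrow> 'a \<Rightarrow> 'a \<Rightarrow> complex) \<Rightarrow> (nat \<Rightarrow> 'a \<Rightarrow> 'a \<Rightarrow> complex)
      \<Rightarrow> (nat \<Rightarrow> 'a \<Rightarrow> 'a \<Rightarrow> complex) \<Rightarrow> bool" where
  "adjoint_gens m B U D H \<longleftrightarrow> finite B \<and> (\<forall>l\<in>{1..<m}. \<forall>a\<in>B. \<forall>b\<in>B. D l a b = cnj (U l b a) \<and> H l a b = cnj (H l b a))"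

lemma gt_h_cnj: "gt_h m lam l P M = cnj (gt_h m lam l M P)"
  by (simp add: gt_h_def)

lemma gt_down_cnj: "gt_down m lam l P M = cnj (gt_up m lam l M P)" "gt_up m lam l P M = cnj (gt_down m lam l M P)"
  by (simp_all add: gt_down_def)

text \<open>Outside \<open>B\<close> both sides of the generator equations vanish by the support
  condition, so the equations between functions reduce to \<open>intertwines\<close>.\<close>

lemma gt_family_iff:
  "gt_family m B U D H lam v \<longleftrightarrow>
     (\<forall>M\<in>GT m lam. \<forall>a. a \<notin> B \<longrightarrow> v M a = 0)
   \<and> (\<forall>M\<in>GT m lam. \<forall>M'\<in>GT m lam. cinner B (v M) (v M') = (if M = M' then 1 else 0))
   \<and> gt_map m B U D H lam v"
proof -
  have eq: "(\<forall>M\<in>GT m lam. matapp B A (v M) = (\<lambda>a. \<Sum>M'\<in>GT m lam. \<alpha> M' M * v M' a)) \<longleftrightarrow> intertwines B A (GT m lam) \<alpha> v"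
    if "\<forall>M\<in>GT m lam. \<forall>a. a \<notin> B \<longrightarrow> v M a = 0" for A \<alpha>
  proof -
    have "matapp B A (v M) = (\<lambda>a. \<Sum>M'\<in>GT m lam. \<alpha> M' M * v M' a) \<longleftrightarrow>
       (\<forall>a\<in>B. (\<Sum>b\<in>B. A a b * v M b) = (\<Sum>M'\<in>GT m lam. \<alpha> M' M * v M' a))" if "M \<in> GT m lam" for M
    proof -
      have "(\<Sum>M'\<in>GT m lam. \<alpha> M' M * v M' a) = 0" if "a \<notin> B" for a
        using that \<open>\<forall>M\<in>GT m lam. \<forall>a. a \<notin> B \<longrightarrow> v M a = 0\<close> by (intro sum.neutral) auto
      then show ?thesis unfolding matapp_def fun_eq_iff by metis
    qed
    then show ?thesis unfolding intertwines_def by blast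
  qed
  show ?thesis
  proof (cases "\<forall>M\<in>GT m lam. \<forall>a. a \<notin> B \<longrightarrow> v M a = 0")
    case True
    show ?thesis unfolding gt_family_def gt_map_def ball_conj_distrib eq[OF True] by blast
  next
    case False
    then show ?thesis unfolding gt_family_def by blast
  qed
qed

text \<open>Moving the operator to the other side of the inner product shows that the Gram matrix of
  two equivariant families commutes with the action, which makes it an instance of Schur's
  lemma.\<close>

lemma gram_intertwines:
  assumes fin: "finite B"
    and adj: "\<And>a b. a \<in> B \<Longrightarrow> b \<in> B \<Longrightarrow> A' a b = cnj (A b a)"
    and adj': "\<And>P Q. P \<in> \<Gamma> \<Longrightarrow> Q \<in> \<Gamma> \<Longrightarrow> \<alpha>' Q P = cnj (\<alpha> P Q)"
    and v: "intertwines B A' \<Gamma> \<alpha>' v" and w: "intertwines B A \<Delta> \<beta> w"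
    and P: "P \<in> \<Gamma>" and M: "M \<in> \<Delta>"
  shows "(\<Sum>Q\<in>\<Gamma>. \<alpha> P Q * cinner B (v Q) (w M)) = (\<Sum>Q\<in>\<Delta>. cinner B (v P) (w Q) * \<beta> Q M)"
proof -
  have "(\<Sum>Q\<in>\<Gamma>. \<alpha> P Q * cinner B (v Q) (w M)) = (\<Sum>Q\<in>\<Gamma>. \<Sum>a\<in>B. cnj (\<alpha>' Q P * v Q a) * w M a)"
    by (intro sum.cong refl) (simp add: cinner_def sum_distrib_left adj'[OF P] mult.assoc)
  also have "\<dots> = (\<Sum>a\<in>B. cnj (\<Sum>Q\<in>\<Gamma>. \<alpha>' Q P * v Q a) * w M a)"
    by (subst sum.swap) (simp add: sum_distrib_right)
  also have "\<dots> = (\<Sum>a\<in>B. cnj (\<Sum>b\<in>B. A' a b * v P b) * w M a)"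
    using intertwinesD[OF v P] by (intro sum.cong refl) simp
  also have "\<dots> = (\<Sum>a\<in>B. \<Sum>b\<in>B. cnj (v P b) * (A b a * w M a))"
    by (intro sum.cong refl) (simp add: sum_distrib_right adj mult.assoc mult.left_commute)
  also have "\<dots> = (\<Sum>b\<in>B. cnj (v P b) * (\<Sum>a\<in>B. A b a * w M a))"
    by (subst sum.swap) (simp add: sum_distrib_left)
  also have "\<dots> = (\<Sum>b\<in>B. cnj (v P b) * (\<Sum>Q\<in>\<Delta>. \<beta> Q M * w Q b))"
    using intertwinesD[OF w M] by (intro sum.cong refl) simp
  also have "\<dots> = (\<Sum>Q\<in>\<Delta>. \<Sum>b\<in>B. cnj (v P b) * w Q b * \<beta> Q M)"
    by (subst sum.swap) (simp add: sum_distrib_left mult.assoc mult.commute mult.left_commute)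
  also have "\<dots> = (\<Sum>Q\<in>\<Delta>. cinner B (v P) (w Q) * \<beta> Q M)"
    by (simp add: cinner_def sum_distrib_right)
  finally show ?thesis .
qed

lemma gram_gt_map:
  assumes adj: "adjoint_gens m B U D H"
    and v: "gt_map m B U D H lam v" and w: "gt_map m B U D H lam' w"
    and l: "l \<in> {1..<m}" and P: "P \<in> GT m lam" and M: "M \<in> GT m lam'"
  shows "(\<Sum>Q\<in>GT m lam. gt_up m lam l P Q * cinner B (v Q) (w M)) = (\<Sum>Q\<in>GT m lam'. cinner B (v P) (w Q) * gt_up m lam' l Q M)"
    and "(\<Sum>Q\<in>GT m lam. gt_down m lam l P Q * cinner B (v Q) (w M)) = (\<Sum>Q\<in>GT m lam'. cinner B (v P) (w Q) * gt_down m lam' l Q M)"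
    and "(\<Sum>Q\<in>GT m lam. gt_h m lam l P Q * cinner B (v Q) (w M)) = (\<Sum>Q\<in>GT m lam'. cinner B (v P) (w Q) * gt_h m lam' l Q M)"
proof -
  have f: "finite B" "\<And>a b. a \<in> B \<Longrightarrow> b \<in> B \<Longrightarrow> D l a b = cnj (U l b a)"
    "\<And>a b. a \<in> B \<Longrightarrow> b \<in> B \<Longrightarrow> H l a b = cnj (H l b a)"
    using adj l unfolding adjoint_gens_def by blast+
  have f': "U l a b = cnj (D l b a)" if "a \<in> B" "b \<in> B" for a b
    using f(2)[OF that(2,1)] by simp
  have v': "intertwines B (U l) (GT m lam) (gt_up m lam l) v" "intertwines B (D l) (GT m lam) (gt_down m lam l) v"
    "intertwines B (H l) (GT m lam) (gt_h m lam l) v"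
    using v l unfolding gt_map_def by blast+
  have w': "intertwines B (U l) (GT m lam') (gt_up m lam' l) w" "intertwines B (D l) (GT m lam') (gt_down m lam' l) w"
    "intertwines B (H l) (GT m lam') (gt_h m lam' l) w"
    using w l unfolding gt_map_def by blast+
  show "(\<Sum>Q\<in>GT m lam. gt_up m lam l P Q * cinner B (v Q) (w M)) = (\<Sum>Q\<in>GT m lam'. cinner B (v P) (w Q) * gt_up m lam' l Q M)"
    by (rule gram_intertwines[OF f(1) f(2) gt_down_cnj(1) v'(2) w'(1) P M])
  show "(\<Sum>Q\<in>GT m lam. gt_down m lam l P Q * cinner B (v Q) (w M)) = (\<Sum>Q\<in>GT m lam'. cinner B (v P) (w Q) * gt_down m lam' l Q M)"
    by (rule gram_intertwines[OF f(1) f' gt_down_cnj(2) v'(1) w'(2) P M])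
  show "(\<Sum>Q\<in>GT m lam. gt_h m lam l P Q * cinner B (v Q) (w M)) = (\<Sum>Q\<in>GT m lam'. cinner B (v P) (w Q) * gt_h m lam' l Q M)"
    by (rule gram_intertwines[OF f(1) f(3) gt_h_cnj v'(3) w'(3) P M])
qed

lemma gram_scalar:
  assumes adj: "adjoint_gens m B U D H" and mx: "max_pat m lam \<in> GT m lam"
    and v: "gt_map m B U D H lam v" and w: "gt_map m B U D H lam w"
    and P: "P \<in> GT m lam" and M: "M \<in> GT m lam"
  shows "cinner B (v P) (w M) = (if P = M then cinner B (v (max_pat m lam)) (w (max_pat m lam)) else 0)"
  by (rule gt_schur_scalar[where G = "\<lambda>P M. cinner B (v P) (w M)"])
    (use gram_gt_map[OF adj v w] mx P M in auto)

lemma sum_gt_wt_diff: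
  assumes "1 \<le> m"
  shows "(\<Sum>l\<in>{1..<m}. gt_wt M l - gt_wt M (l+1)) = gt_wt M 1 - gt_wt M m"
  using assms by (induction m rule: dec_induct) auto

text \<open>Cartan generators see only differences of consecutive weights. Their telescoped sum,
  first minus last weight, is the number that tells the irreps \<open>lam_k m k\<close>
  apart.\<close>

lemma gt_wt_max_pat_lam_k:
  assumes "m \<ge> 2"
  shows "gt_wt (max_pat m (lam_k m k)) 1 - gt_wt (max_pat m (lam_k m k)) m = 2 * int k"
proof -
  have "gt_wt (max_pat m (lam_k m k)) 1 = 2 * int k"
    using assms by (simp add: gt_wt_def max_pat_def lam_k_def)
  moreover have "gt_wt (max_pat m (lam_k m k)) m = 0"
  proof -
    have "{1..m} = insert m {1..<m}" using assms by auto
    then have "(\<Sum>i\<in>{1..m}. int (max_pat m (lam_k m k) i m)) = (\<Sum>i\<in>{1..<m}. int (max_pat m (lam_k m k) i m))"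
      using assms by (simp add: max_pat_def lam_k_def)
    also have "\<dots> = (\<Sum>i\<in>{1..<m}. int (max_pat m (lam_k m k) i (m - 1)))"
      by (intro sum.cong) (auto simp: max_pat_def)
    finally show ?thesis by (simp add: gt_wt_def)
  qed
  ultimately show ?thesis by simp
qed

lemma gt_wt_bounds:
  assumes M: "M \<in> GT m lam" and "1 \<le> m"
  shows "gt_wt M 1 \<le> int (lam 1)" "0 \<le> gt_wt M m"
proof -
  have "M 1 1 \<le> M 1 m" by (rule GT_mono_level[OF M]) (use assms in auto)
  then show "gt_wt M 1 \<le> int (lam 1)" using GT_top[OF M, of 1] assms(2) by (simp add: gt_wt_def)
  have "(\<Sum>i\<in>{1..<m}. int (M i (m - 1))) \<le> (\<Sum>i\<in>{1..<m}. int (M i m))"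
    by (intro sum_mono) (use GT_mono_level[OF M, of _ "m - 1" m] in auto)
  also have "\<dots> \<le> (\<Sum>i\<in>{1..m}. int (M i m))" by (intro sum_mono2) auto
  finally show "0 \<le> gt_wt M m" by (simp add: gt_wt_def)
qed

text \<open>The two highest-weight vectors have different Cartan eigenvalues, since these add up to
  2k and 2k'. So the top entry of the Gram matrix vanishes, and Schur's lemma does the rest.\<close>

lemma gram_lam_k_neq:
  assumes m: "m \<ge> 2" and adj: "adjoint_gens m B U D H" and "k \<noteq> k'"
    and v: "gt_map m B U D H (lam_k m k) v" and w: "gt_map m B U D H (lam_k m k') w"
    and P: "P \<in> GT m (lam_k m k)" and M: "M \<in> GT m (lam_k m k')"
  shows "cinner B (v P) (w M) = 0"
proof (rule gt_schur_zero[where G = "\<lambda>P M. cinner B (v P) (w M)" and lam = "lam_k m k'" and lam' = "lam_k m k" and m = m])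
  let ?a = "max_pat m (lam_k m k)" and ?b = "max_pat m (lam_k m k')"
  show "cinner B (v ?a) (w ?b) = 0"
  proof (rule ccontr)
    assume ne: "cinner B (v ?a) (w ?b) \<noteq> 0"
    have "gt_wt ?a l - gt_wt ?a (l+1) = gt_wt ?b l - gt_wt ?b (l+1)" if l: "l \<in> {1..<m}" for l
    proof -
      have "(\<Sum>Q\<in>GT m (lam_k m k). gt_h m (lam_k m k) l ?a Q * cinner B (v Q) (w ?b))
          = of_int (gt_wt ?a l - gt_wt ?a (l+1)) * cinner B (v ?a) (w ?b)"
      proof -
        have "(\<Sum>Q\<in>GT m (lam_k m k). gt_h m (lam_k m k) l ?a Q * cinner B (v Q) (w ?b))
          = (\<Sum>Q\<in>{?a}. gt_h m (lam_k m k) l ?a Q * cinner B (v Q) (w ?b))"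
          by (rule sum.mono_neutral_right) (use m in \<open>auto simp: gt_h_def\<close>)
        then show ?thesis using m by (simp add: gt_h_def)
      qed
      moreover have "(\<Sum>Q\<in>GT m (lam_k m k'). cinner B (v ?a) (w Q) * gt_h m (lam_k m k') l Q ?b)
          = cinner B (v ?a) (w ?b) * of_int (gt_wt ?b l - gt_wt ?b (l+1))"
      proof -
        have "(\<Sum>Q\<in>GT m (lam_k m k'). cinner B (v ?a) (w Q) * gt_h m (lam_k m k') l Q ?b)
          = (\<Sum>Q\<in>{?b}. cinner B (v ?a) (w Q) * gt_h m (lam_k m k') l Q ?b)"
          by (rule sum.mono_neutral_right) (use m in \<open>auto simp: gt_h_def\<close>)
        then show ?thesis using m by (simp add: gt_h_def)
      qed
      ultimately have "(of_int (gt_wt ?a l - gt_wt ?a (l+1)) :: complex) * cinner B (v ?a) (w ?b)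
          = of_int (gt_wt ?b l - gt_wt ?b (l+1)) * cinner B (v ?a) (w ?b)"
        using gram_gt_map(3)[OF adj v w l max_pat_lam_k[OF m] max_pat_lam_k[OF m]] by (simp only: mult.commute)
      then show ?thesis using ne by (simp only: mult_cancel_right of_int_eq_iff) simp
    qed
    then have "(\<Sum>l\<in>{1..<m}. gt_wt ?a l - gt_wt ?a (l+1)) = (\<Sum>l\<in>{1..<m}. gt_wt ?b l - gt_wt ?b (l+1))"
      by (intro sum.cong) auto
    then show False using sum_gt_wt_diff[of m ?a] sum_gt_wt_diff[of m ?b] gt_wt_max_pat_lam_k[OF m, of k]
        gt_wt_max_pat_lam_k[OF m, of k'] m \<open>k \<noteq> k'\<close> by simp
  qed
qed (use gram_gt_map[OF adj v w] m P M in auto)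

section \<open>Orthonormal families, spans and orthogonal projections\<close>

lemma cinner_self_eq_0:
  assumes "finite B" "cinner B x x = 0" "a \<in> B"
  shows "x a = 0"
proof -
  have "cinner B x x = complex_of_real (\<Sum>a\<in>B. (cmod (x a))\<^sup>2)"
    by (simp add: cinner_def complex_norm_square mult.commute flip: of_real_power)
  then have "(\<Sum>a\<in>B. (cmod (x a))\<^sup>2) = 0" using assms(2) by (metis of_real_eq_0_iff)
  then show ?thesis using assms by (subst (asm) sum_nonneg_eq_0_iff) auto
qed

lemma cspan_orthonormal:
  assumes fin: "finite \<Gamma>"
    and on: "\<And>M M'. M \<in> \<Gamma> \<Longrightarrow> M' \<in> \<Gamma> \<Longrightarrow> cinner B (e M) (e M') = (if M = M' then 1 else 0)"
    and x: "x \<in> cspan (e ` \<Gamma>)"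
  shows "x a = (\<Sum>M\<in>\<Gamma>. cinner B (e M) x * e M a)"
proof -
  have inj: "inj_on e \<Gamma>"
  proof (rule inj_onI)
    fix M P assume "M \<in> \<Gamma>" "P \<in> \<Gamma>" "e M = e P"
    then show "M = P" using on[of M M] on[of M P] by (auto split: if_splits)
  qed
  obtain F c where F: "finite F" "F \<subseteq> e ` \<Gamma>" and xe: "x = (\<lambda>a. \<Sum>v\<in>F. c v * v a)"
    using x unfolding cspan_def by blast
  obtain \<Delta> where \<Delta>: "\<Delta> \<subseteq> \<Gamma>" "F = e ` \<Delta>" using F(2) by (meson subset_imageE)
  define d where "d M = (if M \<in> \<Delta> then c (e M) else 0)" for M
  have xd: "x a = (\<Sum>M\<in>\<Gamma>. d M * e M a)" for a
  proof -
    have "x a = (\<Sum>M\<in>\<Delta>. c (e M) * e M a)"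
      unfolding xe \<Delta>(2) using inj_on_subset[OF inj \<Delta>(1)] by (simp add: sum.reindex)
    also have "\<dots> = (\<Sum>M\<in>\<Gamma>. d M * e M a)"
      using \<Delta>(1) fin by (intro sum.mono_neutral_cong_left) (auto simp: d_def)
    finally show ?thesis .
  qed
  have "cinner B (e M) x = d M" if M: "M \<in> \<Gamma>" for M
  proof -
    have "cinner B (e M) x = (\<Sum>P\<in>\<Gamma>. d P * cinner B (e M) (e P))"
      unfolding cinner_def xd sum_distrib_left by (subst sum.swap) (simp add: ac_simps)
    also have "\<dots> = (\<Sum>P\<in>\<Gamma>. d P * (if M = P then 1 else 0))"
      using on[OF M] by (intro sum.cong) auto
    also have "\<dots> = d M" using fin M by (simp add: sum_mult_delta)
    finally show ?thesis .
  qed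
  then show ?thesis unfolding xd[of a] by (intro sum.cong refl) simp
qed

text \<open>\<open>cspan\<close> sums over a set of vectors, not over indices; this is the reason
  for injectivity and for transporting the coefficients along the inverse of
  \<open>e\<close>.\<close>

lemma cspan_sum:
  assumes "finite \<Gamma>" "\<And>M. M \<in> \<Gamma> \<Longrightarrow> e M \<in> S" "inj_on e \<Gamma>"
  shows "(\<lambda>a. \<Sum>M\<in>\<Gamma>. d M * e M a) \<in> cspan S"
proof -
  have "(\<Sum>M\<in>\<Gamma>. d M * e M a) = (\<Sum>v\<in>e ` \<Gamma>. d (the_inv_into \<Gamma> e v) * v a)" for a
    unfolding sum.reindex[OF assms(3)] comp_def
  proof (intro sum.cong refl)
    fix M assume M: "M \<in> \<Gamma>"
    show "d M * e M a = d (the_inv_into \<Gamma> e (e M)) * e M a"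
      unfolding the_inv_into_f_f[OF assms(3) M] ..
  qed
  moreover have "finite (e ` \<Gamma>)" using assms(1) by (rule finite_imageI)
  moreover have "e ` \<Gamma> \<subseteq> S" using assms(2) by (rule image_subsetI)
  ultimately show ?thesis unfolding cspan_def mem_Collect_eq by (intro exI conjI ext) assumption+
qed

text \<open>\<open>oproj\<close> is a definite description, so existence and uniqueness are both
  needed: the Fourier sum has an orthogonal remainder, and any other candidate has the same Fourier
  coefficients.\<close>

lemma oproj_orthonormal:
  assumes fin: "finite \<Gamma>"
    and on: "\<And>M M'. M \<in> \<Gamma> \<Longrightarrow> M' \<in> \<Gamma> \<Longrightarrow> cinner B (e M) (e M') = (if M = M' then 1 else 0)"
  shows "oproj B (cspan (e ` \<Gamma>)) x = (\<lambda>a. \<Sum>M\<in>\<Gamma>. cinner B (e M) x * e M a)"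
proof -
  let ?y = "\<lambda>a. \<Sum>M\<in>\<Gamma>. cinner B (e M) x * e M a"
  have inj: "inj_on e \<Gamma>"
  proof (rule inj_onI)
    fix M P assume "M \<in> \<Gamma>" "P \<in> \<Gamma>" "e M = e P"
    then show "M = P" using on[of M M] on[of M P] by (auto split: if_splits)
  qed
  have diff: "cinner B z (\<lambda>a. x a - y a) = cinner B z x - cinner B z y" for z y
    by (simp add: cinner_def right_diff_distrib sum_subtractf)
  have ip: "cinner B (e M) ?y = cinner B (e M) x" if M: "M \<in> \<Gamma>" for M
  proof -
    have "cinner B (e M) ?y = (\<Sum>P\<in>\<Gamma>. cinner B (e P) x * cinner B (e M) (e P))"
      unfolding cinner_def sum_distrib_left by (subst sum.swap) (simp add: ac_simps)
    also have "\<dots> = (\<Sum>P\<in>\<Gamma>. cinner B (e P) x * (if M = P then 1 else 0))"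
      using on[OF M] by (intro sum.cong) auto
    finally show ?thesis using fin M by (simp add: sum_mult_delta)
  qed
  have mem: "e M \<in> cspan (e ` \<Gamma>)" if "M \<in> \<Gamma>" for M
    using cspan_sum[of "{M}" e "e ` \<Gamma>" "\<lambda>_. 1"] that by simp
  show ?thesis unfolding oproj_def
  proof (rule the_equality, safe)
    show "?y \<in> cspan (e ` \<Gamma>)" by (rule cspan_sum) (use fin inj in auto)
  next
    fix z assume z: "z \<in> cspan (e ` \<Gamma>)"
    have "cinner B z w = (\<Sum>M\<in>\<Gamma>. cnj (cinner B (e M) z) * cinner B (e M) w)" for w
    proof -
      have za: "z a = (\<Sum>M\<in>\<Gamma>. cinner B (e M) z * e M a)" for a
        by (rule cspan_orthonormal[OF fin on z])
      have "cinner B z w = (\<Sum>a\<in>B. cnj (\<Sum>M\<in>\<Gamma>. cinner B (e M) z * e M a) * w a)"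
        unfolding cinner_def[of B z w] by (intro sum.cong refl arg_cong2[where f = "(*)"] arg_cong[where f = cnj] za)
      also have "\<dots> = (\<Sum>M\<in>\<Gamma>. cnj (cinner B (e M) z) * cinner B (e M) w)"
        unfolding cinner_def cnj_sum sum_distrib_right sum_distrib_left by (subst sum.swap) (simp add: ac_simps)
      finally show ?thesis .
    qed
    then show "cinner B z (\<lambda>a. x a - ?y a) = 0" unfolding diff using ip by simp
  next
    fix y assume y: "y \<in> cspan (e ` \<Gamma>)" and orth: "\<forall>z\<in>cspan (e ` \<Gamma>). cinner B z (\<lambda>a. x a - y a) = 0"
    have "cinner B (e M) x = cinner B (e M) y" if "M \<in> \<Gamma>" for M
      using orth mem[OF that] unfolding diff by auto
    then have "?y a = (\<Sum>M\<in>\<Gamma>. cinner B (e M) y * e M a)" for a by simp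
    then show "y = ?y" using cspan_orthonormal[OF fin on y] by (metis (no_types, lifting))
  qed
qed

section \<open>Tensor products, adjoints and contractions of intertwiners\<close>

definition tprod :: "('a \<Rightarrow> 'a \<Rightarrow> complex) \<Rightarrow> ('b \<Rightarrow> 'b \<Rightarrow> complex) \<Rightarrow> 'a \<times> 'b \<Rightarrow> 'a \<times> 'b \<Rightarrow> complex" where
  "tprod A1 A2 = (\<lambda>(a, b) (a', b'). A1 a a' * (if b = b' then 1 else 0) + (if a = a' then 1 else 0) * A2 b b')"

lemma tens_mat_eq_tprod: "tens_mat A = tprod A A"
  by (simp add: tens_mat_def tprod_def)

text \<open>The commutator action is the tensor action with the dual, minus the transpose, in the
  second factor.\<close>

lemma ad_mat_eq_tprod: "ad_mat A = tprod A (\<lambda>x y. - A y x)"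
  by (auto simp: ad_mat_def tprod_def fun_eq_iff)

lemma sum_tprod:
  assumes "finite B1" "finite B2" "a \<in> B1" "b \<in> B2"
  shows "(\<Sum>z\<in>B1 \<times> B2. tprod A1 A2 (a, b) z * f z) = (\<Sum>a'\<in>B1. A1 a a' * f (a', b)) + (\<Sum>b'\<in>B2. A2 b b' * f (a, b'))"
proof -
  have "(\<Sum>z\<in>B1 \<times> B2. tprod A1 A2 (a, b) z * f z) = (\<Sum>a'\<in>B1. \<Sum>b'\<in>B2. tprod A1 A2 (a, b) (a', b') * f (a', b'))"
    by (simp add: sum.cartesian_product case_prod_beta)
  also have "\<dots> = (\<Sum>a'\<in>B1. \<Sum>b'\<in>B2. (A1 a a' * f (a', b')) * (if b = b' then 1 else 0))
      + (\<Sum>b'\<in>B2. \<Sum>a'\<in>B1. (A2 b b' * f (a', b')) * (if a = a' then 1 else 0))"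
    by (subst (3) sum.swap) (simp add: tprod_def distrib_left distrib_right sum.distrib ac_simps)
  also have "\<dots> = (\<Sum>a'\<in>B1. A1 a a' * f (a', b)) + (\<Sum>b'\<in>B2. A2 b b' * f (a, b'))"
    using assms by (simp add: sum_mult_delta)
  finally show ?thesis .
qed

lemma adjoint_gens_tprod:
  assumes "adjoint_gens m B1 U1 D1 H1" "adjoint_gens m B2 U2 D2 H2"
  shows "adjoint_gens m (B1 \<times> B2) (\<lambda>l. tprod (U1 l) (U2 l)) (\<lambda>l. tprod (D1 l) (D2 l)) (\<lambda>l. tprod (H1 l) (H2 l))"
proof -
  have "D l a b = cnj (U l b a)" "cnj (H l b a) = H l a b"
    if "adjoint_gens m B U D H" "l \<in> {1..<m}" "a \<in> B" "b \<in> B"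
    for B :: "'c set" and U D H l a b
    using that unfolding adjoint_gens_def by metis+
  note * = this[OF assms(1)] this[OF assms(2)]
  show ?thesis
    using assms unfolding adjoint_gens_def[of m "B1 \<times> B2"]
    by (auto simp: tprod_def * adjoint_gens_def[THEN iffD1, THEN conjunct1])
qed

lemma adjoint_gens_GT: "adjoint_gens m (GT m lam) (gt_up m lam) (gt_down m lam) (gt_h m lam)"
  unfolding adjoint_gens_def by (blast intro: finite_GT gt_down_cnj gt_h_cnj)

lemma adjoint_gens_tens:
  "adjoint_gens m (tens_B m lam) (\<lambda>j. tens_mat (gt_up m lam j)) (\<lambda>j. tens_mat (gt_down m lam j)) (\<lambda>j. tens_mat (gt_h m lam j))"
  unfolding tens_mat_eq_tprod tens_B_def by (intro adjoint_gens_tprod adjoint_gens_GT)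

text \<open>Composition of intertwiners: \<open>W\<close> couples two pattern labels to one, and X
  (x) X carries pairs of patterns into \<open>B \<times> B\<close>.\<close>

lemma intertwines_tensor:
  assumes fin: "finite B" "finite \<Gamma>"
    and X: "intertwines B A \<Gamma> \<alpha> X" and W: "intertwines (\<Gamma> \<times> \<Gamma>) (tprod \<alpha> \<alpha>) \<Delta> \<beta> W"
  shows "intertwines (B \<times> B) (tprod A A) \<Delta> \<beta> (\<lambda>R (a, b). \<Sum>M\<in>\<Gamma>. \<Sum>M'\<in>\<Gamma>. W R (M, M') * X M a * X M' b)"
  unfolding intertwines_def
proof (intro ballI)
  fix R z assume R: "R \<in> \<Delta>" and "z \<in> B \<times> B"
  then obtain a b where z: "z = (a, b)" and a: "a \<in> B" and b: "b \<in> B" by auto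
  let ?w = "\<lambda>R (a, b). \<Sum>M\<in>\<Gamma>. \<Sum>M'\<in>\<Gamma>. W R (M, M') * X M a * X M' b"
  have 1: "(\<Sum>a'\<in>B. A a a' * ?w R (a', b)) = (\<Sum>P\<in>\<Gamma>. \<Sum>M'\<in>\<Gamma>. (\<Sum>M\<in>\<Gamma>. \<alpha> P M * W R (M, M')) * X P a * X M' b)"
  proof -
    have "(\<Sum>a'\<in>B. A a a' * ?w R (a', b)) = (\<Sum>a'\<in>B. \<Sum>M\<in>\<Gamma>. \<Sum>M'\<in>\<Gamma>. W R (M, M') * X M' b * (A a a' * X M a'))"
      by (simp add: sum_distrib_left ac_simps)
    also have "\<dots> = (\<Sum>M\<in>\<Gamma>. \<Sum>M'\<in>\<Gamma>. W R (M, M') * X M' b * (\<Sum>a'\<in>B. A a a' * X M a'))"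
      by (subst sum.swap, rule sum.cong[OF refl], subst sum.swap) (simp add: sum_distrib_left)
    also have "\<dots> = (\<Sum>M\<in>\<Gamma>. \<Sum>M'\<in>\<Gamma>. W R (M, M') * X M' b * (\<Sum>P\<in>\<Gamma>. \<alpha> P M * X P a))"
      using intertwinesD[OF X _ a] by (intro sum.cong refl) simp
    also have "\<dots> = (\<Sum>M'\<in>\<Gamma>. \<Sum>M\<in>\<Gamma>. \<Sum>P\<in>\<Gamma>. W R (M, M') * X M' b * \<alpha> P M * X P a)"
      by (subst sum.swap) (simp add: sum_distrib_left ac_simps)
    also have "\<dots> = (\<Sum>M'\<in>\<Gamma>. \<Sum>P\<in>\<Gamma>. (\<Sum>M\<in>\<Gamma>. \<alpha> P M * W R (M, M')) * X P a * X M' b)"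
      by (rule sum.cong[OF refl], subst sum.swap) (simp add: sum_distrib_left sum_distrib_right ac_simps)
    finally show ?thesis by (subst sum.swap) simp
  qed
  have 2: "(\<Sum>b'\<in>B. A b b' * ?w R (a, b')) = (\<Sum>M\<in>\<Gamma>. \<Sum>P\<in>\<Gamma>. (\<Sum>M'\<in>\<Gamma>. \<alpha> P M' * W R (M, M')) * X M a * X P b)"
  proof -
    have "(\<Sum>b'\<in>B. A b b' * ?w R (a, b')) = (\<Sum>b'\<in>B. \<Sum>M\<in>\<Gamma>. \<Sum>M'\<in>\<Gamma>. W R (M, M') * X M a * (A b b' * X M' b'))"
      by (simp add: sum_distrib_left ac_simps)
    also have "\<dots> = (\<Sum>M\<in>\<Gamma>. \<Sum>M'\<in>\<Gamma>. W R (M, M') * X M a * (\<Sum>b'\<in>B. A b b' * X M' b'))"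
      by (subst sum.swap, rule sum.cong[OF refl], subst sum.swap) (simp add: sum_distrib_left)
    also have "\<dots> = (\<Sum>M\<in>\<Gamma>. \<Sum>M'\<in>\<Gamma>. W R (M, M') * X M a * (\<Sum>P\<in>\<Gamma>. \<alpha> P M' * X P b))"
      using intertwinesD[OF X _ b] by (intro sum.cong refl) simp
    also have "\<dots> = (\<Sum>M\<in>\<Gamma>. \<Sum>M'\<in>\<Gamma>. \<Sum>P\<in>\<Gamma>. W R (M, M') * X M a * \<alpha> P M' * X P b)"
      by (simp add: sum_distrib_left ac_simps)
    also have "\<dots> = (\<Sum>M\<in>\<Gamma>. \<Sum>P\<in>\<Gamma>. (\<Sum>M'\<in>\<Gamma>. \<alpha> P M' * W R (M, M')) * X M a * X P b)"
      by (rule sum.cong[OF refl], subst sum.swap) (simp add: sum_distrib_left sum_distrib_right ac_simps)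
    finally show ?thesis .
  qed
  have "(\<Sum>y\<in>B \<times> B. tprod A A z y * ?w R y) = (\<Sum>P\<in>\<Gamma>. \<Sum>P'\<in>\<Gamma>.
      ((\<Sum>M\<in>\<Gamma>. \<alpha> P M * W R (M, P')) + (\<Sum>M'\<in>\<Gamma>. \<alpha> P' M' * W R (P, M'))) * X P a * X P' b)"
    unfolding z sum_tprod[OF fin(1) fin(1) a b] 1 2 by (simp add: distrib_right sum.distrib)
  also have "\<dots> = (\<Sum>P\<in>\<Gamma>. \<Sum>P'\<in>\<Gamma>. (\<Sum>y\<in>\<Gamma> \<times> \<Gamma>. tprod \<alpha> \<alpha> (P, P') y * W R y) * X P a * X P' b)"
    using fin by (intro sum.cong refl) (simp add: sum_tprod)
  also have "\<dots> = (\<Sum>P\<in>\<Gamma>. \<Sum>P'\<in>\<Gamma>. (\<Sum>R'\<in>\<Delta>. \<beta> R' R * W R' (P, P')) * X P a * X P' b)"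
    using intertwinesD[OF W R] by (intro sum.cong refl) simp
  also have "\<dots> = (\<Sum>R'\<in>\<Delta>. \<Sum>P\<in>\<Gamma>. \<Sum>P'\<in>\<Gamma>. \<beta> R' R * W R' (P, P') * X P a * X P' b)"
    unfolding sum_distrib_right
    by (subst (2) sum.swap, subst sum.swap) simp
  also have "\<dots> = (\<Sum>R'\<in>\<Delta>. \<beta> R' R * ?w R' z)"
    unfolding z by (simp add: sum_distrib_left mult.assoc)
  finally show "(\<Sum>y\<in>B \<times> B. tprod A A z y * ?w R y) = (\<Sum>R'\<in>\<Delta>. \<beta> R' R * ?w R' z)" .
qed

text \<open>The adjoint of an intertwiner is one too, so this is the preceding lemma with
  \<open>cnj (X M a)\<close> read as a family indexed by \<open>B\<close> with values on
  patterns.\<close>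

lemma intertwines_cotensor:
  assumes fin: "finite B" "finite \<Gamma>"
    and adj: "\<And>a b. a \<in> B \<Longrightarrow> b \<in> B \<Longrightarrow> A' a b = cnj (A b a)"
    and adj': "\<And>P Q. P \<in> \<Gamma> \<Longrightarrow> Q \<in> \<Gamma> \<Longrightarrow> \<alpha>' Q P = cnj (\<alpha> P Q)"
    and X: "intertwines B A' \<Gamma> \<alpha>' X" and y: "intertwines (B \<times> B) (tprod A A) \<Delta> \<beta> y"
  shows "intertwines (\<Gamma> \<times> \<Gamma>) (tprod \<alpha> \<alpha>) \<Delta> \<beta> (\<lambda>R (M, M'). \<Sum>a\<in>B. \<Sum>b\<in>B. cnj (X M a) * cnj (X M' b) * y R (a, b))"
proof -
  let ?Y = "\<lambda>a M. cnj (X M a)"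
  have Y: "intertwines \<Gamma> \<alpha> B A ?Y"
    unfolding intertwines_def
  proof (intro ballI)
    fix a M assume a: "a \<in> B" and M: "M \<in> \<Gamma>"
    have "(\<Sum>P\<in>\<Gamma>. \<alpha> M P * cnj (X P a)) = cnj (\<Sum>P\<in>\<Gamma>. \<alpha>' P M * X P a)"
      by (simp add: adj' M)
    also have "\<dots> = cnj (\<Sum>b\<in>B. A' a b * X M b)" using intertwinesD[OF X M a] by simp
    also have "\<dots> = (\<Sum>b\<in>B. A b a * cnj (X M b))" by (simp add: adj a)
    finally show "(\<Sum>P\<in>\<Gamma>. \<alpha> M P * cnj (X P a)) = (\<Sum>b\<in>B. A b a * cnj (X M b))" .
  qed
  have "(\<lambda>R (M, M'). \<Sum>a\<in>B. \<Sum>b\<in>B. cnj (X M a) * cnj (X M' b) * y R (a, b)) =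
      (\<lambda>R (a, b). \<Sum>M\<in>B. \<Sum>M'\<in>B. y R (M, M') * cnj (X a M) * cnj (X b M'))"
    by (simp add: ac_simps)
  then show ?thesis using intertwines_tensor[OF fin(2) fin(1) Y y] by simp
qed

text \<open>An invariant of V1 (x) V* is a map V -> V1. Pairing its dual slot with a family in V
  evaluates that map, hence yields an equivariant family in V1.\<close>

lemma intertwines_contract:
  assumes fin: "finite B1" "finite B"
    and X: "intertwines B A \<Gamma> \<alpha> X"
    and y: "\<And>z. z \<in> B1 \<times> B \<Longrightarrow> (\<Sum>z'\<in>B1 \<times> B. tprod A1 (\<lambda>c c'. - A c' c) z z' * y z') = 0"
  shows "intertwines B1 A1 \<Gamma> \<alpha> (\<lambda>R a. \<Sum>c\<in>B. X R c * y (a, c))"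
  unfolding intertwines_def
proof (intro ballI)
  fix R a assume R: "R \<in> \<Gamma>" and a: "a \<in> B1"
  have e: "(\<Sum>a'\<in>B1. A1 a a' * y (a', c)) = (\<Sum>c'\<in>B. A c' c * y (a, c'))" if c: "c \<in> B" for c
    using y[of "(a, c)"] a c sum_tprod[OF fin a c, of A1 "\<lambda>c c'. - A c' c" y] by (simp add: sum_negf)
  have "(\<Sum>a'\<in>B1. A1 a a' * (\<Sum>c\<in>B. X R c * y (a', c))) = (\<Sum>c\<in>B. X R c * (\<Sum>a'\<in>B1. A1 a a' * y (a', c)))"
    unfolding sum_distrib_left by (subst sum.swap) (simp add: ac_simps)
  also have "\<dots> = (\<Sum>c\<in>B. X R c * (\<Sum>c'\<in>B. A c' c * y (a, c')))" using e by simp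
  also have "\<dots> = (\<Sum>c'\<in>B. (\<Sum>c\<in>B. A c' c * X R c) * y (a, c'))"
    unfolding sum_distrib_left sum_distrib_right by (subst sum.swap) (simp add: ac_simps)
  also have "\<dots> = (\<Sum>c'\<in>B. (\<Sum>R'\<in>\<Gamma>. \<alpha> R' R * X R' c') * y (a, c'))"
    using intertwinesD[OF X R] by simp
  also have "\<dots> = (\<Sum>R'\<in>\<Gamma>. \<alpha> R' R * (\<Sum>c\<in>B. X R' c * y (a, c)))"
    unfolding sum_distrib_left sum_distrib_right by (subst sum.swap) (simp add: ac_simps)
  finally show "(\<Sum>a'\<in>B1. A1 a a' * (\<Sum>c\<in>B. X R c * y (a', c))) = (\<Sum>R'\<in>\<Gamma>. \<alpha> R' R * (\<Sum>c\<in>B. X R' c * y (a, c)))" .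
qed

text \<open>Converse of contraction: a map V -> V1 given on a basis becomes an invariant by
  attaching the conjugated basis. The two actions cancel because the generators are adjoint to each
  other on both sides.\<close>

lemma invariant_of_intertwines:
  assumes fin: "finite B1" "finite B" "finite \<Gamma>"
    and adj: "\<And>a b. a \<in> B \<Longrightarrow> b \<in> B \<Longrightarrow> A' a b = cnj (A b a)"
    and adj': "\<And>P Q. P \<in> \<Gamma> \<Longrightarrow> Q \<in> \<Gamma> \<Longrightarrow> \<alpha>' Q P = cnj (\<alpha> P Q)"
    and X: "intertwines B A' \<Gamma> \<alpha>' X" and w: "intertwines B1 A1 \<Gamma> \<alpha> w"
    and z: "z \<in> B1 \<times> B"
  shows "(\<Sum>z'\<in>B1 \<times> B. tprod A1 (\<lambda>c c'. - A c' c) z z' * (case z' of (a, c) \<Rightarrow> \<Sum>R\<in>\<Gamma>. w R a * cnj (X R c))) = 0"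
proof -
  obtain a c where zz: "z = (a, c)" and a: "a \<in> B1" and c: "c \<in> B" using z by auto
  have "(\<Sum>a'\<in>B1. A1 a a' * (\<Sum>R\<in>\<Gamma>. w R a' * cnj (X R c))) = (\<Sum>R\<in>\<Gamma>. (\<Sum>a'\<in>B1. A1 a a' * w R a') * cnj (X R c))"
    unfolding sum_distrib_left sum_distrib_right by (subst sum.swap) (simp add: ac_simps)
  also have "\<dots> = (\<Sum>R\<in>\<Gamma>. \<Sum>R'\<in>\<Gamma>. \<alpha> R' R * w R' a * cnj (X R c))"
    using intertwinesD[OF w _ a] by (simp add: sum_distrib_right)
  also have "\<dots> = (\<Sum>R'\<in>\<Gamma>. \<Sum>R\<in>\<Gamma>. w R' a * cnj (\<alpha>' R R' * X R c))"
    by (subst sum.swap) (simp add: adj' ac_simps)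
  also have "\<dots> = (\<Sum>R'\<in>\<Gamma>. w R' a * cnj (\<Sum>R\<in>\<Gamma>. \<alpha>' R R' * X R c))"
    by (simp add: sum_distrib_left)
  also have "\<dots> = (\<Sum>R'\<in>\<Gamma>. w R' a * cnj (\<Sum>c'\<in>B. A' c c' * X R' c'))"
    using intertwinesD[OF X _ c] by simp
  also have "\<dots> = (\<Sum>c'\<in>B. A c' c * (\<Sum>R\<in>\<Gamma>. w R a * cnj (X R c')))"
    unfolding cnj_sum sum_distrib_left by (subst sum.swap) (simp add: adj c ac_simps)
  finally show ?thesis unfolding zz using sum_tprod[OF fin(1,2) a c] by (simp add: sum_negf)
qed

section \<open>Operators on Fock space\<close>

lemma finite_fock [simp]: "finite (fock m n)"
proof -
  let ?f = "\<lambda>v. restrict v {1..m}"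
  have "inj_on ?f (fock m n)"
  proof (rule inj_onI, rule ext)
    fix v w i assume v: "v \<in> fock m n" and w: "w \<in> fock m n" and eq: "?f v = ?f w"
    show "v i = (w i :: nat)"
    proof (cases "i \<in> {1..m}")
      case True
      then show ?thesis using fun_cong[OF eq, of i] by simp
    next
      case False
      then have "v i = 0" "w i = 0" using v w unfolding fock_def by blast+
      then show ?thesis by simp
    qed
  qed
  moreover have "?f ` fock m n \<subseteq> PiE {1..m} (\<lambda>_. {..n})"
  proof (rule image_subsetI, rule PiE_I)
    fix v i assume v: "v \<in> fock m n" and i: "i \<in> {1..m}"
    have "v i \<le> (\<Sum>i\<in>{1..m}. v i)" by (rule member_le_sum) (use i in auto)
    then show "?f v i \<in> {..n}" using v i by (simp add: fock_def)
  qed auto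
  moreover have "finite (PiE {1..m} (\<lambda>_. {..n}))"
    by (rule finite_PiE) auto
  ultimately show ?thesis by (meson finite_imageD finite_subset)
qed

lemma fock_support: "v \<in> fock m n \<Longrightarrow> i \<notin> {1..m} \<Longrightarrow> v i = 0"
  unfolding fock_def by blast

lemma fock_sum: "v \<in> fock m n \<Longrightarrow> (\<Sum>i\<in>{1..m}. v i) = n"
  unfolding fock_def by blast

lemma finite_om_B [simp]: "finite (om_B m n)"
  by (simp add: om_B_def)

text \<open>Occupation numbers after creation in mode i and annihilation in mode j. Truncated
  subtraction spoils the particle number if \<open>w j = 0\<close>, hence the recurring condition
  \<open>1 \<le> w j\<close>.\<close>

definition hop :: "nat \<Rightarrow> nat \<Rightarrow> (nat \<Rightarrow> nat) \<Rightarrow> nat \<Rightarrow> nat" where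
  "hop i j w = w(i := w i + 1, j := w j - 1)"

lemma hop_apply:
  assumes "i \<noteq> j"
  shows "hop i j w t = (if t = i then w i + 1 else if t = j then w j - 1 else w t)"
  using assms by (simp add: hop_def)

text \<open>With suitable weights \<open>c\<close> this gives particle conservation, the measure of
  \<open>om_highest_zero\<close> and the grading of operators. Terms are balanced on both sides to
  avoid subtraction of naturals.\<close>

lemma sum_hop:
  assumes "i \<noteq> j" "i \<in> {1..m}" "j \<in> {1..m}" "1 \<le> w j"
  shows "(\<Sum>t\<in>{1..m}. c t * hop i j w t) + c j = (\<Sum>t\<in>{1..m}. c t * w t) + (c i :: nat)"
proof -
  have "(\<Sum>t\<in>{1..m}. c t * hop i j w t) + (\<Sum>t\<in>{1..m}. if t = j then c t else 0)
     = (\<Sum>t\<in>{1..m}. c t * w t) + (\<Sum>t\<in>{1..m}. if t = i then c t else 0)"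
    unfolding sum.distrib[symmetric]
  proof (intro sum.cong refl)
    fix t
    have "c j * (w j - Suc 0) + c j = c j * w j" using assms(4) by (cases "w j") auto
    then show "c t * hop i j w t + (if t = j then c t else 0) = c t * w t + (if t = i then c t else 0)"
      using assms(1) by (auto simp: hop_apply)
  qed
  then show ?thesis using assms by simp
qed

lemma hop_in_fock:
  assumes "w \<in> fock m n" "i \<noteq> j" "i \<in> {1..m}" "j \<in> {1..m}" "1 \<le> w j"
  shows "hop i j w \<in> fock m n"
proof -
  have "(\<Sum>t\<in>{1..m}. hop i j w t) = n"
    using sum_hop[of i j m w "\<lambda>_. 1"] fock_sum[OF assms(1)] assms(2-5) by simp
  moreover have "\<forall>t. hop i j w t \<noteq> 0 \<longrightarrow> t \<in> {1..m}"
  proof (intro allI impI, rule ccontr)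
    fix t assume t: "hop i j w t \<noteq> 0" "t \<notin> {1..m}"
    then have "t \<noteq> i" "t \<noteq> j" using assms by auto
    then show False using fock_support[OF assms(1) t(2)] t(1) assms(2) by (simp add: hop_apply)
  qed
  ultimately show ?thesis by (simp add: fock_def)
qed

lemma hop_hop:
  assumes "i \<noteq> j" "1 \<le> w j"
  shows "hop j i (hop i j w) = w"
  using assms by (auto simp: hop_def fun_eq_iff)

lemma adag_a_hop:
  assumes "i \<noteq> j"
  shows "adag_a i j u w = (if 1 \<le> w j \<and> u = hop i j w then complex_of_real (sqrt (real (w j * (w i + 1)))) else 0)"
  using assms by (simp add: adag_a_def hop_def)

lemma adag_a_flip: "adag_a j i u w = adag_a i j w u"
proof (cases "i = j")
  case True
  then show ?thesis by (auto simp: adag_a_def)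
next
  case False
  have iff: "1 \<le> w i \<and> u = hop j i w \<longleftrightarrow> 1 \<le> u j \<and> w = hop i j u"
  proof
    assume a: "1 \<le> w i \<and> u = hop j i w"
    then show "1 \<le> u j \<and> w = hop i j u" using False hop_hop[of j i w] by (auto simp: hop_apply)
  next
    assume a: "1 \<le> u j \<and> w = hop i j u"
    then show "1 \<le> w i \<and> u = hop j i w" using False hop_hop[of i j u] by (auto simp: hop_apply)
  qed
  show ?thesis
  proof (cases "1 \<le> w i \<and> u = hop j i w")
    case True
    then have "w i * (w j + 1) = u j * (u i + 1)" using \<open>i \<noteq> j\<close> by (simp add: hop_apply)
    then show ?thesis using True iff \<open>i \<noteq> j\<close> by (simp only: adag_a_hop[OF \<open>i \<noteq> j\<close>] adag_a_hop[OF \<open>i \<noteq> j\<close>[symmetric]] if_True simp_thms)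
  next
    case no: False
    then show ?thesis using iff False unfolding adag_a_hop[OF \<open>i \<noteq> j\<close>] adag_a_hop[OF \<open>i \<noteq> j\<close>[symmetric]] by argo
  qed
qed

lemma cnj_adag_a [simp]: "cnj (adag_a i j u w) = adag_a i j u w"
  by (simp add: adag_a_def)

lemma om_D_cnj: "om_D l a b = cnj (om_U l b a)" and om_H_cnj: "om_H l a b = cnj (om_H l b a)"
proof -
  obtain u v u' v' where ab: "a = (u, v)" "b = (u', v')" by fastforce
  show "om_D l a b = cnj (om_U l b a)"
    unfolding ab om_D_def om_U_def ad_mat_def
    using adag_a_flip[of "l+1" l] by auto
  show "om_H l a b = cnj (om_H l b a)"
    unfolding ab om_H_def ad_mat_def
    using adag_a_flip[of l l] adag_a_flip[of "l+1" "l+1"] by auto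
qed

lemma adjoint_gens_om: "adjoint_gens m (om_B m n) om_U om_D om_H"
  unfolding adjoint_gens_def using finite_om_B om_D_cnj om_H_cnj by blast

lemma sum_ad_mat:
  assumes "u \<in> fock m n" "v \<in> fock m n"
  shows "(\<Sum>z\<in>om_B m n. ad_mat A (u, v) z * y z)
    = (\<Sum>u'\<in>fock m n. A u u' * y (u', v)) - (\<Sum>v'\<in>fock m n. A v' v * y (u, v'))"
  unfolding om_B_def ad_mat_eq_tprod using assms by (subst sum_tprod) (auto simp: sum_negf)

lemma sum_om_U:
  assumes "u \<in> fock m n" "v \<in> fock m n"
  shows "(\<Sum>z\<in>om_B m n. om_U l (u, v) z * y z)
    = (\<Sum>u'\<in>fock m n. adag_a l (l+1) u u' * y (u', v)) - (\<Sum>v'\<in>fock m n. adag_a l (l+1) v' v * y (u, v'))"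
  unfolding om_U_def by (rule sum_ad_mat[OF assms])

lemma sum_om_H:
  assumes "u \<in> fock m n" "v \<in> fock m n"
  shows "(\<Sum>z\<in>om_B m n. om_H l (u, v) z * y z)
    = of_int ((int (u l) - int (u (l+1))) - (int (v l) - int (v (l+1)))) * y (u, v)"
proof -
  let ?A = "\<lambda>u w. adag_a l l u w - adag_a (l+1) (l+1) u w"
  have A: "?A u w = (of_nat (w l) - of_nat (w (l+1))) * (if u = w then 1 else 0)" for u w
    by (simp add: adag_a_def)
  have "(\<Sum>z\<in>om_B m n. om_H l (u, v) z * y z)
    = (\<Sum>u'\<in>fock m n. ?A u u' * y (u', v)) - (\<Sum>v'\<in>fock m n. ?A v' v * y (u, v'))"
    unfolding om_H_def by (rule sum_ad_mat[OF assms])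
  also have "(\<Sum>u'\<in>fock m n. ?A u u' * y (u', v)) = (\<Sum>u'\<in>fock m n. ((of_nat (u' l) - of_nat (u' (l+1))) * y (u', v)) * (if u = u' then 1 else 0))"
    unfolding A by (intro sum.cong refl) (simp add: ac_simps)
  also have "\<dots> = (of_nat (u l) - of_nat (u (l+1))) * y (u, v)"
    using assms by (simp add: sum_mult_delta)
  also have "(\<Sum>v'\<in>fock m n. ?A v' v * y (u, v')) = (\<Sum>v'\<in>fock m n. ((of_nat (v l) - of_nat (v (l+1))) * y (u, v')) * (if v' = v then 1 else 0))"
    unfolding A by (intro sum.cong refl) (simp add: ac_simps)
  also have "\<dots> = (of_nat (v l) - of_nat (v (l+1))) * y (u, v)"
    using assms by (simp add: sum_mult_delta)
  finally show ?thesis by (simp add: left_diff_distrib)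
qed

lemma sum_adag_a_hop:
  assumes "w \<in> fock m n" "i \<noteq> j" "i \<in> {1..m}" "j \<in> {1..m}" "1 \<le> w j"
  shows "(\<Sum>u\<in>fock m n. adag_a i j u w * f u) = complex_of_real (sqrt (real (w j * (w i + 1)))) * f (hop i j w)"
proof -
  have "(\<Sum>u\<in>fock m n. adag_a i j u w * f u) = (\<Sum>u\<in>{hop i j w}. adag_a i j u w * f u)"
    by (rule sum.mono_neutral_right) (use hop_in_fock[OF assms] assms in \<open>auto simp: adag_a_hop\<close>)
  then show ?thesis using assms by (simp add: adag_a_hop)
qed

section \<open>Highest-weight operators and their lowest column\<close>

definition lowest :: "nat \<Rightarrow> nat \<Rightarrow> nat \<Rightarrow> nat" where
  "lowest m n = (\<lambda>i. if i = m then n else 0)"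

lemma lowest_in_fock: "1 \<le> m \<Longrightarrow> lowest m n \<in> fock m n"
  by (auto simp: lowest_def fock_def)

definition om_highest :: "nat \<Rightarrow> nat \<Rightarrow> ((nat \<Rightarrow> nat) \<times> (nat \<Rightarrow> nat) \<Rightarrow> complex) \<Rightarrow> bool" where
  "om_highest m n y \<longleftrightarrow> (\<forall>l\<in>{1..<m}. \<forall>z\<in>om_B m n. (\<Sum>z'\<in>om_B m n. om_U l z z' * y z') = 0)"

lemma om_highestD:
  assumes "om_highest m n y" "l \<in> {1..<m}" "u \<in> fock m n" "v \<in> fock m n"
  shows "(\<Sum>u'\<in>fock m n. adag_a l (l+1) u u' * y (u', v)) = (\<Sum>v'\<in>fock m n. adag_a l (l+1) v' v * y (u, v'))"
proof -
  have "(u, v) \<in> om_B m n" using assms by (simp add: om_B_def)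
  then have "(\<Sum>z'\<in>om_B m n. om_U l (u, v) z' * y z') = 0"
    using assms(1,2) unfolding om_highest_def by blast
  then show ?thesis using sum_om_U[OF assms(3,4)] by simp
qed

text \<open>As an operator, a highest-weight vector commutes with all raising operators, and these
  generate the Fock space from its lowest vector.\<close>
lemma om_highest_zero:
  assumes hw: "om_highest m n y" and m: "m \<ge> 1"
    and zero: "\<And>u. u \<in> fock m n \<Longrightarrow> y (u, lowest m n) = 0"
    and u: "u \<in> fock m n" and v: "v \<in> fock m n"
  shows "y (u, v) = 0"
  using u v
proof (induction "\<Sum>t\<in>{1..m}. (m - t) * v t" arbitrary: u v rule: less_induct)
  case less
  show ?case
  proof (cases "\<exists>l\<in>{1..<m}. 1 \<le> v l")
    case False
    have "v i = 0" if "i \<noteq> m" for i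
      using False fock_support[OF less.prems(2), of i] that by (cases "i \<in> {1..m}") force+
    moreover have "v m = n"
    proof -
      have "(\<Sum>i\<in>{1..m}. v i) = (\<Sum>i\<in>{m}. v i)"
        by (rule sum.mono_neutral_right) (use m calculation in auto)
      then show ?thesis using fock_sum[OF less.prems(2)] by simp
    qed
    ultimately have "v = lowest m n" by (auto simp: lowest_def)
    then show ?thesis using zero less.prems by simp
  next
    case True
    then obtain l where l: "l \<in> {1..<m}" "1 \<le> v l" by blast
    \<comment> \<open>\<open>v\<close> arises from \<open>w\<close> by one raising step, and
      \<open>w\<close> has the smaller measure. Commuting the raising operator past \<open>y\<close>
      carries the vanishing of column \<open>w\<close> over to column \<open>v\<close>.\<close>
    define w where "w = hop (l+1) l v"
    have w: "w \<in> fock m n" unfolding w_def by (rule hop_in_fock) (use l less.prems in auto)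
    have w1: "1 \<le> w (l+1)" using l by (simp add: w_def hop_apply)
    have vw: "v = hop l (l+1) w" unfolding w_def using l by (subst hop_hop) auto
    have lt: "(\<Sum>t\<in>{1..m}. (m - t) * w t) < (\<Sum>t\<in>{1..m}. (m - t) * v t)"
      using sum_hop[of l "l+1" m w "\<lambda>t. m - t"] l w1 unfolding vw[symmetric] by auto
    have "(\<Sum>u'\<in>fock m n. adag_a l (l+1) u u' * y (u', w)) = 0"
      using less.hyps[OF lt _ w] by simp
    then have "(\<Sum>v'\<in>fock m n. adag_a l (l+1) v' w * y (u, v')) = 0"
      using om_highestD[OF hw l(1) less.prems(1) w] by simp
    then have "complex_of_real (sqrt (real (w (l+1) * (w l + 1)))) * y (u, v) = 0"
      using sum_adag_a_hop[OF w, of l "l+1" "\<lambda>v'. y (u, v')"] l w1 vw by simp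
    moreover have "complex_of_real (sqrt (real (w (l+1) * (w l + 1)))) \<noteq> 0"
    proof -
      have "w (l+1) * (w l + 1) \<noteq> 0" using w1 by simp
      then show ?thesis unfolding of_real_eq_0_iff real_sqrt_eq_0_iff of_nat_eq_0_iff .
    qed
    ultimately show ?thesis unfolding mult_eq_0_iff by blast
  qed
qed

text \<open>For j < m the lowest Fock state has no particle in mode j, so the raising operator from
  j to j - 1 kills it. By commutation it kills the lowest column of \<open>y\<close> too, which
  therefore has no particle in mode j.\<close>

lemma om_highest_lowest_column:
  assumes hw: "om_highest m n y" and u: "u \<in> fock m n"
    and nz: "y (u, lowest m n) \<noteq> 0" and j: "1 < j" "j < m"
  shows "u j = 0"
proof (rule ccontr)
  assume "u j \<noteq> 0"
  define l where "l = j - 1"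
  have l: "l \<in> {1..<m}" "j = l + 1" and uj: "1 \<le> u (l+1)" using j \<open>u j \<noteq> 0\<close> by (auto simp: l_def)
  have h: "hop l (l+1) u \<in> fock m n" by (rule hop_in_fock) (use l u uj in auto)
  have low: "lowest m n \<in> fock m n" using j by (intro lowest_in_fock) simp
  have "(\<Sum>v'\<in>fock m n. adag_a l (l+1) v' (lowest m n) * y (hop l (l+1) u, v')) = 0"
    by (intro sum.neutral) (use l j in \<open>auto simp: adag_a_hop lowest_def\<close>)
  then have 0: "(\<Sum>u'\<in>fock m n. adag_a l (l+1) (hop l (l+1) u) u' * y (u', lowest m n)) = 0"
    using om_highestD[OF hw l(1) h low] by simp
  have "(\<Sum>u'\<in>fock m n. adag_a l (l+1) (hop l (l+1) u) u' * y (u', lowest m n))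
     = (\<Sum>u'\<in>fock m n. adag_a (l+1) l u' (hop l (l+1) u) * y (u', lowest m n))"
    by (subst adag_a_flip) simp
  also have "\<dots> = complex_of_real (sqrt (real (hop l (l+1) u l * (hop l (l+1) u (l+1) + 1)))) * y (u, lowest m n)"
  proof -
    have "1 \<le> hop l (l+1) u l" by (simp add: hop_apply)
    moreover have "hop (l+1) l (hop l (l+1) u) = u" using uj by (intro hop_hop) auto
    ultimately show ?thesis
      using sum_adag_a_hop[OF h, of "l+1" l "\<lambda>u'. y (u', lowest m n)"] l by simp
  qed
  finally have "real (hop l (l+1) u l * (hop l (l+1) u (l+1) + 1)) = 0" using 0 nz by simp
  then have "hop l (l+1) u l * (hop l (l+1) u (l+1) + 1) = 0" by (simp only: of_nat_eq_0_iff)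
  then show False by (simp add: hop_apply)
qed

lemma fock_two_modes:
  assumes m: "m \<ge> 2" and v: "v \<in> fock m n" and mid: "\<And>j. 1 < j \<Longrightarrow> j < m \<Longrightarrow> v j = 0"
  shows "v 1 + v m = n"
proof -
  have "(\<Sum>i\<in>{1..m}. v i) = (\<Sum>i\<in>{1, m}. v i)"
  proof (rule sum.mono_neutral_right)
    show "\<forall>i\<in>{1..m} - {1, m}. v i = 0"
    proof
      fix i assume "i \<in> {1..m} - {1, m}"
      then have "1 < i" "i < m" by auto
      then show "v i = 0" by (rule mid)
    qed
  qed (use m in auto)
  then show ?thesis using fock_sum[OF v] m by simp
qed

section \<open>The components 0..n exhaust the operator space\<close>

lemma cspan_mono: "S \<subseteq> T \<Longrightarrow> cspan S \<subseteq> cspan T"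
  unfolding cspan_def by blast

context
  fixes m n :: nat and X :: "nat \<Rightarrow> gtpat \<Rightarrow> (nat \<Rightarrow> nat) \<times> (nat \<Rightarrow> nat) \<Rightarrow> complex"
  assumes m2: "m \<ge> 2"
    and X: "\<And>l. l \<le> n \<Longrightarrow> gt_family m (om_B m n) om_U om_D om_H (lam_k m l) (X l)"
begin

lemma X_map: "l \<le> n \<Longrightarrow> gt_map m (om_B m n) om_U om_D om_H (lam_k m l) (X l)"
  using X unfolding gt_family_iff by blast

lemma X_orthonormal:
  "l \<le> n \<Longrightarrow> M \<in> GT m (lam_k m l) \<Longrightarrow> P \<in> GT m (lam_k m l) \<Longrightarrow>
    cinner (om_B m n) (X l M) (X l P) = (if M = P then 1 else 0)"
  using X unfolding gt_family_iff by blast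

lemma X_support: "l \<le> n \<Longrightarrow> M \<in> GT m (lam_k m l) \<Longrightarrow> a \<notin> om_B m n \<Longrightarrow> X l M a = 0"
  using X unfolding gt_family_iff by blast

private abbreviation (input) "Xtop l \<equiv> X l (max_pat m (lam_k m l))"

lemma Xtop_highest:
  assumes "l \<le> n"
  shows "om_highest m n (Xtop l)"
  unfolding om_highest_def
proof (intro ballI)
  fix j z assume j: "j \<in> {1..<m}" and z: "z \<in> om_B m n"
  have "intertwines (om_B m n) (om_U j) (GT m (lam_k m l)) (gt_up m (lam_k m l) j) (X l)"
    using X_map[OF assms] j unfolding gt_map_def by blast
  from intertwinesD[OF this max_pat_lam_k[OF m2] z]
  show "(\<Sum>z'\<in>om_B m n. om_U j z z' * Xtop l z') = 0"
    using j by (simp add: gt_up_max_pat)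
qed

text \<open>The Cartan eigenvalue equations, summed over j, telescope to u_1 - u_m + n = 2l. Only
  modes 1 and m are occupied, so u_1 + u_m = n, and u_1 = l follows.\<close>

lemma Xtop_lowest_column:
  assumes l: "l \<le> n" and u: "u \<in> fock m n" and nz: "Xtop l (u, lowest m n) \<noteq> 0"
  shows "u 1 = l"
proof -
  let ?T = "max_pat m (lam_k m l)"
  have low: "lowest m n \<in> fock m n" using m2 by (intro lowest_in_fock) simp
  have "(int (u j) - int (u (j+1))) - (int (lowest m n j) - int (lowest m n (j+1))) = gt_wt ?T j - gt_wt ?T (j+1)"
    if j: "j \<in> {1..<m}" for j
  proof -
    have "intertwines (om_B m n) (om_H j) (GT m (lam_k m l)) (gt_h m (lam_k m l) j) (X l)"
      using X_map[OF l] j unfolding gt_map_def by blast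
    from intertwinesD[OF this max_pat_lam_k[OF m2], of "(u, lowest m n)"]
    have "of_int ((int (u j) - int (u (j+1))) - (int (lowest m n j) - int (lowest m n (j+1)))) * Xtop l (u, lowest m n)
        = (\<Sum>M\<in>GT m (lam_k m l). gt_h m (lam_k m l) j M ?T * X l M (u, lowest m n))"
      using u low unfolding sum_om_H[OF u low] by (simp add: om_B_def)
    also have "\<dots> = (\<Sum>M\<in>{?T}. gt_h m (lam_k m l) j M ?T * X l M (u, lowest m n))"
      by (rule sum.mono_neutral_right) (use m2 in \<open>auto simp: gt_h_def\<close>)
    also have "\<dots> = of_int (gt_wt ?T j - gt_wt ?T (j+1)) * Xtop l (u, lowest m n)"
      using m2 by (simp add: gt_h_def)
    finally show ?thesis using nz by (simp only: mult_cancel_right of_int_eq_iff) simp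
  qed
  then have "(\<Sum>j\<in>{1..<m}. (int (u j) - int (u (j+1))) - (int (lowest m n j) - int (lowest m n (j+1))))
      = (\<Sum>j\<in>{1..<m}. gt_wt ?T j - gt_wt ?T (j+1))"
    by (intro sum.cong) auto
  also have "\<dots> = 2 * int l" using sum_gt_wt_diff[of m ?T] gt_wt_max_pat_lam_k[OF m2] m2 by simp
  also have "(\<Sum>j\<in>{1..<m}. (int (u j) - int (u (j+1))) - (int (lowest m n j) - int (lowest m n (j+1))))
      = (int (u 1) - int (u m)) - (int (lowest m n 1) - int (lowest m n m))"
  proof -
    have tel: "(\<Sum>j\<in>{1..<m}. f j - f (j+1)) = f 1 - f m" for f :: "nat \<Rightarrow> int"
    proof -
      have "1 \<le> m" using m2 by simp
      then show ?thesis by (induction m rule: dec_induct) auto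
    qed
    show ?thesis unfolding sum_subtractf[of "\<lambda>j. int (u j) - int (u (j+1))"] 
      using tel[of "\<lambda>j. int (u j)"] tel[of "\<lambda>j. int (lowest m n j)"] by simp
  qed
  finally have 1: "int (u 1) - int (u m) + int n = 2 * int l" using m2 by (simp add: lowest_def)
  have "u 1 + u m = n"
    using fock_two_modes[OF m2 u] om_highest_lowest_column[OF Xtop_highest[OF l] u nz] by blast
  then show ?thesis using 1 by linarith
qed

lemma fock_two_mode_unique:
  assumes "u \<in> fock m n" "w \<in> fock m n" "u 1 = w 1" "\<And>j. 1 < j \<Longrightarrow> j < m \<Longrightarrow> u j = 0 \<and> w j = 0"
  shows "u = w"
proof -
  have "u 1 + u m = n" "w 1 + w m = n" using fock_two_modes[OF m2] assms by blast+
  then have "u m = w m" using assms(3) by simp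
  moreover have "u i = w i" if "i \<noteq> m" for i
  proof (cases "i \<in> {1..m}")
    case True
    then show ?thesis using assms(3) assms(4)[of i] that by (cases "i = 1") auto
  next
    case False
    then show ?thesis using fock_support[OF assms(1)] fock_support[OF assms(2)] by simp
  qed
  ultimately show ?thesis by (metis ext)
qed

lemma Xtop_nonzero:
  assumes l: "l \<le> n"
  obtains u where "u \<in> fock m n" "Xtop l (u, lowest m n) \<noteq> 0"
proof -
  have "\<exists>u\<in>fock m n. Xtop l (u, lowest m n) \<noteq> 0"
  proof (rule ccontr)
    assume "\<not> ?thesis"
    then have "Xtop l (u, v) = 0" if "u \<in> fock m n" "v \<in> fock m n" for u v
      using om_highest_zero[OF Xtop_highest[OF l] _ _ that] m2 by force
    then have "cinner (om_B m n) (Xtop l) (Xtop l) = 0"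
      unfolding cinner_def om_B_def by (intro sum.neutral) auto
    then show False using X_orthonormal[OF l max_pat_lam_k[OF m2] max_pat_lam_k[OF m2]] by simp
  qed
  then show thesis using that by blast
qed

text \<open>A highest-weight operator is determined by its lowest column, whose only possible
  entries are the n + 1 states with particles in modes 1 and m. \<open>Xtop l\<close> occupies
  exactly the one with l particles in mode 1, so suitable multiples clear the column.\<close>

lemma om_highest_span:
  assumes y: "om_highest m n y"
  shows "\<exists>c. \<forall>z\<in>om_B m n. y z = (\<Sum>l\<le>n. c l * Xtop l z)"
proof -
  have "\<forall>l. \<exists>u. l \<le> n \<longrightarrow> u \<in> fock m n \<and> Xtop l (u, lowest m n) \<noteq> 0"
    using Xtop_nonzero by metis
  then obtain w where w: "\<And>l. l \<le> n \<Longrightarrow> w l \<in> fock m n" "\<And>l. l \<le> n \<Longrightarrow> Xtop l (w l, lowest m n) \<noteq> 0"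
    by metis
  \<comment> \<open>\<open>w l\<close> is the single place where the lowest column of
    \<open>Xtop l\<close> is nonzero, so this quotient makes the difference vanish there.\<close>
  define c where "c l = y (w l, lowest m n) / Xtop l (w l, lowest m n)" for l
  define y' where "y' z = y z - (\<Sum>l\<le>n. c l * Xtop l z)" for z
  have hw': "om_highest m n y'"
    unfolding om_highest_def
  proof (intro ballI)
    fix j z assume j: "j \<in> {1..<m}" and z: "z \<in> om_B m n"
    have "(\<Sum>z'\<in>om_B m n. om_U j z z' * y' z') = (\<Sum>z'\<in>om_B m n. om_U j z z' * y z')
        - (\<Sum>l\<le>n. c l * (\<Sum>z'\<in>om_B m n. om_U j z z' * Xtop l z'))"
      unfolding y'_def right_diff_distrib sum_subtractf sum_distrib_left
      by (subst (2) sum.swap) (simp add: ac_simps)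
    also have "\<dots> = 0"
      using y Xtop_highest j z unfolding om_highest_def by simp
    finally show "(\<Sum>z'\<in>om_B m n. om_U j z z' * y' z') = 0" .
  qed
  have at_w: "Xtop l (u, lowest m n) = (if l = u 1 then Xtop l (w l, lowest m n) else 0)"
    if "l \<le> n" "u \<in> fock m n" "\<And>j. 1 < j \<Longrightarrow> j < m \<Longrightarrow> u j = 0" for l u
  proof (cases "l = u 1")
    case True
    have "w l 1 = l" using Xtop_lowest_column[OF that(1) w(1) w(2)] that by simp
    then have "u = w l"
      using fock_two_mode_unique[OF that(2) w(1)[OF that(1)]] True that(3)
        om_highest_lowest_column[OF Xtop_highest[OF that(1)] w(1) w(2)] that(1) by metis
    then show ?thesis using True by simp
  next
    case False
    then show ?thesis using Xtop_lowest_column[OF that(1,2)] by auto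
  qed
  have "y' (u, lowest m n) = 0" if u: "u \<in> fock m n" for u
  proof (cases "\<forall>j. 1 < j \<longrightarrow> j < m \<longrightarrow> u j = 0")
    case True
    have un: "u 1 \<le> n"
    proof -
      have "u 1 \<le> (\<Sum>i\<in>{1..m}. u i)" by (rule member_le_sum) (use m2 in auto)
      then show ?thesis using fock_sum[OF u] by simp
    qed
    have "(\<Sum>l\<le>n. c l * Xtop l (u, lowest m n)) = (\<Sum>l\<in>{u 1}. c l * Xtop l (u, lowest m n))"
      by (rule sum.mono_neutral_right) (use un at_w[OF _ u] True in auto)
    also have "\<dots> = y (w (u 1), lowest m n)"
      using at_w[OF un u] True w(2)[OF un] by (simp add: c_def)
    also have "w (u 1) = u"
    proof -
      have "w (u 1) 1 = u 1" using Xtop_lowest_column[OF un w(1) w(2)] un by simp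
      then show ?thesis
        using fock_two_mode_unique[OF w(1)[OF un] u] True
          om_highest_lowest_column[OF Xtop_highest[OF un] w(1) w(2)] un by metis
    qed
    finally show ?thesis by (simp add: y'_def)
  next
    case False
    then obtain j where j: "1 < j" "j < m" "u j \<noteq> 0" by blast
    then have "y (u, lowest m n) = 0" 
      using om_highest_lowest_column[OF y u _ j(1,2)] j(3) by metis
    moreover have "Xtop l (u, lowest m n) = 0" if "l \<le> n" for l
      using om_highest_lowest_column[OF Xtop_highest[OF that] u _ j(1,2)] j(3) by metis
    ultimately show ?thesis by (simp add: y'_def)
  qed
  then have uv: "y' (u, v) = 0" if "u \<in> fock m n" "v \<in> fock m n" for u v
    using om_highest_zero[OF hw' _ _ that] m2 by simp
  have "y' z = 0" if "z \<in> om_B m n" for z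
    using that uv[of "fst z" "snd z"] unfolding om_B_def mem_Times_iff prod.collapse by blast
  then show ?thesis unfolding y'_def right_minus_eq by (intro exI[of _ c] ballI)
qed

lemma X_cross:
  assumes "l \<le> n" "l' \<le> n" "M \<in> GT m (lam_k m l)" "P \<in> GT m (lam_k m l')"
  shows "cinner (om_B m n) (X l M) (X l' P) = (if l = l' \<and> M = P then 1 else 0)"
  using assms X_orthonormal gram_lam_k_neq[OF m2 adjoint_gens_om _ X_map X_map]
  by (cases "l = l'") auto

text \<open>The orthogonal complement of all components is invariant under raising. If it were
  nonzero it would contain a highest-weight operator; this is a combination of the vectors
  \<open>Xtop l\<close>, hence orthogonal to itself.\<close>

lemma X_complete_zero:
  assumes orth: "\<And>l M. l \<le> n \<Longrightarrow> M \<in> GT m (lam_k m l) \<Longrightarrow> cinner (om_B m n) (X l M) y = 0"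
    and z: "z \<in> om_B m n"
  shows "y z = 0"
proof (rule ccontr)
  assume nz: "y z \<noteq> 0"
  let ?S = "{y. \<forall>l\<le>n. \<forall>M\<in>GT m (lam_k m l). cinner (om_B m n) (X l M) y = 0}"
  \<comment> \<open>A raising operator moves a particle of the row index from mode l + 1 to l, or
    one of the column index from l to l + 1; the opposite weights make the grade increase in both
    cases.\<close>
  let ?gr = "\<lambda>(u, v). (\<Sum>t\<in>{1..m}. (m - t) * u t) + (\<Sum>t\<in>{1..m}. t * v t)"
  obtain x a where x: "x \<in> ?S" "a \<in> om_B m n" "x a \<noteq> 0"
    and hw: "\<And>l a. l \<in> {1..<m} \<Longrightarrow> matapp (om_B m n) (om_U l) x a = 0"
  proof (rule exists_highest[where B = "om_B m n" and S = ?S and L = "{1..<m}" and U = om_U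
        and gr = ?gr and ?y0.0 = y and ?a0.0 = z])
    fix x l assume x: "x \<in> ?S" and l: "l \<in> {1..<m}"
    have "cinner (om_B m n) (X k M) (matapp (om_B m n) (om_U l) x) = 0" if k: "k \<le> n" and M: "M \<in> GT m (lam_k m k)" for k M
    proof -
      have D: "om_D l a b = cnj (om_U l b a)" if "a \<in> om_B m n" "b \<in> om_B m n" for a b
        using adjoint_gens_om[of m n] that l unfolding adjoint_gens_def by blast
      have i: "intertwines (om_B m n) (om_D l) (GT m (lam_k m k)) (gt_down m (lam_k m k) l) (X k)"
        using X_map[OF k] l unfolding gt_map_def by blast
      have "cinner (om_B m n) (X k M) (matapp (om_B m n) (om_U l) x)
          = (\<Sum>a\<in>om_B m n. \<Sum>b\<in>om_B m n. cnj (om_D l b a * X k M a) * x b)"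
        by (simp add: cinner_def matapp_def sum_distrib_left D ac_simps)
      also have "\<dots> = (\<Sum>b\<in>om_B m n. cnj (\<Sum>a\<in>om_B m n. om_D l b a * X k M a) * x b)"
        by (subst sum.swap) (simp add: sum_distrib_right)
      also have "\<dots> = (\<Sum>b\<in>om_B m n. cnj (\<Sum>P\<in>GT m (lam_k m k). gt_down m (lam_k m k) l P M * X k P b) * x b)"
        using intertwinesD[OF i M] by simp
      also have "\<dots> = (\<Sum>P\<in>GT m (lam_k m k). cnj (gt_down m (lam_k m k) l P M) * cinner (om_B m n) (X k P) x)"
        unfolding cinner_def cnj_sum sum_distrib_left sum_distrib_right by (subst sum.swap) (simp add: ac_simps)
      also have "\<dots> = 0" using x k by simp
      finally show ?thesis .
    qed
    then show "matapp (om_B m n) (om_U l) x \<in> ?S" by blast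
  next
    fix a b l assume l: "l \<in> {1..<m}" and a: "a \<in> om_B m n" and b: "b \<in> om_B m n" and ne: "om_U l a b \<noteq> 0"
    obtain u v u' v' where ab: "a = (u, v)" "b = (u', v')" by fastforce
    from ne consider "v = v'" "adag_a l (l+1) u u' \<noteq> 0" | "u = u'" "adag_a l (l+1) v' v \<noteq> 0"
      unfolding ab om_U_def ad_mat_def
      by (cases "v = v' \<and> adag_a l (l+1) u u' \<noteq> 0") (auto split: if_splits)
    then show "?gr b < ?gr a"
    proof cases
      case 1
      then have "1 \<le> u' (l+1)" "u = hop l (l+1) u'" by (auto simp: adag_a_hop split: if_splits)
      then show ?thesis using sum_hop[of l "l+1" m u' "\<lambda>t. m - t"] l 1 unfolding ab by auto
    next
      case 2
      then have "1 \<le> v (l+1)" "v' = hop l (l+1) v" by (auto simp: adag_a_hop split: if_splits)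
      then show ?thesis using sum_hop[of l "l+1" m v "\<lambda>t. t"] l 2 unfolding ab by auto
    qed
  qed (use orth z nz in auto)
  have "om_highest m n x" unfolding om_highest_def
  proof (intro ballI)
    fix l z assume "l \<in> {1..<m}" "z \<in> om_B m n"
    then show "(\<Sum>z'\<in>om_B m n. om_U l z z' * x z') = 0" using hw[of l z] by (simp add: matapp_def)
  qed
  from om_highest_span[OF this] obtain c where c: "\<forall>z\<in>om_B m n. x z = (\<Sum>l\<le>n. c l * Xtop l z)" ..
  have "cinner (om_B m n) x x = (\<Sum>a\<in>om_B m n. cnj (\<Sum>l\<le>n. c l * Xtop l a) * x a)"
    unfolding cinner_def by (intro sum.cong refl arg_cong2[where f = "(*)"] arg_cong[where f = cnj] c[rule_format])
  also have "\<dots> = (\<Sum>l\<le>n. cnj (c l) * cinner (om_B m n) (Xtop l) x)"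
    unfolding cinner_def cnj_sum sum_distrib_left sum_distrib_right by (subst sum.swap) (simp add: ac_simps)
  also have "\<dots> = 0" using x(1) m2 by simp
  finally show False using cinner_self_eq_0[OF finite_om_B _ x(2)] x(3) by blast
qed

lemma X_expand:
  assumes z: "z \<in> om_B m n"
  shows "y z = (\<Sum>l\<le>n. \<Sum>M\<in>GT m (lam_k m l). cinner (om_B m n) (X l M) y * X l M z)"
proof -
  define r where "r z = y z - (\<Sum>l\<le>n. \<Sum>M\<in>GT m (lam_k m l). cinner (om_B m n) (X l M) y * X l M z)" for z
  have "r z = 0"
  proof (rule X_complete_zero[OF _ z])
    fix k P assume k: "k \<le> n" and P: "P \<in> GT m (lam_k m k)"
    have "cinner (om_B m n) (X k P) r = cinner (om_B m n) (X k P) y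
       - (\<Sum>l\<le>n. \<Sum>M\<in>GT m (lam_k m l). cinner (om_B m n) (X l M) y * cinner (om_B m n) (X k P) (X l M))"
      unfolding r_def cinner_def[of _ "X k P"] right_diff_distrib sum_subtractf sum_distrib_left
      by (subst (2) sum.swap, subst (3) sum.swap) (simp add: ac_simps)
    also have "(\<Sum>l\<le>n. \<Sum>M\<in>GT m (lam_k m l). cinner (om_B m n) (X l M) y * cinner (om_B m n) (X k P) (X l M))
       = (\<Sum>l\<le>n. \<Sum>M\<in>GT m (lam_k m l). if k = l \<and> P = M then cinner (om_B m n) (X l M) y else 0)"
      using X_cross[OF k _ P] by (intro sum.cong refl) simp
    also have "\<dots> = (\<Sum>l\<in>{k}. \<Sum>M\<in>GT m (lam_k m l). if k = l \<and> P = M then cinner (om_B m n) (X l M) y else 0)"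
      by (rule sum.mono_neutral_right) (use k in auto)
    also have "\<dots> = cinner (om_B m n) (X k P) y" using P by simp
    finally show "cinner (om_B m n) (X k P) r = 0" by simp
  qed
  then show ?thesis by (simp add: r_def)
qed

text \<open>\<open>isotypic\<close> collects the vectors of every conceivable GT family. By
  completeness such a vector expands over all components, and by Schur's lemma only the k-th
  survives: the decomposition is multiplicity-free.\<close>

lemma isotypic_om:
  assumes k: "k \<le> n"
  shows "isotypic m (om_B m n) om_U om_D om_H (lam_k m k) = cspan (X k ` GT m (lam_k m k))"
proof
  let ?B = "om_B m n" and ?G = "GT m (lam_k m k)"
  let ?S = "{v M |v M. gt_family m ?B om_U om_D om_H (lam_k m k) v \<and> M \<in> ?G}"
  have inj: "inj_on (X k) ?G"
  proof (rule inj_onI)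
    fix M P assume MP: "M \<in> ?G" "P \<in> ?G" and eq: "X k M = X k P"
    have "cinner ?B (X k M) (X k P) = 1" using X_orthonormal[OF k MP(1) MP(1)] eq by simp
    then show "M = P" using X_orthonormal[OF k MP] by (auto split: if_splits)
  qed
  show "cspan (X k ` ?G) \<subseteq> isotypic m ?B om_U om_D om_H (lam_k m k)"
  proof -
    have "X k ` ?G \<subseteq> ?S" 
    proof (rule image_subsetI)
      fix M assume "M \<in> ?G"
      then show "X k M \<in> ?S" using X[OF k] by (intro CollectI exI[of _ "X k"] exI[of _ M] conjI refl)
    qed
    then show ?thesis unfolding isotypic_def by (rule cspan_mono)
  qed
  show "isotypic m ?B om_U om_D om_H (lam_k m k) \<subseteq> cspan (X k ` ?G)"
  proof
    fix x assume "x \<in> isotypic m ?B om_U om_D om_H (lam_k m k)"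
    then obtain F c where F: "finite F" "F \<subseteq> ?S" and x: "x = (\<lambda>a. \<Sum>v\<in>F. c v * v a)"
      unfolding isotypic_def cspan_def by blast
    have e: "v a = (\<Sum>M\<in>?G. cinner ?B (X k M) v * X k M a)" if v: "v \<in> F" for v a
    proof -
      obtain f P where f: "gt_family m ?B om_U om_D om_H (lam_k m k) f" and P: "P \<in> ?G" and vf: "v = f P"
        using F(2) v by blast
      have fm: "gt_map m ?B om_U om_D om_H (lam_k m k) f" and fs: "a \<notin> ?B \<Longrightarrow> v a = 0"
        using f P unfolding gt_family_iff vf by blast+
      show ?thesis
      proof (cases "a \<in> ?B")
        case True
        have "v a = (\<Sum>l\<le>n. \<Sum>M\<in>GT m (lam_k m l). cinner ?B (X l M) v * X l M a)" by (rule X_expand[OF True])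
        also have "\<dots> = (\<Sum>l\<in>{k}. \<Sum>M\<in>GT m (lam_k m l). cinner ?B (X l M) v * X l M a)"
          unfolding vf using gram_lam_k_neq[OF m2 adjoint_gens_om _ X_map fm _ P] k
          by (intro sum.mono_neutral_right) (auto intro!: sum.neutral)
        finally show ?thesis by simp
      next
        case False
        then show ?thesis using fs X_support[OF k] by simp
      qed
    qed
    have "x = (\<lambda>a. \<Sum>M\<in>?G. (\<Sum>v\<in>F. c v * cinner ?B (X k M) v) * X k M a)"
    proof
      fix a
      have "x a = (\<Sum>v\<in>F. c v * (\<Sum>M\<in>?G. cinner ?B (X k M) v * X k M a))"
        unfolding x by (intro sum.cong refl arg_cong2[where f = "(*)"] e)
      also have "\<dots> = (\<Sum>M\<in>?G. (\<Sum>v\<in>F. c v * cinner ?B (X k M) v) * X k M a)"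
        unfolding sum_distrib_left sum_distrib_right by (subst sum.swap) (simp add: ac_simps)
      finally show "x a = (\<Sum>M\<in>?G. (\<Sum>v\<in>F. c v * cinner ?B (X k M) v) * X k M a)" .
    qed
    also have "\<dots> \<in> cspan (X k ` ?G)" by (rule cspan_sum) (use inj in auto)
    finally show "x \<in> cspan (X k ` ?G)" .
  qed
qed

lemma P_lam_eq:
  assumes k: "k \<le> n"
  shows "P_lam m n k x = (\<lambda>a. \<Sum>M\<in>GT m (lam_k m k). cinner (om_B m n) (X k M) x * X k M a)"
  unfolding P_lam_def isotypic_om[OF k]
  by (rule oproj_orthonormal) (use X_orthonormal[OF k] in auto)

end

section \<open>Plane rotations generate SU(m)\<close>

lemma cdet_rows_not_inj:
  fixes m :: nat and h :: cmat
  assumes f: "f \<in> {1..m} \<rightarrow> {1..m}" and ni: "\<not> inj_on f {1..m}"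
  shows "(\<Sum>\<sigma> | \<sigma> permutes {1..m}. of_int (sign \<sigma>) * (\<Prod>i\<in>{1..m}. h (f i) (\<sigma> i)) :: complex) = 0"
proof -
  obtain a b where ab: "a \<in> {1..m}" "b \<in> {1..m}" "a \<noteq> b" "f a = f b"
    using ni by (auto simp: inj_on_def)
  let ?t = "Transposition.transpose a b"
  have t: "?t permutes {1..m}" using ab by (intro permutes_swap_id)
  have ft: "f (?t i) = f i" for i using ab by (auto simp: Transposition.transpose_def)
  let ?F = "\<lambda>\<sigma>. of_int (sign \<sigma>) * (\<Prod>i\<in>{1..m}. h (f i) (\<sigma> i)) :: complex"
  have "sum ?F {\<sigma>. \<sigma> permutes {1..m}} = (\<Sum>\<sigma> | \<sigma> permutes {1..m}. ?F (\<sigma> \<circ> ?t))"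
    by (rule sum_permutations_compose_right[OF t])
  also have "\<dots> = (\<Sum>\<sigma> | \<sigma> permutes {1..m}. - ?F \<sigma>)"
  proof (intro sum.cong refl)
    fix \<sigma> assume "\<sigma> \<in> {\<sigma>. \<sigma> permutes {1..m}}"
    then have \<sigma>: "\<sigma> permutes {1..m}" by simp
    have "sign (\<sigma> \<circ> ?t) = - sign \<sigma>"
      using ab \<sigma> t by (subst sign_compose) (auto simp: sign_swap_id intro: permutes_imp_permutation)
    moreover have "(\<Prod>i\<in>{1..m}. h (f i) ((\<sigma> \<circ> ?t) i)) = (\<Prod>i\<in>{1..m}. h (f i) (\<sigma> i))"
      using prod.permute[OF t, of "\<lambda>i. h (f i) (\<sigma> i)"] by (simp add: ft comp_def)
    ultimately show "?F (\<sigma> \<circ> ?t) = - ?F \<sigma>" by simp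
  qed
  finally have "sum ?F {\<sigma>. \<sigma> permutes {1..m}} = - sum ?F {\<sigma>. \<sigma> permutes {1..m}}"
    by (simp add: sum_negf)
  moreover have "z = 0" if "z = - z" for z :: complex using that by (simp add: complex_eq_iff)
  ultimately show ?thesis by blast
qed

lemma cdet_rows_permuted:
  assumes f: "f permutes {1..m}"
  shows "(\<Sum>\<sigma> | \<sigma> permutes {1..m}. of_int (sign \<sigma>) * (\<Prod>i\<in>{1..m}. h (f i) (\<sigma> i)) :: complex)
    = of_int (sign f) * cdet m h"
proof -
  let ?F = "\<lambda>\<sigma>. of_int (sign \<sigma>) * (\<Prod>i\<in>{1..m}. h (f i) (\<sigma> i)) :: complex"
  have "sum ?F {\<sigma>. \<sigma> permutes {1..m}} = (\<Sum>\<sigma> | \<sigma> permutes {1..m}. ?F (\<sigma> \<circ> f))"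
    by (rule sum_permutations_compose_right[OF f])
  also have "\<dots> = (\<Sum>\<sigma> | \<sigma> permutes {1..m}. of_int (sign f) * (of_int (sign \<sigma>) * (\<Prod>i\<in>{1..m}. h i (\<sigma> i))))"
  proof (intro sum.cong refl)
    fix \<sigma> assume "\<sigma> \<in> {\<sigma>. \<sigma> permutes {1..m}}"
    then have \<sigma>: "\<sigma> permutes {1..m}" by simp
    have "sign (\<sigma> \<circ> f) = sign f * sign \<sigma>"
      using \<sigma> f by (subst sign_compose) (auto intro: permutes_imp_permutation)
    moreover have "(\<Prod>i\<in>{1..m}. h (f i) ((\<sigma> \<circ> f) i)) = (\<Prod>i\<in>{1..m}. h i (\<sigma> i))"
      using prod.permute[OF f, of "\<lambda>i. h i (\<sigma> i)"] by (simp add: comp_def)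
    ultimately show "?F (\<sigma> \<circ> f) = of_int (sign f) * (of_int (sign \<sigma>) * (\<Prod>i\<in>{1..m}. h i (\<sigma> i)))" by simp
  qed
  finally show ?thesis by (simp add: cdet_def sum_distrib_left)
qed

text \<open>Expanding the product of row sums gives one term for each map f choosing a row of
  \<open>h\<close>. A non-injective f repeats a row and contributes 0; an injective one is a
  permutation and contributes its sign.\<close>

lemma cdet_mult: "cdet m (cmatmul m g h) = cdet m g * cdet m h"
proof -
  let ?I = "{1..m}" and ?P = "{\<sigma>. \<sigma> permutes {1..m}}"
  let ?E = "PiE ?I (\<lambda>_. ?I)"
  let ?D = "\<lambda>f. \<Sum>\<sigma>\<in>?P. of_int (sign \<sigma>) * (\<Prod>i\<in>?I. h (f i) (\<sigma> i)) :: complex"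
  have finE: "finite ?E" by (rule finite_PiE) auto
  have "cdet m (cmatmul m g h) = (\<Sum>\<sigma>\<in>?P. of_int (sign \<sigma>) * (\<Sum>f\<in>?E. \<Prod>i\<in>?I. g i (f i) * h (f i) (\<sigma> i)))"
    unfolding cdet_def cmatmul_def by (subst prod_sum_PiE) auto
  also have "\<dots> = (\<Sum>f\<in>?E. (\<Prod>i\<in>?I. g i (f i)) * ?D f)"
    unfolding sum_distrib_left prod.distrib by (subst sum.swap) (simp add: ac_simps)
  also have "\<dots> = (\<Sum>f\<in>{f \<in> ?E. inj_on f ?I}. (\<Prod>i\<in>?I. g i (f i)) * ?D f)"
  proof (rule sum.mono_neutral_right[OF finE])
    show "\<forall>f\<in>?E - {f \<in> ?E. inj_on f ?I}. (\<Prod>i\<in>?I. g i (f i)) * ?D f = 0"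
    proof
      fix f assume f: "f \<in> ?E - {f \<in> ?E. inj_on f ?I}"
      then have "?D f = 0" by (intro cdet_rows_not_inj) (auto simp: PiE_def)
      then show "(\<Prod>i\<in>?I. g i (f i)) * ?D f = 0" by simp
    qed
  qed auto
  also have "\<dots> = (\<Sum>p\<in>?P. (\<Prod>i\<in>?I. g i (p i)) * ?D p)"
  \<comment> \<open>Extensional maps are \<open>undefined\<close> outside the index range,
    permutations are the identity there; the two witnesses translate between these
    conventions.\<close>
  proof (rule sum.reindex_bij_witness[where i = "\<lambda>p. restrict p ?I" and j = "\<lambda>f i. if i \<in> ?I then f i else i"])
    fix f assume f: "f \<in> {f \<in> ?E. inj_on f ?I}"
    let ?p = "\<lambda>i. if i \<in> ?I then f i else i"
    show "restrict ?p ?I = f" using f by (auto simp: PiE_def extensional_def fun_eq_iff)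
    have inj: "inj_on f ?I" and sub: "f ` ?I \<subseteq> ?I" using f by (auto simp: PiE_def)
    have "f ` ?I = ?I" by (rule endo_inj_surj) (use inj sub in auto)
    then have "bij_betw f ?I ?I" using inj by (simp add: bij_betw_def)
    moreover have "bij_betw ?p ?I ?I \<longleftrightarrow> bij_betw f ?I ?I" by (intro bij_betw_cong) auto
    ultimately show "?p \<in> ?P" by (auto intro!: bij_imp_permutes)
    show "(\<Prod>i\<in>?I. g i (?p i)) * ?D ?p = (\<Prod>i\<in>?I. g i (f i)) * ?D f" by simp
  next
    fix p assume p: "p \<in> ?P"
    then have p': "p permutes ?I" by simp
    show "(\<lambda>i. if i \<in> ?I then restrict p ?I i else i) = p"
    proof
      fix i show "(if i \<in> ?I then restrict p ?I i else i) = p i"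
      proof (cases "i \<in> ?I")
        case False
        show ?thesis unfolding if_not_P[OF False] by (rule permutes_not_in[OF p' False, symmetric])
      qed simp
    qed
    have "inj_on (restrict p ?I) ?I \<longleftrightarrow> inj_on p ?I" by (intro inj_on_cong) auto
    then show "restrict p ?I \<in> {f \<in> ?E. inj_on f ?I}"
      using permutes_inj_on[OF p'] permutes_in_image[OF p'] by auto
  qed
  also have "\<dots> = (\<Sum>p\<in>?P. (\<Prod>i\<in>?I. g i (p i)) * (of_int (sign p) * cdet m h))"
  proof (intro sum.cong refl)
    fix p assume "p \<in> ?P"
    then have "p permutes ?I" by simp
    from cdet_rows_permuted[OF this, of h]
    show "(\<Prod>i\<in>?I. g i (p i)) * ?D p = (\<Prod>i\<in>?I. g i (p i)) * (of_int (sign p) * cdet m h)" by simp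
  qed
  also have "\<dots> = cdet m g * cdet m h"
    by (simp add: cdet_def[of m g] sum_distrib_left sum_distrib_right ac_simps)
  finally show ?thesis .
qed

lemma cdet_diagonal:
  assumes "\<And>i j. i \<in> {1..m} \<Longrightarrow> i \<noteq> j \<Longrightarrow> g i j = 0"
  shows "cdet m g = (\<Prod>i\<in>{1..m}. g i i)"
proof -
  have "cdet m g = (\<Sum>\<sigma>\<in>{id}. of_int (sign \<sigma>) * (\<Prod>i\<in>{1..m}. g i (\<sigma> i)))"
    unfolding cdet_def
  proof (rule sum.mono_neutral_right)
    show "\<forall>\<sigma>\<in>{\<sigma>. \<sigma> permutes {1..m}} - {id}. of_int (sign \<sigma>) * (\<Prod>i\<in>{1..m}. g i (\<sigma> i)) = 0"
    proof
      fix \<sigma> assume \<sigma>: "\<sigma> \<in> {\<sigma>. \<sigma> permutes {1..m}} - {id}"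
      then obtain i where i: "\<sigma> i \<noteq> i" by (metis DiffD2 eq_id_iff insertI1)
      then have "i \<in> {1..m}" using \<sigma> by (metis DiffD1 mem_Collect_eq permutes_not_in)
      then have "(\<Prod>i\<in>{1..m}. g i (\<sigma> i)) = 0" using assms[of i "\<sigma> i"] i by (intro prod_zero) auto
      then show "of_int (sign \<sigma>) * (\<Prod>i\<in>{1..m}. g i (\<sigma> i)) = 0" by simp
    qed
  qed (auto simp: finite_permutations permutes_id)
  then show ?thesis by simp
qed

section \<open>Rotations in the plane of two consecutive coordinates\<close>

definition id_mat :: "nat \<Rightarrow> cmat" where
  "id_mat m = (\<lambda>i j. if i = j \<and> i \<in> {1..m} then 1 else 0)"

definition blk :: "nat \<Rightarrow> nat \<Rightarrow> complex \<Rightarrow> complex \<Rightarrow> complex \<Rightarrow> complex \<Rightarrow> cmat" where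
  "blk m l a b c d = (\<lambda>i j. if i \<in> {1..m} \<and> j \<in> {1..m} then
     (if i = l \<and> j = l then a else if i = l \<and> j = l+1 then b else if i = l+1 \<and> j = l then c
      else if i = l+1 \<and> j = l+1 then d else if i = j then 1 else 0) else 0)"

lemma sum_blk_row:
  assumes l: "l \<in> {1..<m}" and i: "i \<in> {1..m}"
  shows "(\<Sum>t\<in>{1..m}. blk m l a b c d i t * f t)
    = (if i = l then a * f l + b * f (l+1) else if i = l+1 then c * f l + d * f (l+1) else f i)"
proof (cases "i = l \<or> i = l+1")
  case True
  have "(\<Sum>t\<in>{1..m}. blk m l a b c d i t * f t) = (\<Sum>t\<in>{l, l+1}. blk m l a b c d i t * f t)"
    by (rule sum.mono_neutral_right) (use l True in \<open>auto simp: blk_def\<close>)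
  then show ?thesis using True l by (auto simp: blk_def)
next
  case False
  have "(\<Sum>t\<in>{1..m}. blk m l a b c d i t * f t) = (\<Sum>t\<in>{i}. blk m l a b c d i t * f t)"
    by (rule sum.mono_neutral_right) (use i False in \<open>auto simp: blk_def\<close>)
  then show ?thesis using False i by (simp add: blk_def)
qed

lemma blk_transpose: "blk m l a b c d i j = blk m l a c b d j i"
  by (auto simp: blk_def)

lemma blk_one: "l \<in> {1..<m} \<Longrightarrow> blk m l 1 0 0 1 = id_mat m"
  by (auto simp: blk_def id_mat_def fun_eq_iff)

text \<open>A permutation moving an index outside {l, l+1} meets a vanishing off-diagonal entry,
  which leaves the identity and one transposition.\<close>

lemma cdet_blk:
  assumes l: "l \<in> {1..<m}"
  shows "cdet m (blk m l a b c d) = a * d - b * c"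
proof -
  let ?g = "blk m l a b c d"
  let ?t = "Transposition.transpose l (l+1)"
  have "cdet m ?g = (\<Sum>\<sigma>\<in>{id, ?t}. of_int (sign \<sigma>) * (\<Prod>i\<in>{1..m}. ?g i (\<sigma> i)))"
    unfolding cdet_def
  proof (rule sum.mono_neutral_right)
    show "\<forall>\<sigma>\<in>{\<sigma>. \<sigma> permutes {1..m}} - {id, ?t}. of_int (sign \<sigma>) * (\<Prod>i\<in>{1..m}. ?g i (\<sigma> i)) = 0"
    proof
      fix \<sigma> assume \<sigma>: "\<sigma> \<in> {\<sigma>. \<sigma> permutes {1..m}} - {id, ?t}"
      then have p: "\<sigma> permutes {1..m}" by simp
      have "\<exists>i\<in>{1..m}. i \<notin> {l, l+1} \<and> \<sigma> i \<noteq> i"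
      proof (rule ccontr)
        assume "\<not> ?thesis"
        then have "\<sigma> i = i" if "i \<notin> {l, l+1}" for i using permutes_not_in[OF p, of i] that by blast
        then have "\<sigma> permutes {l, l+1}" using p unfolding permutes_def by blast
        then show False using \<sigma> unfolding permutes_doubleton_iff by blast
      qed
      then obtain i where i: "i \<in> {1..m}" "i \<notin> {l, l+1}" "\<sigma> i \<noteq> i" by blast
      then have "?g i (\<sigma> i) = 0" by (auto simp: blk_def)
      then have "(\<Prod>i\<in>{1..m}. ?g i (\<sigma> i)) = 0" using i by (intro prod_zero) auto
      then show "of_int (sign \<sigma>) * (\<Prod>i\<in>{1..m}. ?g i (\<sigma> i)) = 0" by simp
    qed
    have "?t permutes {1..m}" using l by (intro permutes_swap_id) auto
    then show "{id, ?t} \<subseteq> {\<sigma>. \<sigma> permutes {1..m}}" by (simp add: permutes_id)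
  qed (simp add: finite_permutations)
  also have "\<dots> = (\<Prod>i\<in>{1..m}. ?g i i) - (\<Prod>i\<in>{1..m}. ?g i (?t i))"
  proof -
    have "id \<noteq> ?t" by (metis id_apply n_not_Suc_n transpose_apply_first Suc_eq_plus1)
    then show ?thesis by (simp add: sign_swap_id)
  qed
  also have "(\<Prod>i\<in>{1..m}. ?g i i) = (\<Prod>i\<in>{l, l+1}. ?g i i)"
    by (rule prod.mono_neutral_right) (use l in \<open>auto simp: blk_def\<close>)
  also have "(\<Prod>i\<in>{1..m}. ?g i (?t i)) = (\<Prod>i\<in>{l, l+1}. ?g i (?t i))"
    by (rule prod.mono_neutral_right) (use l in \<open>auto simp: blk_def Transposition.transpose_def\<close>)
  finally show ?thesis using l by (simp add: blk_def)
qed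

lemma cdet_id_mat: "cdet m (id_mat m) = 1"
  by (subst cdet_diagonal) (auto simp: id_mat_def)

lemma SU_unitary:
  "g \<in> SU m \<Longrightarrow> i \<in> {1..m} \<Longrightarrow> j \<in> {1..m} \<Longrightarrow> (\<Sum>t\<in>{1..m}. cnj (g t i) * g t j) = (if i = j then 1 else 0)"
  unfolding SU_def by blast

lemma SU_support: "g \<in> SU m \<Longrightarrow> \<not> (i \<in> {1..m} \<and> j \<in> {1..m}) \<Longrightarrow> g i j = 0"
  unfolding SU_def by blast

lemma SU_I:
  assumes "\<And>i j. \<not> (i \<in> {1..m} \<and> j \<in> {1..m}) \<Longrightarrow> g i j = 0"
    "\<And>i j. i \<in> {1..m} \<Longrightarrow> j \<in> {1..m} \<Longrightarrow> (\<Sum>t\<in>{1..m}. cnj (g t i) * g t j) = (if i = j then 1 else 0)"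
    "cdet m g = 1"
  shows "g \<in> SU m"
  using assms unfolding SU_def by blast

lemma cmatmul_in_SU:
  assumes g: "g \<in> SU m" and h: "h \<in> SU m"
  shows "cmatmul m g h \<in> SU m"
proof (rule SU_I)
  fix i j assume "\<not> (i \<in> {1..m} \<and> j \<in> {1..m})"
  then show "cmatmul m g h i j = 0"
    unfolding cmatmul_def using SU_support[OF g] SU_support[OF h] by (intro sum.neutral) auto
next
  fix i j assume ij: "i \<in> {1..m}" "j \<in> {1..m}"
  have "(\<Sum>t\<in>{1..m}. cnj (cmatmul m g h t i) * cmatmul m g h t j)
     = (\<Sum>t\<in>{1..m}. \<Sum>s\<in>{1..m}. \<Sum>r\<in>{1..m}. cnj (h s i) * h r j * (cnj (g t s) * g t r))"
    unfolding cmatmul_def cnj_sum complex_cnj_mult sum_product by (intro sum.cong refl) (simp add: ac_simps)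
  also have "\<dots> = (\<Sum>s\<in>{1..m}. \<Sum>r\<in>{1..m}. cnj (h s i) * h r j * (\<Sum>t\<in>{1..m}. cnj (g t s) * g t r))"
    by (subst sum.swap, rule sum.cong[OF refl], subst sum.swap) (simp add: sum_distrib_left)
  also have "\<dots> = (\<Sum>s\<in>{1..m}. \<Sum>r\<in>{1..m}. cnj (h s i) * h r j * (if s = r then 1 else 0))"
    using SU_unitary[OF g] by (intro sum.cong refl) auto
  also have "\<dots> = (\<Sum>s\<in>{1..m}. cnj (h s i) * h s j)" by (simp add: sum_mult_delta)
  finally show "(\<Sum>t\<in>{1..m}. cnj (cmatmul m g h t i) * cmatmul m g h t j) = (if i = j then 1 else 0)"
    using SU_unitary[OF h ij] by simp
next
  show "cdet m (cmatmul m g h) = 1" using g h by (simp add: cdet_mult SU_def)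
qed

definition plane :: "nat \<Rightarrow> nat \<Rightarrow> complex \<Rightarrow> complex \<Rightarrow> cmat" where
  "plane m l a b = blk m l a b (- cnj b) (cnj a)"

lemma plane_in_SU:
  assumes l: "l \<in> {1..<m}" and ab: "(cmod a)\<^sup>2 + (cmod b)\<^sup>2 = 1"
  shows "plane m l a b \<in> SU m"
proof (rule SU_I)
  have ab': "a * cnj a + b * cnj b = 1"
    using ab by (metis complex_norm_square of_real_1 of_real_add of_real_power)
  show "cdet m (plane m l a b) = 1" using ab' by (simp add: plane_def cdet_blk[OF l])
  fix i j
  show "\<not> (i \<in> {1..m} \<and> j \<in> {1..m}) \<Longrightarrow> plane m l a b i j = 0" unfolding plane_def blk_def by (rule if_not_P)
  assume i: "i \<in> {1..m}" and j: "j \<in> {1..m}"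
  have "(\<Sum>t\<in>{1..m}. cnj (plane m l a b t i) * plane m l a b t j)
      = (\<Sum>t\<in>{1..m}. blk m l a (- cnj b) b (cnj a) j t * cnj (plane m l a b t i))"
    unfolding plane_def using blk_transpose[of m l a b "- cnj b" "cnj a" _ j] by (simp add: mult.commute)
  also have "\<dots> = (if i = j then 1 else 0)"
  proof -
    have e: "plane m l a b l i = (if i = l then a else if i = l+1 then b else 0)"
      "plane m l a b (l+1) i = (if i = l then - cnj b else if i = l+1 then cnj a else 0)"
      "j \<noteq> l \<Longrightarrow> j \<noteq> l+1 \<Longrightarrow> plane m l a b j i = (if i = j then 1 else 0)"
      using i j l by (simp_all add: plane_def blk_def)
    have 1: "a * cnj a + cnj b * b = 1" "b * cnj b + cnj a * a = 1" using ab' by (simp_all add: ac_simps)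
    consider "j = l" | "j = l+1" | "j \<noteq> l" "j \<noteq> l+1" by blast
    then show ?thesis
    proof cases
      case 1
      then show ?thesis unfolding sum_blk_row[OF l j] e using \<open>a * cnj a + cnj b * b = 1\<close> by (simp add: mult.commute)
    next
      case 2
      then show ?thesis unfolding sum_blk_row[OF l j] e using \<open>b * cnj b + cnj a * a = 1\<close> by (simp add: mult.commute)
    next
      case 3
      then show ?thesis unfolding sum_blk_row[OF l j] using e(3) by simp
    qed
  qed
  finally show "(\<Sum>t\<in>{1..m}. cnj (plane m l a b t i) * plane m l a b t j) = (if i = j then 1 else 0)" .
qed

lemma cmatmul_plane:
  assumes l: "l \<in> {1..<m}" and i: "i \<in> {1..m}"
  shows "cmatmul m (plane m l a b) g i j = (if i = l then a * g l j + b * g (l+1) j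
     else if i = l+1 then cnj a * g (l+1) j - cnj b * g l j else g i j)"
  unfolding cmatmul_def plane_def sum_blk_row[OF l i] by (auto simp: algebra_simps)

text \<open>The result is not merely (0, r) up to a phase: r is real and nonnegative. This lets a
  finished column have diagonal entry exactly 1, since no further phase correction is available
  inside the plane rotations.\<close>

lemma plane_rotates_to_axis:
  obtains a b r where "(cmod a)\<^sup>2 + (cmod b)\<^sup>2 = 1" "a * x + b * y = 0"
    "cnj a * y - cnj b * x = complex_of_real r" "0 \<le> r"
proof (cases "x = 0 \<and> y = 0")
  case True
  then show thesis using that[of 1 0 0] by simp
next
  case False
  define r where "r = sqrt ((cmod x)\<^sup>2 + (cmod y)\<^sup>2)"
  have rpos: "r > 0" unfolding r_def using False by (auto simp: sum_power2_gt_zero_iff)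
  have r2: "r\<^sup>2 = (cmod x)\<^sup>2 + (cmod y)\<^sup>2" by (simp add: r_def)
  have xy: "x * cnj x + y * cnj y = complex_of_real (r * r)"
    using r2 by (metis complex_norm_square of_real_add of_real_power power2_eq_square)
  show thesis
  proof (rule that[of "y / r" "- x / r" r])
    show "(cmod (y / r))\<^sup>2 + (cmod (- x / r))\<^sup>2 = 1"
    proof -
      have "(cmod (y / r))\<^sup>2 + (cmod (- x / r))\<^sup>2 = ((cmod x)\<^sup>2 + (cmod y)\<^sup>2) / r\<^sup>2"
        by (simp add: norm_divide power_divide add_divide_distrib)
      then show ?thesis unfolding r2[symmetric] using rpos by simp
    qed
    show "y / r * x + - x / r * y = 0" by simp
    have "cnj (y / r) * y - cnj (- x / r) * x = (x * cnj x + y * cnj y) / r"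
      by (simp add: add_divide_distrib mult.commute)
    then show "cnj (y / r) * y - cnj (- x / r) * x = complex_of_real r"
      unfolding xy using rpos by simp
  qed (use rpos in simp)
qed

text \<open>Givens rotations: acting from the left with rotations in the planes of consecutive
  coordinates turns the last column into a unit vector, then the one before it, and so on.\<close>
lemma SU_plane_induct:
  assumes m: "1 \<le> m" and one: "Q (id_mat m)"
    and step: "\<And>l a b g. l \<in> {1..<m} \<Longrightarrow> (cmod a)\<^sup>2 + (cmod b)\<^sup>2 = 1 \<Longrightarrow> g \<in> SU m \<Longrightarrow>
        Q (cmatmul m (plane m l a b) g) \<Longrightarrow> Q g"
    and g: "g \<in> SU m"
  shows "Q g"
proof -
  have "\<forall>g\<in>SU m. (\<forall>s\<in>{J<..m}. \<forall>t\<in>{1..m}. g t s = (if t = s then 1 else 0)) \<longrightarrow> Q g" if "1 \<le> J" "J \<le> m" for J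
    using that
  proof (induction J rule: dec_induct)
    case base
    show ?case
    proof (intro ballI impI)
      fix g assume g: "g \<in> SU m" and cols: "\<forall>s\<in>{1<..m}. \<forall>t\<in>{1..m}. g t s = (if t = s then 1 else 0)"
      have off: "g i j = 0" if i: "i \<in> {1..m}" and ij: "i \<noteq> j" for i j
      proof (cases "j \<in> {1<..m}")
        case True
        then show ?thesis using cols i ij by auto
      next
        case False
        show ?thesis
        proof (cases "j = 1")
          case True
          have i1: "i \<in> {1<..m}" using i ij True by auto
          have "(\<Sum>t\<in>{1..m}. cnj (g t i) * g t 1) = (\<Sum>t\<in>{1..m}. (if t = i then 1 else 0) * g t 1)"
            using cols i1 by (intro sum.cong refl) auto
          also have "\<dots> = g i 1" using i by (simp add: sum_mult_delta)
          finally show ?thesis using SU_unitary[OF g i, of 1] m ij True by simp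
        next
          case False
          then show ?thesis using SU_support[OF g, of i j] \<open>j \<notin> {1<..m}\<close> by auto
        qed
      qed
      \<comment> \<open>All diagonal entries but the first are already 1; the determinant fixes the
        remaining one.\<close>
      have "1 = (\<Prod>i\<in>{1..m}. g i i)" using cdet_diagonal[OF off] g by (simp add: SU_def)
      also have "\<dots> = (\<Prod>i\<in>{1}. g i i)"
        by (rule prod.mono_neutral_right) (use m cols in auto)
      finally have "g 1 1 = 1" by simp
      then have "g i j = id_mat m i j" for i j
        using off cols SU_support[OF g, of i j] by (cases "i \<in> {1..m} \<and> i = j"; cases "i = 1") (auto simp: id_mat_def)
      then have "g = id_mat m" by blast
      then show "Q g" using one by simp
    qed
  next
    case (step J)
    note outer = step.prems step.hyps and outer_IH = step.IH
    have IH: "Q g" if "g \<in> SU m" "\<And>s t. s \<in> {J<..m} \<Longrightarrow> t \<in> {1..m} \<Longrightarrow> g t s = (if t = s then 1 else 0)" for g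
      using outer_IH outer that by auto
    let ?J = "Suc J"
    \<comment> \<open>Here the entries of column \<open>?J\<close> above row \<open>i\<close> are
      already zero, and the entry in row \<open>i\<close> is real and nonnegative as the outcome of
      the last rotation. For \<open>i = 1\<close> no rotation has taken place yet, hence the guard
      \<open>1 < i\<close>. The induction goes down from \<open>i = ?J\<close>.\<close>
    have inner: "\<forall>g\<in>SU m. (\<forall>s\<in>{?J<..m}. \<forall>t\<in>{1..m}. g t s = (if t = s then 1 else 0)) \<longrightarrow>
        (\<forall>t. 1 \<le> t \<longrightarrow> t < i \<longrightarrow> g t ?J = 0) \<longrightarrow> (1 < i \<longrightarrow> (\<exists>r\<ge>0. g i ?J = complex_of_real r)) \<longrightarrow> Q g"
      if "1 \<le> i" "i \<le> ?J" for i
      using that(2,1)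
    proof (induction i rule: inc_induct)
      case base
      show ?case
      proof (intro ballI impI)
        fix g assume g: "g \<in> SU m" and cols: "\<forall>s\<in>{?J<..m}. \<forall>t\<in>{1..m}. g t s = (if t = s then 1 else 0)"
          and z: "\<forall>t. 1 \<le> t \<longrightarrow> t < ?J \<longrightarrow> g t ?J = 0" and r: "1 < ?J \<longrightarrow> (\<exists>r\<ge>0. g ?J ?J = complex_of_real r)"
        have J: "?J \<in> {1..m}" using outer by simp
        obtain r where r: "0 \<le> r" "g ?J ?J = complex_of_real r" using r outer by auto
        \<comment> \<open>Orthogonality to the finished unit columns clears the entries below the
          diagonal.\<close>
        have below: "g t ?J = 0" if t: "t \<in> {?J<..m}" for t
        proof -
          have "(\<Sum>s\<in>{1..m}. cnj (g s t) * g s ?J) = (\<Sum>s\<in>{1..m}. (if s = t then 1 else 0) * g s ?J)"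
            using cols t by (intro sum.cong refl) auto
          also have "\<dots> = g t ?J" using t by (simp add: sum_mult_delta)
          finally show ?thesis using SU_unitary[OF g _ J, of t] t by auto
        qed
        have zero: "g t ?J = 0" if "t \<in> {1..m}" "t \<noteq> ?J" for t
          using z below[of t] that by (cases "t < ?J") auto
        have "1 = (\<Sum>s\<in>{1..m}. cnj (g s ?J) * g s ?J)" using SU_unitary[OF g J J] by simp
        also have "\<dots> = (\<Sum>s\<in>{?J}. cnj (g s ?J) * g s ?J)"
          by (rule sum.mono_neutral_right) (use J zero in auto)
        finally have "complex_of_real (r * r) = 1" using r by simp
        then have "r * r = 1" by (metis of_real_eq_1_iff)
        then have "r = 1" using r(1) by (metis abs_of_nonneg power2_eq_1_iff power2_eq_square real_sqrt_abs real_sqrt_one)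
        then show "Q g" using IH[OF g] cols zero r(2) by (metis (full_types) Suc_leI greaterThanAtMost_iff le_neq_implies_less of_real_1)
      qed
    next
      case (step i)
      show ?case
      proof (intro ballI impI)
        fix g assume g: "g \<in> SU m" and cols: "\<forall>s\<in>{?J<..m}. \<forall>t\<in>{1..m}. g t s = (if t = s then 1 else 0)"
          and z: "\<forall>t. 1 \<le> t \<longrightarrow> t < i \<longrightarrow> g t ?J = 0"
        obtain a b r where abr: "(cmod a)\<^sup>2 + (cmod b)\<^sup>2 = 1" "a * g i ?J + b * g (Suc i) ?J = 0"
            "cnj a * g (Suc i) ?J - cnj b * g i ?J = complex_of_real r" "0 \<le> r"
          by (rule plane_rotates_to_axis)
        have i: "i \<in> {1..<m}" using step outer by auto
        let ?h = "cmatmul m (plane m i a b) g"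
        have h: "?h \<in> SU m" by (rule cmatmul_in_SU[OF plane_in_SU[OF i abr(1)] g])
        have "Q ?h"
        proof (rule step.IH[rule_format, OF _ h])
          fix s t assume "s \<in> {?J<..m}" "t \<in> {1..m}"
          then show "?h t s = (if t = s then 1 else 0)"
            using cols step.hyps i by (auto simp: cmatmul_plane)
        next
          fix t assume t: "1 \<le> t" "t < Suc i"
          then show "?h t ?J = 0" using z abr(2) i by (auto simp: cmatmul_plane)
        next
          show "\<exists>r\<ge>0. ?h (Suc i) ?J = complex_of_real r" using abr i by (auto simp: cmatmul_plane)
        qed simp
        then show "Q g" using assms(3)[OF i abr(1) g] by blast
      qed
    qed
    show ?case
    proof (intro ballI impI)
      fix g assume "g \<in> SU m" "\<forall>s\<in>{?J<..m}. \<forall>t\<in>{1..m}. g t s = (if t = s then 1 else 0)"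
      then show "Q g" using inner[of 1] by auto
    qed
  qed
  from this[of m] show ?thesis using g m by auto
qed

section \<open>Haar averages of unitary representations\<close>

text \<open>This is exp(\<theta> K) = cos \<theta> + K sin \<theta> inside the plane, for K = (ic,
  b; -cnj b, -ic), whose square is -1 when c^2 + |b|^2 = 1.\<close>

definition rot :: "nat \<Rightarrow> nat \<Rightarrow> real \<Rightarrow> complex \<Rightarrow> real \<Rightarrow> cmat" where
  "rot m l c b \<theta> = plane m l (of_real (cos \<theta>) + \<i> * of_real c * of_real (sin \<theta>)) (b * of_real (sin \<theta>))"

text \<open>Every element of SU(2) lies on a one-parameter subgroup: as a unit quaternion it has
  real part cos \<theta> and imaginary part of length sin \<theta>. If the latter is zero the axis
  is arbitrary, and (1, 0) is taken.\<close>

lemma plane_polar: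
  assumes "(cmod a)\<^sup>2 + (cmod b)\<^sup>2 = 1"
  obtains c d \<theta> where "c\<^sup>2 + (cmod d)\<^sup>2 = 1" "plane m l a b = rot m l c d \<theta>"
proof -
  define s where "s = sqrt ((Im a)\<^sup>2 + (cmod b)\<^sup>2)"
  have s2: "s\<^sup>2 = (Im a)\<^sup>2 + (cmod b)\<^sup>2" by (simp add: s_def)
  have "(Re a)\<^sup>2 + s\<^sup>2 = 1" using assms unfolding s2 cmod_power2 by simp
  then obtain \<theta> where \<theta>: "Re a = cos \<theta>" "s = sin \<theta>" by (rule sincos_total_2pi)
  show thesis
  proof (cases "s = 0")
    case True
    then have "Im a = 0" "b = 0" using s2 by (simp_all add: sum_power2_eq_zero_iff)
    then have "plane m l a b = rot m l 1 0 \<theta>"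
    proof -
      have "a = complex_of_real (cos \<theta>)" using \<open>Im a = 0\<close> \<theta>(1) by (simp add: complex_eq_iff)
      then show ?thesis using \<open>b = 0\<close> True \<theta>(2) by (simp add: rot_def)
    qed
    then show thesis using that[of 1 0 \<theta>] by simp
  next
    case False
    have "(Im a / s)\<^sup>2 + (cmod (b / s))\<^sup>2 = ((Im a)\<^sup>2 + (cmod b)\<^sup>2) / s\<^sup>2"
      by (simp add: norm_divide power_divide add_divide_distrib)
    then have "(Im a / s)\<^sup>2 + (cmod (b / s))\<^sup>2 = 1" unfolding s2[symmetric] using False by simp
    moreover have "a = complex_of_real (cos \<theta>) + \<i> * complex_of_real (Im a / s) * complex_of_real (sin \<theta>)"
      using \<theta> False by (simp add: complex_eq_iff)
    moreover have "b = b / complex_of_real s * complex_of_real (sin \<theta>)" using \<theta> False by simp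
    ultimately show thesis using that[of "Im a / s" "b / s" \<theta>] by (simp add: rot_def)
  qed
qed

lemma rot_unit:
  assumes "c\<^sup>2 + (cmod b)\<^sup>2 = 1"
  shows "(cmod (of_real (cos \<theta>) + \<i> * of_real c * of_real (sin \<theta>)))\<^sup>2 + (cmod (b * of_real (sin \<theta>)))\<^sup>2 = 1"
proof -
  have "(cmod (of_real (cos \<theta>) + \<i> * of_real c * of_real (sin \<theta>)))\<^sup>2 + (cmod (b * of_real (sin \<theta>)))\<^sup>2
      = (cos \<theta>)\<^sup>2 + (c\<^sup>2 + (cmod b)\<^sup>2) * (sin \<theta>)\<^sup>2"
    by (simp add: cmod_power2 norm_mult power_mult_distrib distrib_right)
  then show ?thesis using assms by simp
qed

lemma rot_in_SU: "l \<in> {1..<m} \<Longrightarrow> c\<^sup>2 + (cmod b)\<^sup>2 = 1 \<Longrightarrow> rot m l c b \<theta> \<in> SU m"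
  unfolding rot_def by (intro plane_in_SU rot_unit)

lemma rot_0: "l \<in> {1..<m} \<Longrightarrow> rot m l c b 0 = id_mat m"
  by (simp add: rot_def plane_def blk_one)

text \<open>The relation K^2 = -1 enters through \<open>cb'\<close>; everything else is the addition
  theorems.\<close>

lemma rot_add:
  assumes l: "l \<in> {1..<m}" and cb: "c\<^sup>2 + (cmod b)\<^sup>2 = 1"
  shows "rot m l c b (x + y) = cmatmul m (rot m l c b x) (rot m l c b y)"
proof (rule ext, rule ext)
  fix i j
  let ?a = "\<lambda>x. complex_of_real (cos x) + \<i> * c * sin x" and ?b = "\<lambda>x. b * complex_of_real (sin x)"
  have cb': "complex_of_real c * complex_of_real c + b * cnj b = 1"
    using cb by (metis complex_norm_square of_real_1 of_real_add of_real_power power2_eq_square)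
  have ii: "\<i> * \<i> = -1" by simp
  have A: "?a (x + y) = ?a x * ?a y + ?b x * (- cnj (?b y))"
  proof -
    have "?a x * ?a y + ?b x * (- cnj (?b y))
      = complex_of_real (cos x * cos y) - (complex_of_real c * complex_of_real c + b * cnj b) * (sin x * sin y)
        + \<i> * c * (sin x * cos y + cos x * sin y)"
      by (simp add: algebra_simps) 
    then show ?thesis unfolding cb' by (simp add: cos_add sin_add algebra_simps)
  qed
  have B: "?b (x + y) = ?a x * ?b y + ?b x * cnj (?a y)"
    by (simp add: sin_add algebra_simps)
  show "rot m l c b (x + y) i j = cmatmul m (rot m l c b x) (rot m l c b y) i j"
  proof (cases "i \<in> {1..m} \<and> j \<in> {1..m}")
    case True
    then have i: "i \<in> {1..m}" and j: "j \<in> {1..m}" by auto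
    have e: "plane m l a b l j = (if j = l then a else if j = l+1 then b else 0)"
      "plane m l a b (l+1) j = (if j = l then - cnj b else if j = l+1 then cnj a else 0)" for a b
      using j l by (simp_all add: plane_def blk_def)
    consider "i = l" | "i = l+1" | "i \<noteq> l" "i \<noteq> l+1" by blast
    then show ?thesis
    proof cases
      case 1
      have l': "l \<in> {1..m}" using l by simp
      show ?thesis unfolding rot_def 1 cmatmul_plane[OF l l'] e A B by simp
    next
      case 2
      have A': "cnj (?a (x + y)) = cnj (?a x) * cnj (?a y) - cnj (?b x) * ?b y" unfolding A by (simp add: algebra_simps)
      have B': "- cnj (?b (x + y)) = - cnj (?a x) * cnj (?b y) - cnj (?b x) * ?a y" unfolding B by (simp add: algebra_simps)
      have l': "l + 1 \<in> {1..m}" using l by simp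
      have sl: "cmatmul m (plane m l a b) g (l + 1) j = cnj a * g (l+1) j - cnj b * g l j" for a b g
        using cmatmul_plane[OF l l'] by simp
      show ?thesis unfolding rot_def 2 sl e A' B' by (simp add: algebra_simps)
    next
      case 3
      then show ?thesis unfolding rot_def cmatmul_plane[OF l i] by (simp add: plane_def blk_def)
    qed
  next
    case False
    have "cmatmul m (rot m l c b x) (rot m l c b y) i j = 0"
      using False SU_support[OF cmatmul_in_SU[OF rot_in_SU[OF l cb] rot_in_SU[OF l cb]]] by blast
    then show ?thesis using False SU_support[OF rot_in_SU[OF l cb]] by metis
  qed
qed

text \<open>The last assumption is the differential of the representation along the generator
  (ic, b; - cnj b, -ic) = ic H + b E - (cnj b) F of a plane rotation.\<close>
locale su_rep =
  fixes m :: nat and B :: "'a set" and \<rho> :: "cmat \<Rightarrow> 'a \<Rightarrow> 'a \<Rightarrow> complex"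
    and U D H :: "nat \<Rightarrow> 'a \<Rightarrow> 'a \<Rightarrow> complex"
  assumes finite_B: "finite B"
    and mult: "\<And>g h a b. g \<in> SU m \<Longrightarrow> h \<in> SU m \<Longrightarrow> a \<in> B \<Longrightarrow> b \<in> B \<Longrightarrow>
        \<rho> (cmatmul m g h) a b = (\<Sum>c\<in>B. \<rho> g a c * \<rho> h c b)"
    and one: "\<And>a b. a \<in> B \<Longrightarrow> b \<in> B \<Longrightarrow> \<rho> (id_mat m) a b = (if a = b then 1 else 0)"
    and unit: "\<And>g a b. g \<in> SU m \<Longrightarrow> a \<in> B \<Longrightarrow> b \<in> B \<Longrightarrow>
        (\<Sum>c\<in>B. cnj (\<rho> g c a) * \<rho> g c b) = (if a = b then 1 else 0)"
    and meas: "\<And>a b. a \<in> B \<Longrightarrow> b \<in> B \<Longrightarrow> (\<lambda>g. \<rho> g a b) \<in> borel_measurable borel"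
    and deriv: "\<And>l c \<beta> a b. l \<in> {1..<m} \<Longrightarrow> c\<^sup>2 + (cmod \<beta>)\<^sup>2 = 1 \<Longrightarrow> a \<in> B \<Longrightarrow> b \<in> B \<Longrightarrow>
        ((\<lambda>\<theta>. \<rho> (rot m l c \<beta> \<theta>) a b) has_vector_derivative
          (\<i> * c * H l a b + \<beta> * U l a b - cnj \<beta> * D l a b)) (at 0)"

text \<open>Conjugating the derivative exchanges \<beta> with \<open>cnj \<beta>\<close>, so raising
  and lowering swap roles, with a minus sign that also absorbs the conjugate of \<i>.\<close>

lemma su_rep_cnj:
  assumes "su_rep m B \<rho> U D H"
  shows "su_rep m B (\<lambda>g a b. cnj (\<rho> g a b)) (\<lambda>l a b. - cnj (D l a b)) (\<lambda>l a b. - cnj (U l a b)) (\<lambda>l a b. - cnj (H l a b))"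
proof -
  interpret su_rep m B \<rho> U D H by fact
  show ?thesis
  proof
    fix g a b assume "g \<in> SU m" "a \<in> B" "b \<in> B"
    then have "cnj (\<Sum>c\<in>B. cnj (\<rho> g c a) * \<rho> g c b) = (if a = b then 1 else 0)" using unit by simp
    then show "(\<Sum>c\<in>B. cnj (cnj (\<rho> g c a)) * cnj (\<rho> g c b)) = (if a = b then 1 else 0)" by simp
  next
    fix l a b and c :: real and \<beta>
    assume a: "l \<in> {1..<m}" "c\<^sup>2 + (cmod \<beta>)\<^sup>2 = 1" "a \<in> B" "b \<in> B"
    show "((\<lambda>\<theta>. cnj (\<rho> (rot m l c \<beta> \<theta>) a b)) has_vector_derivative
        \<i> * c * - cnj (H l a b) + \<beta> * - cnj (D l a b) - cnj \<beta> * - cnj (U l a b)) (at 0)"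
      using has_vector_derivative_cnj[OF deriv[OF a]] by (simp add: algebra_simps)
  next
    fix a b assume "a \<in> B" "b \<in> B"
    then show "(\<lambda>g. cnj (\<rho> g a b)) \<in> borel_measurable borel"
      using meas by (intro borel_measurable_continuous_on[of cnj]) (auto intro: continuous_intros)
  qed (use finite_B mult one in auto)
qed

lemma su_rep_tensor:
  assumes "su_rep m B1 \<rho>1 U1 D1 H1" "su_rep m B2 \<rho>2 U2 D2 H2"
  shows "su_rep m (B1 \<times> B2) (\<lambda>g (a, b) (c, d). \<rho>1 g a c * \<rho>2 g b d)
    (\<lambda>l. tprod (U1 l) (U2 l)) (\<lambda>l. tprod (D1 l) (D2 l)) (\<lambda>l. tprod (H1 l) (H2 l))"
proof -
  interpret r1: su_rep m B1 \<rho>1 U1 D1 H1 by fact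
  interpret r2: su_rep m B2 \<rho>2 U2 D2 H2 by fact
  have prod: "(\<Sum>c\<in>B1 \<times> B2. case c of (x, y) \<Rightarrow> f x * h y) = (\<Sum>x\<in>B1. f x) * (\<Sum>y\<in>B2. h y)"
    for f h :: "_ \<Rightarrow> complex"
    by (simp add: sum_product sum.cartesian_product)
  show ?thesis
  proof
    show "finite (B1 \<times> B2)" using r1.finite_B r2.finite_B by simp
  next
    fix g h a b assume gh: "g \<in> SU m" "h \<in> SU m" and ab: "a \<in> B1 \<times> B2" "b \<in> B1 \<times> B2"
    obtain a1 a2 b1 b2 where e: "a = (a1, a2)" "b = (b1, b2)" by fastforce
    show "(case a of (a, b) \<Rightarrow> \<lambda>(c, d). \<rho>1 (cmatmul m g h) a c * \<rho>2 (cmatmul m g h) b d) b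
       = (\<Sum>c\<in>B1 \<times> B2. (case a of (a, b) \<Rightarrow> \<lambda>(c, d). \<rho>1 g a c * \<rho>2 g b d) c *
           (case c of (a, b) \<Rightarrow> \<lambda>(c, d). \<rho>1 h a c * \<rho>2 h b d) b)"
      using prod[of "\<lambda>x. \<rho>1 g a1 x * \<rho>1 h x b1" "\<lambda>y. \<rho>2 g a2 y * \<rho>2 h y b2"] r1.mult[OF gh, of a1 b1] r2.mult[OF gh, of a2 b2] ab
      unfolding e by (simp add: case_prod_beta ac_simps)
  next
    fix a b assume ab: "a \<in> B1 \<times> B2" "b \<in> B1 \<times> B2"
    then show "(case a of (a, b) \<Rightarrow> \<lambda>(c, d). \<rho>1 (id_mat m) a c * \<rho>2 (id_mat m) b d) b = (if a = b then 1 else 0)"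
      by (auto simp: r1.one r2.one split: if_splits)
    show "(\<lambda>g. (case a of (a, b) \<Rightarrow> \<lambda>(c, d). \<rho>1 g a c * \<rho>2 g b d) b) \<in> borel_measurable borel"
      using ab by (auto intro!: borel_measurable_times r1.meas r2.meas)
  next
    fix g a b assume g: "g \<in> SU m" and ab: "a \<in> B1 \<times> B2" "b \<in> B1 \<times> B2"
    obtain a1 a2 b1 b2 where e: "a = (a1, a2)" "b = (b1, b2)" by fastforce
    show "(\<Sum>c\<in>B1 \<times> B2. cnj ((case c of (a, b) \<Rightarrow> \<lambda>(c, d). \<rho>1 g a c * \<rho>2 g b d) a) *
           (case c of (a, b) \<Rightarrow> \<lambda>(c, d). \<rho>1 g a c * \<rho>2 g b d) b) = (if a = b then 1 else 0)"
      using prod[of "\<lambda>x. cnj (\<rho>1 g x a1) * \<rho>1 g x b1" "\<lambda>y. cnj (\<rho>2 g y a2) * \<rho>2 g y b2"] r1.unit[OF g, of a1 b1] r2.unit[OF g, of a2 b2] ab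
      unfolding e by (simp add: case_prod_beta ac_simps)
  next
    fix l a b and c :: real and \<beta>
    assume l: "l \<in> {1..<m}" "c\<^sup>2 + (cmod \<beta>)\<^sup>2 = 1" and ab: "a \<in> B1 \<times> B2" "b \<in> B1 \<times> B2"
    obtain a1 a2 b1 b2 where e: "a = (a1, a2)" "b = (b1, b2)" by fastforce
    have mem: "a1 \<in> B1" "b1 \<in> B1" "a2 \<in> B2" "b2 \<in> B2" using ab unfolding e by auto
    have "((\<lambda>\<theta>. \<rho>1 (rot m l c \<beta> \<theta>) a1 b1 * \<rho>2 (rot m l c \<beta> \<theta>) a2 b2) has_vector_derivative
        \<rho>1 (rot m l c \<beta> 0) a1 b1 * (\<i> * c * H2 l a2 b2 + \<beta> * U2 l a2 b2 - cnj \<beta> * D2 l a2 b2)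
        + (\<i> * c * H1 l a1 b1 + \<beta> * U1 l a1 b1 - cnj \<beta> * D1 l a1 b1) * \<rho>2 (rot m l c \<beta> 0) a2 b2) (at 0)"
      by (rule has_vector_derivative_mult[OF r1.deriv[OF l mem(1,2)] r2.deriv[OF l mem(3,4)]])
    then show "((\<lambda>\<theta>. (case a of (a, b) \<Rightarrow> \<lambda>(a', b'). \<rho>1 (rot m l c \<beta> \<theta>) a a' * \<rho>2 (rot m l c \<beta> \<theta>) b b') b) has_vector_derivative
        \<i> * c * tprod (H1 l) (H2 l) a b + \<beta> * tprod (U1 l) (U2 l) a b - cnj \<beta> * tprod (D1 l) (D2 l) a b) (at 0)"
      unfolding e using r1.one[OF mem(1,2)] r2.one[OF mem(3,4)] rot_0[OF l(1)]
      by (simp add: tprod_def algebra_simps split: if_splits)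
  qed
qed

context su_rep
begin

definition lie_invariant :: "('a \<Rightarrow> complex) \<Rightarrow> bool" where
  "lie_invariant x \<longleftrightarrow> (\<forall>l\<in>{1..<m}. \<forall>a\<in>B. (\<Sum>b\<in>B. U l a b * x b) = 0
     \<and> (\<Sum>b\<in>B. D l a b * x b) = 0 \<and> (\<Sum>b\<in>B. H l a b * x b) = 0)"

lemma deriv_apply:
  assumes l: "l \<in> {1..<m}" "c\<^sup>2 + (cmod \<beta>)\<^sup>2 = 1" and a: "a \<in> B"
  shows "((\<lambda>\<theta>. \<Sum>b\<in>B. \<rho> (rot m l c \<beta> \<theta>) a b * x b) has_vector_derivative
     \<i> * c * (\<Sum>b\<in>B. H l a b * x b) + \<beta> * (\<Sum>b\<in>B. U l a b * x b) - cnj \<beta> * (\<Sum>b\<in>B. D l a b * x b)) (at 0)"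
proof -
  have "((\<lambda>\<theta>. \<Sum>b\<in>B. \<rho> (rot m l c \<beta> \<theta>) a b * x b) has_vector_derivative
     (\<Sum>b\<in>B. (\<i> * c * H l a b + \<beta> * U l a b - cnj \<beta> * D l a b) * x b)) (at 0)"
    by (intro has_vector_derivative_sum has_vector_derivative_mult_left deriv[OF l a])
  moreover have "(\<Sum>b\<in>B. (\<i> * c * H l a b + \<beta> * U l a b - cnj \<beta> * D l a b) * x b)
     = \<i> * c * (\<Sum>b\<in>B. H l a b * x b) + \<beta> * (\<Sum>b\<in>B. U l a b * x b) - cnj \<beta> * (\<Sum>b\<in>B. D l a b * x b)"
    by (simp add: sum_distrib_left sum.distrib sum_subtractf algebra_simps)
  ultimately show ?thesis by simp
qed

text \<open>By the group law the derivative of the orbit at t is the image under the rotation by t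
  of the derivative at 0, which is zero; so the orbit is constant.\<close>

lemma rot_fixes_lie_invariant:
  assumes x: "lie_invariant x" and l: "l \<in> {1..<m}" "c\<^sup>2 + (cmod \<beta>)\<^sup>2 = 1" and a: "a \<in> B"
  shows "(\<Sum>b\<in>B. \<rho> (rot m l c \<beta> \<theta>) a b * x b) = x a"
proof -
  let ?F = "\<lambda>a \<theta>. \<Sum>b\<in>B. \<rho> (rot m l c \<beta> \<theta>) a b * x b"
  have d0: "(?F a has_vector_derivative 0) (at 0)" if "a \<in> B" for a
    using deriv_apply[OF l that, of x] x l that unfolding lie_invariant_def by simp
  have shift: "?F a (t + s) = (\<Sum>d\<in>B. \<rho> (rot m l c \<beta> t) a d * ?F d s)" for t s
  proof -
    have "?F a (t + s) = (\<Sum>b\<in>B. \<Sum>d\<in>B. \<rho> (rot m l c \<beta> t) a d * (\<rho> (rot m l c \<beta> s) d b * x b))"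
      unfolding rot_add[OF l] using mult[OF rot_in_SU[OF l] rot_in_SU[OF l] a]
      by (intro sum.cong refl) (simp add: sum_distrib_right mult.assoc)
    then show ?thesis by (subst (asm) sum.swap) (simp add: sum_distrib_left)
  qed
  have "(?F a has_vector_derivative 0) (at t)" for t
  proof -
    have "((\<lambda>s. \<Sum>d\<in>B. \<rho> (rot m l c \<beta> t) a d * ?F d s) has_vector_derivative (\<Sum>d\<in>B. \<rho> (rot m l c \<beta> t) a d * 0)) (at 0)"
      by (intro has_vector_derivative_sum has_vector_derivative_mult_right d0)
    then have s: "((\<lambda>s. ?F a (t + s)) has_vector_derivative 0) (at 0)" unfolding shift by simp
    have "((\<lambda>s. ?F a (t + s)) \<circ> (\<lambda>s. s - t) has_vector_derivative 1 *\<^sub>R 0) (at t)"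
      by (rule vector_diff_chain_at) (auto intro!: derivative_eq_intros s)
    then show ?thesis by (simp add: comp_def)
  qed
  then have "?F a \<theta> = ?F a 0"
    using has_vector_derivative_zero_constant[of UNIV "?F a"] by (metis UNIV_I convex_UNIV)
  also have "\<dots> = (\<Sum>b\<in>B. (if a = b then 1 else 0) * x b)"
    using one[OF a] rot_0[OF l(1)] by (intro sum.cong refl) simp
  also have "\<dots> = x a" using finite_B a by (simp add: sum_mult_delta)
  finally show ?thesis .
qed

text \<open>Induction over plane rotations p: the vector is fixed both by p and by p g, and the
  matrix of p is injective by unitarity, so it is fixed by g.\<close>

lemma fixes_lie_invariant:
  assumes m: "1 \<le> m" and x: "lie_invariant x" and g: "g \<in> SU m" and a: "a \<in> B"
  shows "(\<Sum>b\<in>B. \<rho> g a b * x b) = x a"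
proof -
  have "\<forall>a\<in>B. (\<Sum>b\<in>B. \<rho> g a b * x b) = x a"
  proof (rule SU_plane_induct[OF m _ _ g, where Q = "\<lambda>g. \<forall>a\<in>B. (\<Sum>b\<in>B. \<rho> g a b * x b) = x a"])
    show "\<forall>a\<in>B. (\<Sum>b\<in>B. \<rho> (id_mat m) a b * x b) = x a"
      using finite_B by (auto simp: one sum_mult_delta)
  next
    fix l \<alpha> \<beta> g assume l: "l \<in> {1..<m}" and ab: "(cmod \<alpha>)\<^sup>2 + (cmod \<beta>)\<^sup>2 = 1" and g: "g \<in> SU m"
      and Q: "\<forall>a\<in>B. (\<Sum>b\<in>B. \<rho> (cmatmul m (plane m l \<alpha> \<beta>) g) a b * x b) = x a"
    let ?p = "plane m l \<alpha> \<beta>"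
    have p: "?p \<in> SU m" by (rule plane_in_SU[OF l ab])
    obtain c d \<theta> where cd: "c\<^sup>2 + (cmod d)\<^sup>2 = 1" "?p = rot m l c d \<theta>"
      using plane_polar[OF ab] by metis
    have px: "(\<Sum>b\<in>B. \<rho> ?p a b * x b) = x a" if "a \<in> B" for a
      unfolding cd(2) by (rule rot_fixes_lie_invariant[OF x l cd(1) that])
    let ?gx = "\<lambda>a. \<Sum>b\<in>B. \<rho> g a b * x b"
    have pg: "(\<Sum>d\<in>B. \<rho> ?p a d * ?gx d) = x a" if a: "a \<in> B" for a
    proof -
      have "(\<Sum>d\<in>B. \<rho> ?p a d * ?gx d) = (\<Sum>b\<in>B. \<Sum>d\<in>B. \<rho> ?p a d * \<rho> g d b * x b)"
        by (subst sum.swap) (simp add: sum_distrib_left mult.assoc)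
      also have "\<dots> = (\<Sum>b\<in>B. \<rho> (cmatmul m ?p g) a b * x b)"
        using mult[OF p g a] by (intro sum.cong refl) (simp add: sum_distrib_right)
      finally show ?thesis using Q a by simp
    qed
    have inj: "y e = (\<Sum>a\<in>B. cnj (\<rho> ?p a e) * (\<Sum>d\<in>B. \<rho> ?p a d * y d))" if e: "e \<in> B" for y e
    proof -
      have "(\<Sum>a\<in>B. cnj (\<rho> ?p a e) * (\<Sum>d\<in>B. \<rho> ?p a d * y d)) = (\<Sum>d\<in>B. (\<Sum>a\<in>B. cnj (\<rho> ?p a e) * \<rho> ?p a d) * y d)"
        unfolding sum_distrib_left sum_distrib_right by (subst sum.swap) (simp add: mult.assoc)
      also have "\<dots> = (\<Sum>d\<in>B. (if e = d then 1 else 0) * y d)"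
        using unit[OF p e] by (intro sum.cong refl) simp
      finally show ?thesis using finite_B e by (simp add: sum_mult_delta)
    qed
    show "\<forall>a\<in>B. ?gx a = x a"
    proof
      fix e assume e: "e \<in> B"
      have "?gx e = (\<Sum>a\<in>B. cnj (\<rho> ?p a e) * x a)" using inj[OF e, of ?gx] pg by simp
      also have "\<dots> = x e" using inj[OF e, of x] px by simp
      finally show "?gx e = x e" .
    qed
  qed
  then show ?thesis using a by blast
qed

text \<open>Columns of a unitary matrix have norm 1; the bound makes the matrix elements
  integrable.\<close>

lemma norm_le_1:
  assumes g: "g \<in> SU m" and a: "a \<in> B" and b: "b \<in> B"
  shows "norm (\<rho> g a b) \<le> 1"
proof -
  have "complex_of_real (\<Sum>c\<in>B. (cmod (\<rho> g c b))\<^sup>2) = 1"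
    using unit[OF g b b] by (simp add: complex_norm_square mult.commute flip: of_real_power)
  then have "(\<Sum>c\<in>B. (cmod (\<rho> g c b))\<^sup>2) = 1" by (metis of_real_eq_1_iff)
  moreover have "(cmod (\<rho> g a b))\<^sup>2 \<le> (\<Sum>c\<in>B. (cmod (\<rho> g c b))\<^sup>2)"
    by (rule member_le_sum) (use a finite_B in auto)
  ultimately have "(cmod (\<rho> g a b))\<^sup>2 \<le> 1\<^sup>2" by simp
  then show ?thesis by (rule power2_le_imp_le) simp
qed

end

section \<open>The averaging operator as projector onto invariants\<close>

locale su_rep_haar = su_rep m B \<rho> U D H
  for m :: nat and B :: "'a set" and \<rho> :: "cmat \<Rightarrow> 'a \<Rightarrow> 'a \<Rightarrow> complex"
    and U D H :: "nat \<Rightarrow> 'a \<Rightarrow> 'a \<Rightarrow> complex" +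
  fixes \<mu> :: "cmat measure"
  assumes haar: "haar_SU m \<mu>"
begin

sublocale prob_space \<mu> using haar by (simp add: haar_SU_def)

lemma space_haar: "space \<mu> = SU m" using haar by (simp add: haar_SU_def)

lemma measurable_haar: "f \<in> borel_measurable borel \<Longrightarrow> f \<in> borel_measurable \<mu>"
proof -
  assume "f \<in> borel_measurable borel"
  then have "f \<in> borel_measurable (restrict_space borel (SU m))" by (rule measurable_restrict_space1)
  moreover have "sets \<mu> = sets (restrict_space borel (SU m))" using haar by (simp add: haar_SU_def)
  ultimately show ?thesis using measurable_cong_sets[OF _ refl] by blast
qed

lemma continuous_entry: "continuous_on UNIV (\<lambda>g::cmat. g i j)"
  using continuous_on_product_then_coordinatewise[OF continuous_on_product_coordinates[of i], of j] .

text \<open>\<open>borel\<close> on matrices comes from the product topology of functions, so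
  coordinatewise continuity suffices; what remains is restriction to SU(m).\<close>

lemma measurable_translation:
  assumes h: "h \<in> SU m"
  shows "cmatmul m h \<in> measurable \<mu> \<mu>"
proof -
  have "continuous_on UNIV (cmatmul m h)"
    unfolding cmatmul_def by (intro continuous_on_coordinatewise_then_product continuous_intros continuous_entry)
  then have "cmatmul m h \<in> measurable borel borel" by (rule borel_measurable_continuous_onI)
  then have "cmatmul m h \<in> measurable (restrict_space borel (SU m)) (restrict_space borel (SU m))"
    using h by (intro measurable_restrict_space2 measurable_restrict_space1) (auto simp: space_restrict_space cmatmul_in_SU)
  moreover have "sets \<mu> = sets (restrict_space borel (SU m))" using haar by (simp add: haar_SU_def)
  ultimately show ?thesis using measurable_cong_sets by blast
qed

lemma integrable_entry [simp]:
  assumes "a \<in> B" "b \<in> B"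
  shows "integrable \<mu> (\<lambda>g. \<rho> g a b)"
proof (rule integrable_const_bound[where B = 1])
  show "AE g in \<mu>. norm (\<rho> g a b) \<le> 1" using norm_le_1[OF _ assms] by (intro AE_I2) (simp add: space_haar)
  show "(\<lambda>g. \<rho> g a b) \<in> borel_measurable \<mu>" by (rule measurable_haar[OF meas[OF assms]])
qed

definition avg :: "'a \<Rightarrow> 'a \<Rightarrow> complex" where
  "avg a b = (\<integral>g. \<rho> g a b \<partial>\<mu>)"

lemma rho_avg:
  assumes h: "h \<in> SU m" and a: "a \<in> B" and b: "b \<in> B"
  shows "(\<Sum>c\<in>B. \<rho> h a c * avg c b) = avg a b"
proof -
  have "(\<Sum>c\<in>B. \<rho> h a c * avg c b) = (\<integral>g. (\<Sum>c\<in>B. \<rho> h a c * \<rho> g c b) \<partial>\<mu>)"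
    unfolding avg_def using b by (subst Bochner_Integration.integral_sum) auto
  also have "\<dots> = (\<integral>g. \<rho> (cmatmul m h g) a b \<partial>\<mu>)"
    by (rule Bochner_Integration.integral_cong) (use mult[OF h _ a b] space_haar in auto)
  also have "\<dots> = (\<integral>g. \<rho> g a b \<partial>distr \<mu> \<mu> (cmatmul m h))"
    by (rule integral_distr[symmetric]) (use measurable_translation[OF h] measurable_haar meas a b in auto)
  also have "distr \<mu> \<mu> (cmatmul m h) = \<mu>" using haar h by (simp add: haar_SU_def)
  finally show ?thesis by (simp add: avg_def)
qed

text \<open>Left invariance alone makes the averaging operator P satisfy P = P* P, so it is selfadjoint.\<close>
lemma avg_hermitian:
  assumes a: "a \<in> B" and b: "b \<in> B"
  shows "avg a b = cnj (avg b a)"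
proof -
  have PP: "(\<Sum>c\<in>B. cnj (avg c a) * avg c b) = avg a b" if a: "a \<in> B" and b: "b \<in> B" for a b
  proof -
    have "(\<Sum>c\<in>B. cnj (avg c a) * avg c b) = (\<integral>g. (\<Sum>c\<in>B. cnj (\<rho> g c a) * avg c b) \<partial>\<mu>)"
      unfolding avg_def[of _ a] using a by (subst Bochner_Integration.integral_sum) (auto simp: integrable_cnj)
    also have "\<dots> = (\<integral>g. avg a b \<partial>\<mu>)"
    proof (rule Bochner_Integration.integral_cong[OF refl])
      fix g assume "g \<in> space \<mu>"
      then have g: "g \<in> SU m" by (simp add: space_haar)
      have "(\<Sum>c\<in>B. cnj (\<rho> g c a) * avg c b) = (\<Sum>c\<in>B. cnj (\<rho> g c a) * (\<Sum>d\<in>B. \<rho> g c d * avg d b))"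
        using rho_avg[OF g _ b] by (intro sum.cong refl) simp
      also have "\<dots> = (\<Sum>d\<in>B. (\<Sum>c\<in>B. cnj (\<rho> g c a) * \<rho> g c d) * avg d b)"
        unfolding sum_distrib_left sum_distrib_right by (subst sum.swap) (simp add: mult.assoc)
      also have "\<dots> = (\<Sum>d\<in>B. (if a = d then 1 else 0) * avg d b)"
        using unit[OF g a] by (intro sum.cong refl) simp
      also have "\<dots> = avg a b" using finite_B a by (simp add: sum_mult_delta)
      finally show "(\<Sum>c\<in>B. cnj (\<rho> g c a) * avg c b) = avg a b" .
    qed
    finally show ?thesis by simp (simp add: prob_space)
  qed
  have "cnj (avg b a) = cnj (\<Sum>c\<in>B. cnj (avg c b) * avg c a)" using PP[OF b a] by simp
  also have "\<dots> = (\<Sum>c\<in>B. cnj (avg c a) * avg c b)" by (simp add: mult.commute)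
  finally show ?thesis using PP[OF a b] by simp
qed

text \<open>Rotations fix an averaged vector, so the derivative at 0 vanishes for every axis. The
  axes (1, 0), (0, 1) and (0, \<i>) isolate H, U - D and U + D.\<close>

lemma avg_lie_invariant:
  assumes z: "z \<in> B"
  shows "lie_invariant (\<lambda>b. avg b z)"
  unfolding lie_invariant_def
proof (intro ballI)
  fix l a assume l: "l \<in> {1..<m}" and a: "a \<in> B"
  let ?h = "\<Sum>b\<in>B. H l a b * avg b z" and ?u = "\<Sum>b\<in>B. U l a b * avg b z" and ?d = "\<Sum>b\<in>B. D l a b * avg b z"
  have e: "\<i> * c * ?h + \<beta> * ?u - cnj \<beta> * ?d = 0" if cb: "c\<^sup>2 + (cmod \<beta>)\<^sup>2 = 1" for c :: real and \<beta>
  proof -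
    have "(\<lambda>\<theta>. \<Sum>b\<in>B. \<rho> (rot m l c \<beta> \<theta>) a b * avg b z) = (\<lambda>_. avg a z)"
      using rho_avg[OF rot_in_SU[OF l cb] a z] by auto
    then have "((\<lambda>_. avg a z) has_vector_derivative \<i> * c * ?h + \<beta> * ?u - cnj \<beta> * ?d) (at (0::real))"
      using deriv_apply[OF l cb a, of "\<lambda>b. avg b z"] by simp
    then show ?thesis using vector_derivative_unique_at has_vector_derivative_const by blast
  qed
  have h: "?h = 0" using e[of 1 0] by simp
  have 1: "?u - ?d = 0" using e[of 0 1] by simp
  have "\<i> * (?u + ?d) = 0" using e[of 0 \<i>] by (simp add: distrib_left)
  then have 2: "?u + ?d = 0" by simp
  have "2 * ?u = (?u - ?d) + (?u + ?d)" by simp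
  then have "?u = 0" using 1 2 by simp
  then show "?u = 0 \<and> ?d = 0 \<and> ?h = 0" using h 2 by simp
qed

lemma avg_fixes_lie_invariant:
  assumes m: "1 \<le> m" and x: "lie_invariant x" and a: "a \<in> B"
  shows "(\<Sum>b\<in>B. avg a b * x b) = x a"
proof -
  have "(\<Sum>b\<in>B. avg a b * x b) = (\<integral>g. (\<Sum>b\<in>B. \<rho> g a b * x b) \<partial>\<mu>)"
    unfolding avg_def using a by (subst Bochner_Integration.integral_sum) auto
  also have "\<dots> = (\<integral>g. x a \<partial>\<mu>)"
    by (rule Bochner_Integration.integral_cong) (use fixes_lie_invariant[OF m x _ a] space_haar in auto)
  finally show ?thesis by (simp add: prob_space)
qed

end

section \<open>The Fock representation\<close>

text \<open>Composing with one permutation that carries \<open>b\<close> to \<open>s\<close> maps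
  the stabilizer of \<open>b\<close> bijectively onto the fibre over \<open>s\<close>, so all fibres
  have equal size. Its value follows by comparing the count of all permutations, n!, with the
  multinomial formula.\<close>

lemma sum_permute_list:
  fixes \<Phi> :: "'a list \<Rightarrow> complex"
  assumes n: "length b = n"
  shows "(\<Sum>\<sigma> | \<sigma> permutes {..<n}. \<Phi> (permute_list \<sigma> b))
    = of_nat (\<Prod>x\<in>set b. fact (count (mset b) x)) * (\<Sum>s\<in>permutations_of_multiset (mset b). \<Phi> s)"
proof -
  let ?P = "{\<sigma>. \<sigma> permutes {..<n}}" and ?S = "permutations_of_multiset (mset b)"
  let ?f = "\<lambda>\<sigma>. permute_list \<sigma> b"
  let ?N = "card {\<sigma>\<in>?P. ?f \<sigma> = b}"
  have finP: "finite ?P" by (rule finite_permutations) simp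
  have img: "?f ` ?P = ?S"
  proof
    show "?f ` ?P \<subseteq> ?S" using n by (auto intro!: permutations_of_multisetI)
    show "?S \<subseteq> ?f ` ?P"
    proof
      fix s assume "s \<in> ?S"
      then have "mset s = mset b" by (rule permutations_of_multisetD)
      then obtain p where "p permutes {..<length b}" "permute_list p b = s" by (rule mset_eq_permutation)
      then show "s \<in> ?f ` ?P" using n by blast
    qed
  qed
  have fibre: "card {\<sigma>\<in>?P. ?f \<sigma> = s} = ?N" if s: "s \<in> ?S" for s
  proof -
    have "s \<in> ?f ` ?P" unfolding img by (rule s)
    then obtain q where "s = ?f q" "q \<in> ?P" by (rule imageE)
    then have q: "q permutes {..<n}" "?f q = s" by simp_all
    have q': "inv q permutes {..<n}" by (rule permutes_inv[OF q(1)])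
    have "bij_betw (\<lambda>\<tau>. \<tau> \<circ> q) {\<sigma>\<in>?P. ?f \<sigma> = b} {\<sigma>\<in>?P. ?f \<sigma> = s}"
    proof (rule bij_betwI[where g = "\<lambda>\<sigma>. \<sigma> \<circ> inv q"])
      show "(\<lambda>\<tau>. \<tau> \<circ> q) \<in> {\<sigma>\<in>?P. ?f \<sigma> = b} \<rightarrow> {\<sigma>\<in>?P. ?f \<sigma> = s}"
        using q n permutes_compose[OF q(1)] by (auto simp: permute_list_compose)
      have "permute_list (inv q) s = b"
        using permute_list_compose[of "inv q" b q] q q' n permutes_inv_o(1)[OF q(1)] by simp
      then show "(\<lambda>\<sigma>. \<sigma> \<circ> inv q) \<in> {\<sigma>\<in>?P. ?f \<sigma> = s} \<rightarrow> {\<sigma>\<in>?P. ?f \<sigma> = b}"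
        using q' n permutes_compose[OF q'] by (auto simp: permute_list_compose)
    qed (use permutes_inv_o[OF q(1)] in \<open>auto simp: comp_assoc\<close>)
    then show ?thesis by (simp add: bij_betw_same_card)
  qed
  have count: "(\<Sum>\<sigma>\<in>?P. \<Psi> (?f \<sigma>)) = of_nat ?N * (\<Sum>s\<in>?S. \<Psi> s)" for \<Psi> :: "'a list \<Rightarrow> complex"
  proof -
    have "(\<Sum>\<sigma>\<in>?P. \<Psi> (?f \<sigma>)) = (\<Sum>s\<in>?S. \<Sum>\<sigma>\<in>{\<sigma>\<in>?P. ?f \<sigma> = s}. \<Psi> (?f \<sigma>))"
      unfolding img[symmetric] by (rule sum.image_gen[OF finP])
    also have "\<dots> = (\<Sum>s\<in>?S. of_nat ?N * \<Psi> s)"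
      using fibre by (intro sum.cong refl) simp
    finally show ?thesis by (simp add: sum_distrib_left)
  qed
  have "(of_nat (fact n) :: complex) = of_nat ?N * of_nat (card ?S)"
    using count[of "\<lambda>_. 1"] by (simp add: card_permutations)
  then have N: "fact n = ?N * card ?S" by (simp only: of_nat_mult[symmetric] of_nat_eq_iff)
  have "card ?S * (\<Prod>x\<in>set b. fact (count (mset b) x)) = fact n"
    using card_permutations_of_multiset_aux[of "mset b"] n by simp
  then have "card ?S * (\<Prod>x\<in>set b. fact (count (mset b) x)) = card ?S * ?N" using N by simp
  moreover have "card ?S \<noteq> 0" using N by (metis fact_nonzero mult_0_right)
  ultimately have "?N = (\<Prod>x\<in>set b. fact (count (mset b) x))" by simp
  then show ?thesis using count[of \<Phi>] by simp
qed

lemma prod_sum_lists: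
  fixes F :: "nat \<Rightarrow> 'a \<Rightarrow> complex"
  assumes "finite A"
  shows "(\<Sum>s | set s \<subseteq> A \<and> length s = n. \<Prod>t<n. F t (s ! t)) = (\<Prod>t<n. \<Sum>i\<in>A. F t i)"
proof (induction n arbitrary: F)
  case 0
  have "{s. set s \<subseteq> A \<and> length s = 0} = {[]}" by auto
  then show ?case by simp
next
  case (Suc n)
  let ?L = "\<lambda>n. {s. set s \<subseteq> A \<and> length s = n}"
  have inj: "inj_on (\<lambda>(s, i). i # s) (?L n \<times> A)" by (auto simp: inj_on_def)
  have "(\<Sum>s\<in>?L (Suc n). \<Prod>t<Suc n. F t (s ! t)) = (\<Sum>(s, i)\<in>?L n \<times> A. \<Prod>t<Suc n. F t ((i # s) ! t))"
    unfolding lists_length_Suc_eq sum.reindex[OF inj] by (simp add: case_prod_beta comp_def)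
  also have "\<dots> = (\<Sum>s\<in>?L n. \<Sum>i\<in>A. F 0 i * (\<Prod>t<n. F (Suc t) (s ! t)))"
    unfolding sum.cartesian_product by (simp add: prod.lessThan_Suc_shift case_prod_beta del: prod.lessThan_Suc)
  also have "\<dots> = (\<Sum>i\<in>A. F 0 i) * (\<Sum>s\<in>?L n. \<Prod>t<n. F (Suc t) (s ! t))"
    by (subst sum.swap) (simp add: sum_product)
  also have "\<dots> = (\<Prod>t<Suc n. \<Sum>i\<in>A. F t i)"
    using Suc.IH[of "\<lambda>t. F (Suc t)"] by (simp add: prod.lessThan_Suc_shift del: prod.lessThan_Suc)
  finally show ?case .
qed

lemma prod_list_modeseq:
  fixes f :: "nat \<Rightarrow> complex"
  shows "prod_list (map f (modeseq m v)) = (\<Prod>i\<in>{1..m}. f i ^ v i)"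
proof -
  have "prod_list (map f (concat (map (\<lambda>i. replicate (v i) i) xs))) = prod_list (map (\<lambda>i. f i ^ v i) xs)" for xs
    by (induction xs) (simp_all add: prod_list_replicate)
  then have "prod_list (map f (modeseq m v)) = prod_list (map (\<lambda>i. f i ^ v i) [1..<m+1])"
    by (simp only: modeseq_def)
  also have "\<dots> = (\<Prod>i\<in>set [1..<m+1]. f i ^ v i)"
    by (rule prod.distinct_set_conv_list[symmetric]) simp
  also have "set [1..<m+1] = {1..m}" by auto
  finally show ?thesis .
qed

lemma count_modeseq:
  assumes "v \<in> fock m n"
  shows "count (mset (modeseq m v)) = v"
proof
  fix i
  have "count (mset (concat (map (\<lambda>i. replicate (v i) i) xs))) i = (if i \<in> set xs then v i else 0)"
    if "distinct xs" for xs
    using that by (induction xs) auto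
  from this[of "[1..<m+1]"] show "count (mset (modeseq m v)) i = v i"
    using fock_support[OF assms, of i] by (auto simp: modeseq_def)
qed

lemma length_modeseq:
  assumes "v \<in> fock m n"
  shows "length (modeseq m v) = n"
proof -
  have "length (concat (map (\<lambda>i. replicate (v i) i) xs)) = sum_list (map v xs)" for xs
    by (induction xs) simp_all
  then have "length (modeseq m v) = sum_list (map v [1..<m+1])" by (simp only: modeseq_def)
  also have "\<dots> = (\<Sum>i\<in>set [1..<m+1]. v i)" by (rule sum.distinct_set_conv_list[symmetric]) simp
  also have "set [1..<m+1] = {1..m}" by auto
  finally show ?thesis using fock_sum[OF assms] by simp
qed

lemma set_modeseq: "set (modeseq m v) \<subseteq> {1..m}"
  by (auto simp: modeseq_def)

section \<open>Coherent vectors as generating functions of the permanents\<close>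

definition fprod :: "nat \<Rightarrow> (nat \<Rightarrow> nat) \<Rightarrow> nat" where
  "fprod m v = (\<Prod>i\<in>{1..m}. fact (v i))"

lemma fprod_pos: "fprod m v > 0" by (simp add: fprod_def prod_pos)

lemma prod_fact_modeseq:
  assumes "v \<in> fock m n"
  shows "(\<Prod>x\<in>set (modeseq m v). fact (count (mset (modeseq m v)) x)) = fprod m v"
  unfolding fprod_def
proof (rule prod.mono_neutral_cong_left)
  show "\<forall>i\<in>{1..m} - set (modeseq m v). fact (v i) = (1::nat)"
  proof
    fix i assume "i \<in> {1..m} - set (modeseq m v)"
    then have "count (mset (modeseq m v)) i = 0" by simp
    then show "fact (v i) = (1::nat)" by (simp add: count_modeseq[OF assms])
  qed
qed (use set_modeseq count_modeseq[OF assms] in auto)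

text \<open>Fock amplitude of the unnormalized coherent state exp(sum_i x_i a_i^dagger)|0>. On these
  vectors \<open>tau\<close> acts by multiplying x with the matrix, which reduces identities between
  permanents to matrix identities.\<close>

definition coh :: "nat \<Rightarrow> (nat \<Rightarrow> complex) \<Rightarrow> (nat \<Rightarrow> nat) \<Rightarrow> complex" where
  "coh m x u = (\<Prod>i\<in>{1..m}. x i ^ u i) / complex_of_real (sqrt (real (fprod m u)))"

lemma prod_nth_modeseq:
  fixes f :: "nat \<Rightarrow> complex"
  assumes s: "mset s = mset (modeseq m v)" and v: "v \<in> fock m n"
  shows "(\<Prod>t<n. f (s ! t)) = (\<Prod>i\<in>{1..m}. f i ^ v i)"
proof -
  have "length s = n" using length_modeseq[OF v] mset_eq_length[OF s] by simp
  then have "(\<Prod>t<n. f (s ! t)) = prod_list (map f s)"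
    by (simp add: prod.list_conv_set_nth atLeast0LessThan)
  also have "\<dots> = prod_mset (image_mset f (mset s))" by (metis mset_map prod_mset_prod_list)
  also have "\<dots> = prod_list (map f (modeseq m v))" unfolding s by (metis mset_map prod_mset_prod_list)
  finally show ?thesis by (simp add: prod_list_modeseq)
qed

text \<open>Words over the modes are grouped by their letter counts. This turns a sum over
  occupation numbers into one over all words, and the latter factorizes.\<close>

lemma modeseq_partition:
  fixes \<Psi> :: "nat list \<Rightarrow> complex"
  shows "(\<Sum>v\<in>fock m n. \<Sum>s\<in>permutations_of_multiset (mset (modeseq m v)). \<Psi> s)
    = (\<Sum>s | set s \<subseteq> {1..m} \<and> length s = n. \<Psi> s)"
proof -
  let ?L = "{s. set s \<subseteq> {1..m} \<and> length s = n}"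
  have cnt: "count (mset s) \<in> fock m n" if "s \<in> ?L" for s
  proof -
    have "(\<Sum>i\<in>{1..m}. count (mset s) i) = (\<Sum>i\<in>set s. count (mset s) i)"
      by (rule sum.mono_neutral_right) (use that in auto)
    also have "\<dots> = n" using that size_multiset_overloaded_eq[of "mset s"] by simp
    moreover have "\<forall>i. count (mset s) i \<noteq> 0 \<longrightarrow> i \<in> {1..m}" using that by (auto simp: count_eq_zero_iff)
    ultimately show ?thesis by (simp add: fock_def)
  qed
  have "(\<Sum>v\<in>fock m n. \<Sum>s\<in>permutations_of_multiset (mset (modeseq m v)). \<Psi> s)
     = (\<Sum>v\<in>fock m n. \<Sum>s\<in>{s\<in>?L. count (mset s) = v}. \<Psi> s)"
  proof (rule sum.cong[OF refl], rule sum.cong)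
    fix v assume v: "v \<in> fock m n"
    show "permutations_of_multiset (mset (modeseq m v)) = {s\<in>?L. count (mset s) = v}"
    proof (intro set_eqI iffI)
      fix s assume "s \<in> permutations_of_multiset (mset (modeseq m v))"
      then have e: "mset s = mset (modeseq m v)" by (rule permutations_of_multisetD)
      then have "length s = n" "set s = set (modeseq m v)"
        using length_modeseq[OF v] mset_eq_length[OF e] mset_eq_setD[OF e] by simp_all
      then show "s \<in> {s\<in>?L. count (mset s) = v}" using e set_modeseq count_modeseq[OF v] by simp
    next
      fix s assume "s \<in> {s\<in>?L. count (mset s) = v}"
      then have "count (mset s) = count (mset (modeseq m v))" using count_modeseq[OF v] by simp
      then show "s \<in> permutations_of_multiset (mset (modeseq m v))"
        by (intro permutations_of_multisetI) (simp add: count_inject)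
    qed
  qed simp
  also have "\<dots> = (\<Sum>s\<in>?L. \<Psi> s)"
    by (rule sum.group) (use cnt finite_lists_length_eq[of "{1..m}" n] in auto)
  finally show ?thesis .
qed

text \<open>Repeated columns make the permanent a factor prod_i v_i! times a sum over distinct
  words. That factor cancels against the two square roots for v, in \<open>tau\<close> and in
  \<open>coh\<close>; all words then occur once, and their sum is a product of linear forms.\<close>

lemma tau_coh:
  assumes u: "u \<in> fock m n"
  shows "(\<Sum>v\<in>fock m n. tau m n g u v * coh m x v) = coh m (\<lambda>i. \<Sum>j\<in>{1..m}. g i j * x j) u"
proof -
  let ?a = "modeseq m u"
  let ?\<Psi> = "\<lambda>s. \<Prod>t<n. g (?a ! t) (s ! t) * x (s ! t)"
  let ?su = "complex_of_real (sqrt (real (fprod m u)))"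
  have summand: "tau m n g u v * coh m x v = (\<Sum>s\<in>permutations_of_multiset (mset (modeseq m v)). ?\<Psi> s) / ?su"
    if v: "v \<in> fock m n" for v
  proof -
    let ?b = "modeseq m v" and ?sv = "complex_of_real (sqrt (real (fprod m v)))"
    let ?S = "permutations_of_multiset (mset ?b)"
    have "(\<Sum>\<sigma> | \<sigma> permutes {..<n}. \<Prod>t<n. g (?a ! t) (?b ! \<sigma> t))
       = (\<Sum>\<sigma> | \<sigma> permutes {..<n}. (\<lambda>s. \<Prod>t<n. g (?a ! t) (s ! t)) (permute_list \<sigma> ?b))"
      using length_modeseq[OF v] by (intro sum.cong refl prod.cong) (auto simp: permute_list_nth)
    also have "\<dots> = of_nat (fprod m v) * (\<Sum>s\<in>?S. \<Prod>t<n. g (?a ! t) (s ! t))"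
      by (subst sum_permute_list[OF length_modeseq[OF v]]) (simp only: prod_fact_modeseq[OF v])
    finally have 1: "tau m n g u v = of_nat (fprod m v) * (\<Sum>s\<in>?S. \<Prod>t<n. g (?a ! t) (s ! t)) / (?su * ?sv)"
      unfolding tau_def fprod_def by (simp add: real_sqrt_mult)
    have 2: "(\<Sum>s\<in>?S. ?\<Psi> s) = (\<Sum>s\<in>?S. \<Prod>t<n. g (?a ! t) (s ! t)) * (\<Prod>i\<in>{1..m}. x i ^ v i)"
      unfolding sum_distrib_right
      by (intro sum.cong refl) (simp add: prod.distrib prod_nth_modeseq[OF permutations_of_multisetD v])
    have 3: "of_nat (fprod m v) = ?sv * ?sv"
      by (simp flip: of_real_mult)
    have "?sv \<noteq> 0" using fprod_pos[of m v] by simp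
    then show ?thesis unfolding 1 2 coh_def 3 by (simp add: field_simps)
  qed
  have "(\<Sum>v\<in>fock m n. tau m n g u v * coh m x v)
     = (\<Sum>v\<in>fock m n. \<Sum>s\<in>permutations_of_multiset (mset (modeseq m v)). ?\<Psi> s) / ?su"
    using summand by (simp add: sum_divide_distrib)
  also have "\<dots> = (\<Sum>s | set s \<subseteq> {1..m} \<and> length s = n. ?\<Psi> s) / ?su"
    by (simp only: modeseq_partition)
  also have "\<dots> = (\<Prod>t<n. \<Sum>j\<in>{1..m}. g (?a ! t) j * x j) / ?su"
    by (subst prod_sum_lists[of "{1..m}" "\<lambda>t j. g (?a ! t) j * x j"]) auto
  also have "\<dots> = coh m (\<lambda>i. \<Sum>j\<in>{1..m}. g i j * x j) u"
    using prod_nth_modeseq[OF refl u, of "\<lambda>i. \<Sum>j\<in>{1..m}. g i j * x j"] by (simp add: coh_def)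
  finally show ?thesis .
qed

lemma digits_unique:
  fixes v w :: "nat \<Rightarrow> nat"
  assumes "\<And>i. i \<in> {1..m} \<Longrightarrow> v i < q" "\<And>i. i \<in> {1..m} \<Longrightarrow> w i < q"
    and "(\<Sum>i\<in>{1..m}. v i * q ^ i) = (\<Sum>i\<in>{1..m}. w i * q ^ i)"
  shows "\<forall>i\<in>{1..m}. v i = w i"
  using assms
proof (induction m)
  case (Suc m)
  have bound: "(\<Sum>i\<in>{1..m}. v i * q ^ i) < q ^ Suc m" if "\<And>i. i \<in> {1..m} \<Longrightarrow> v i < q" "q > 0" for v :: "nat \<Rightarrow> nat" and m
    using that(1)
  proof (induction m)
    case (Suc m)
    have "v (Suc m) + 1 \<le> q" using Suc.prems[of "Suc m"] by simp
    then have "(v (Suc m) + 1) * q ^ Suc m \<le> q * q ^ Suc m" by (rule mult_right_mono) simp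
    then show ?case using Suc by simp
  qed (use \<open>q > 0\<close> in simp)
  have q: "q > 0" using Suc.prems(1)[of "Suc m"] by simp
  \<comment> \<open>Positions start at 1, so the lower digits stay below \<open>q ^ Suc m\<close>,
    and \<open>div\<close> and \<open>mod\<close> by this power split off the leading digit.\<close>
  have s: "(\<Sum>i\<in>{1..Suc m}. f i * q ^ i) div q ^ Suc m = f (Suc m)"
      "(\<Sum>i\<in>{1..Suc m}. f i * q ^ i) mod q ^ Suc m = (\<Sum>i\<in>{1..m}. f i * q ^ i)"
    if "\<And>i. i \<in> {1..Suc m} \<Longrightarrow> f i < q" for f :: "nat \<Rightarrow> nat"
  proof -
    have "(\<Sum>i\<in>{1..m}. f i * q ^ i) < q ^ Suc m" using that q by (intro bound) auto
    then show "(\<Sum>i\<in>{1..Suc m}. f i * q ^ i) div q ^ Suc m = f (Suc m)"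
        "(\<Sum>i\<in>{1..Suc m}. f i * q ^ i) mod q ^ Suc m = (\<Sum>i\<in>{1..m}. f i * q ^ i)"
      using q by (simp_all del: power_Suc)
  qed
  have "v (Suc m) = w (Suc m)" using s(1)[of v] s(1)[of w] Suc.prems by simp
  moreover have "\<forall>i\<in>{1..m}. v i = w i"
  proof (rule Suc.IH)
    show "(\<Sum>i\<in>{1..m}. v i * q ^ i) = (\<Sum>i\<in>{1..m}. w i * q ^ i)"
      using s(2)[of v] s(2)[of w] Suc.prems by metis
  qed (use Suc.prems in auto)
  ultimately show ?case by (auto simp: le_Suc_eq)
qed simp

text \<open>Substituting powers of one variable with exponents in base n+1 separates the monomials.\<close>
lemma coh_independent:
  assumes zero: "\<And>x. (\<Sum>v\<in>fock m n. c v * coh m x v) = 0" and v: "v \<in> fock m n"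
  shows "c v = 0"
proof -
  define e where "e v = (\<Sum>i\<in>{1..m}. v i * Suc n ^ i)" for v :: "nat \<Rightarrow> nat"
  define d where "d v = c v / complex_of_real (sqrt (real (fprod m v)))" for v
  have inj: "e w = e v \<longleftrightarrow> w = v" if w: "w \<in> fock m n" for w
  proof
    have le: "u i < Suc n" if "u \<in> fock m n" "i \<in> {1..m}" for u i
    proof -
      have "u i \<le> (\<Sum>i\<in>{1..m}. u i)" by (rule member_le_sum) (use that in auto)
      then show ?thesis using fock_sum[OF that(1)] by simp
    qed
    assume "e w = e v"
    then have eq: "\<forall>i\<in>{1..m}. w i = v i" unfolding e_def by (intro digits_unique[of m w "Suc n" v] le w v)
    show "w = v"
    proof
      fix i show "w i = v i" using eq fock_support[OF w, of i] fock_support[OF v, of i] by (cases "i \<in> {1..m}") auto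
    qed
  qed simp
  define p where "p = (\<Sum>w\<in>fock m n. monom (d w) (e w))"
  have "poly p T = 0" for T
  proof -
    have "poly p T = (\<Sum>w\<in>fock m n. c w * coh m (\<lambda>i. T ^ (Suc n ^ i)) w)"
      unfolding p_def poly_sum
      by (intro sum.cong refl)
        (simp add: poly_monom d_def e_def coh_def power_sum power_mult mult.commute flip: power_mult)
    then show ?thesis using zero by simp
  qed
  then have "p = 0" using poly_all_0_iff_0 by blast
  then have "0 = coeff p (e v)" by simp
  also have "\<dots> = (\<Sum>w\<in>fock m n. if w = v then d w else 0)"
    unfolding p_def coeff_sum using inj by (intro sum.cong refl) simp
  also have "\<dots> = d v" using v by simp
  finally show ?thesis using fprod_pos[of m v] by (simp add: d_def)
qed

lemma coh_matrix_eqI: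
  assumes "\<And>x. (\<Sum>v\<in>fock m n. A v * coh m x v) = (\<Sum>v\<in>fock m n. A' v * coh m x v)" "v \<in> fock m n"
  shows "A v = A' v"
proof -
  have "(\<Sum>v\<in>fock m n. (A v - A' v) * coh m x v) = 0" for x
    using assms(1)[of x] by (simp add: left_diff_distrib sum_subtractf)
  from coh_independent[OF this assms(2)] show ?thesis by simp
qed

text \<open>Both sides send the coherent vector of x to that of g(hx), and coherent vectors separate
  matrices.\<close>

lemma tau_mult:
  assumes u: "u \<in> fock m n" and v: "v \<in> fock m n"
  shows "tau m n (cmatmul m g h) u v = (\<Sum>w\<in>fock m n. tau m n g u w * tau m n h w v)"
proof (rule coh_matrix_eqI[OF _ v])
  fix x
  have "(\<Sum>v\<in>fock m n. tau m n (cmatmul m g h) u v * coh m x v)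
     = coh m (\<lambda>i. \<Sum>j\<in>{1..m}. \<Sum>t\<in>{1..m}. g i t * h t j * x j) u"
    unfolding tau_coh[OF u] cmatmul_def sum_distrib_right ..
  also have "(\<lambda>i. \<Sum>j\<in>{1..m}. \<Sum>t\<in>{1..m}. g i t * h t j * x j) = (\<lambda>i. \<Sum>t\<in>{1..m}. g i t * (\<Sum>j\<in>{1..m}. h t j * x j))"
    by (rule ext, subst sum.swap) (simp add: sum_distrib_left mult.assoc)
  also have "coh m \<dots> u = (\<Sum>w\<in>fock m n. tau m n g u w * coh m (\<lambda>t. \<Sum>j\<in>{1..m}. h t j * x j) w)"
    by (simp only: tau_coh[OF u])
  also have "\<dots> = (\<Sum>w\<in>fock m n. tau m n g u w * (\<Sum>v\<in>fock m n. tau m n h w v * coh m x v))"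
    by (intro sum.cong refl) (simp only: tau_coh)
  also have "\<dots> = (\<Sum>v\<in>fock m n. (\<Sum>w\<in>fock m n. tau m n g u w * tau m n h w v) * coh m x v)"
    unfolding sum_distrib_left sum_distrib_right by (subst sum.swap) (simp add: mult.assoc)
  finally show "(\<Sum>v\<in>fock m n. tau m n (cmatmul m g h) u v * coh m x v)
     = (\<Sum>v\<in>fock m n. (\<Sum>w\<in>fock m n. tau m n g u w * tau m n h w v) * coh m x v)" .
qed

lemma tau_id:
  assumes g: "\<And>i j. i \<in> {1..m} \<Longrightarrow> j \<in> {1..m} \<Longrightarrow> g i j = (if i = j then 1 else 0)"
    and u: "u \<in> fock m n" and v: "v \<in> fock m n"
  shows "tau m n g u v = (if u = v then 1 else 0)"
proof (rule coh_matrix_eqI[OF _ v])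
  fix x
  have "(\<Sum>j\<in>{1..m}. g i j * x j) = x i" if i: "i \<in> {1..m}" for i
  proof -
    have "(\<Sum>j\<in>{1..m}. g i j * x j) = (\<Sum>j\<in>{1..m}. (if i = j then 1 else 0) * x j)"
      using g i by (intro sum.cong refl) auto
    then show ?thesis using i by (simp add: sum_mult_delta)
  qed
  then have "coh m (\<lambda>i. \<Sum>j\<in>{1..m}. g i j * x j) u = coh m x u" by (simp add: coh_def)
  also have "\<dots> = (\<Sum>v\<in>fock m n. (if u = v then 1 else 0) * coh m x v)"
    using u by (simp add: sum_mult_delta)
  finally show "(\<Sum>v\<in>fock m n. tau m n g u v * coh m x v) = (\<Sum>v\<in>fock m n. (if u = v then 1 else 0) * coh m x v)"
    unfolding tau_coh[OF u] .
qed

text \<open>Summing over inverse permutations transposes a permanent; thus unitarity of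
  \<open>tau\<close> follows from multiplicativity.\<close>

lemma tau_adjoint: "cnj (tau m n g v u) = tau m n (\<lambda>i j. cnj (g j i)) u v"
proof -
  let ?a = "modeseq m u" and ?b = "modeseq m v"
  have "(\<Sum>\<sigma> | \<sigma> permutes {..<n}. \<Prod>t<n. cnj (g (?b ! t) (?a ! \<sigma> t)))
      = (\<Sum>\<sigma> | \<sigma> permutes {..<n}. \<Prod>t<n. cnj (g (?b ! t) (?a ! inv \<sigma> t)))"
    by (rule sum_permutations_inverse)
  also have "\<dots> = (\<Sum>\<sigma> | \<sigma> permutes {..<n}. \<Prod>t<n. cnj (g (?b ! \<sigma> t) (?a ! t)))"
  proof (intro sum.cong refl)
    fix \<sigma> assume "\<sigma> \<in> {\<sigma>. \<sigma> permutes {..<n}}"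
    then have \<sigma>: "\<sigma> permutes {..<n}" by simp
    show "(\<Prod>t<n. cnj (g (?b ! t) (?a ! inv \<sigma> t))) = (\<Prod>t<n. cnj (g (?b ! \<sigma> t) (?a ! t)))"
      using prod.permute[OF \<sigma>, of "\<lambda>t. cnj (g (?b ! t) (?a ! inv \<sigma> t))"]
      by (simp add: comp_def permutes_inverses(2)[OF \<sigma>])
  qed
  finally show ?thesis unfolding tau_def by (simp add: mult.commute)
qed

lemma tau_unitary:
  assumes g: "g \<in> SU m" and u: "u \<in> fock m n" and v: "v \<in> fock m n"
  shows "(\<Sum>w\<in>fock m n. cnj (tau m n g w u) * tau m n g w v) = (if u = v then 1 else 0)"
proof -
  have "(\<Sum>w\<in>fock m n. cnj (tau m n g w u) * tau m n g w v) = tau m n (cmatmul m (\<lambda>i j. cnj (g j i)) g) u v"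
    unfolding tau_adjoint by (rule tau_mult[OF u v, symmetric])
  also have "\<dots> = (if u = v then 1 else 0)"
    by (rule tau_id[OF _ u v]) (simp only: cmatmul_def SU_unitary[OF g])
  finally show ?thesis .
qed

lemma tau_measurable: "(\<lambda>g. tau m n g u v) \<in> borel_measurable borel"
proof -
  have "continuous_on UNIV (\<lambda>g::cmat. g i j)" for i j
    using continuous_on_product_then_coordinatewise[OF continuous_on_product_coordinates[of i], of j] .
  then have "continuous_on UNIV (\<lambda>g. tau m n g u v)"
    unfolding tau_def divide_inverse by (intro continuous_intros)
  then show ?thesis by (rule borel_measurable_continuous_onI)
qed

text \<open>On coherent vectors a_i^dagger a_j acts as the differential operator x_j d/dx_i. The
  derivative is written out as \<open>u i * x i ^ (u i - 1)\<close>, whose leading factor takes care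
  of \<open>u i = 0\<close>.\<close>

lemma sum_adag_a_coh:
  assumes u: "u \<in> fock m n" and i: "i \<in> {1..m}" and j: "j \<in> {1..m}"
  shows "(\<Sum>v\<in>fock m n. adag_a i j u v * coh m x v)
    = of_nat (u i) * x j * x i ^ (u i - 1) * (\<Prod>k\<in>{1..m} - {i}. x k ^ u k) / complex_of_real (sqrt (real (fprod m u)))"
proof (cases "i = j")
  case True
  have "(\<Sum>v\<in>fock m n. adag_a i j u v * coh m x v) = (\<Sum>v\<in>fock m n. (if u = v then of_nat (u i) else 0) * coh m x v)"
    unfolding True by (intro sum.cong refl) (simp add: adag_a_def)
  also have "\<dots> = of_nat (u i) * coh m x u" using u by (simp add: sum_mult_delta)
  also have "(\<Prod>k\<in>{1..m}. x k ^ u k) = x i ^ u i * (\<Prod>k\<in>{1..m} - {i}. x k ^ u k)"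
    using i by (rule prod.remove[OF finite_atLeastAtMost])
  then have "of_nat (u i) * coh m x u = of_nat (u i) * x i ^ u i * (\<Prod>k\<in>{1..m} - {i}. x k ^ u k) / complex_of_real (sqrt (real (fprod m u)))"
    by (simp add: coh_def)
  also have "of_nat (u i) * x i ^ u i = of_nat (u i) * x j * x i ^ (u i - 1)"
    using True by (cases "u i") auto
  finally show ?thesis .
next
  case False
  show ?thesis
  proof (cases "u i = 0")
    case True
    then have "adag_a i j u v = 0" for v using False by (auto simp: adag_a_hop hop_apply)
    then show ?thesis using True by simp
  next
    case ui: False
    let ?w = "hop j i u"
    have "(\<Sum>v\<in>fock m n. adag_a i j u v * coh m x v) = (\<Sum>v\<in>fock m n. adag_a j i v u * coh m x v)"
      by (subst adag_a_flip) simp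
    also have "\<dots> = complex_of_real (sqrt (real (u i * (u j + 1)))) * coh m x ?w"
      using sum_adag_a_hop[OF u, of j i "coh m x"] False ui i j by simp
    also have "coh m x ?w = x j * x i ^ (u i - 1) * (\<Prod>k\<in>{1..m} - {i}. x k ^ u k) / complex_of_real (sqrt (real (fprod m ?w)))"
    proof -
      have split: "(\<Prod>k\<in>{1..m}. f k) = f i * (f j * (\<Prod>k\<in>{1..m} - {i} - {j}. f k))" for f :: "nat \<Rightarrow> 'b :: comm_monoid_mult"
      proof -
        have "(\<Prod>k\<in>{1..m}. f k) = f i * (\<Prod>k\<in>{1..m} - {i}. f k)"
          using i by (intro prod.remove) auto
        also have "(\<Prod>k\<in>{1..m} - {i}. f k) = f j * (\<Prod>k\<in>{1..m} - {i} - {j}. f k)"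
          using j False by (intro prod.remove) auto
        finally show ?thesis .
      qed
      have "(\<Prod>k\<in>{1..m}. x k ^ ?w k) = x i ^ (u i - 1) * (x j ^ (u j + 1) * (\<Prod>k\<in>{1..m} - {i} - {j}. x k ^ ?w k))"
        using False by (subst split) (simp add: hop_apply)
      also have "(\<Prod>k\<in>{1..m} - {i} - {j}. x k ^ ?w k) = (\<Prod>k\<in>{1..m} - {i} - {j}. x k ^ u k)"
        using False by (intro prod.cong refl) (simp add: hop_apply)
      also have "x i ^ (u i - 1) * (x j ^ (u j + 1) * (\<Prod>k\<in>{1..m} - {i} - {j}. x k ^ u k))
          = x j * x i ^ (u i - 1) * (x j ^ u j * (\<Prod>k\<in>{1..m} - {i} - {j}. x k ^ u k))" by simp
      also have "x j ^ u j * (\<Prod>k\<in>{1..m} - {i} - {j}. x k ^ u k) = (\<Prod>k\<in>{1..m} - {i}. x k ^ u k)"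
        using j False by (intro prod.remove[symmetric]) auto
      finally show ?thesis by (simp add: coh_def)
    qed
    \<comment> \<open>The hop changes u_i! u_j! into (u_i - 1)! (u_j + 1)!, which turns the square
      root of the hopping amplitude into the plain factor \<open>u i\<close>.\<close>
    also have "fprod m ?w * u i = fprod m u * (u j + 1)"
    proof -
      have split: "fprod m v = fact (v i) * (fact (v j) * (\<Prod>k\<in>{1..m} - {i} - {j}. fact (v k)))" for v
      proof -
        have "fprod m v = fact (v i) * (\<Prod>k\<in>{1..m} - {i}. fact (v k))"
          unfolding fprod_def using i by (intro prod.remove) auto
        also have "(\<Prod>k\<in>{1..m} - {i}. fact (v k)) = fact (v j) * (\<Prod>k\<in>{1..m} - {i} - {j}. fact (v k))"
          using j False by (intro prod.remove) auto
        finally show ?thesis .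
      qed
      have "(\<Prod>k\<in>{1..m} - {i} - {j}. fact (?w k)) = (\<Prod>k\<in>{1..m} - {i} - {j}. fact (u k) :: nat)"
        using False by (intro prod.cong refl) (simp add: hop_apply)
      moreover have "fact (u i) = u i * (fact (u i - 1) :: nat)" using ui by (simp add: fact_reduce)
      ultimately show ?thesis unfolding split[of ?w] split[of u] using False by (simp add: hop_apply algebra_simps)
    qed
    then have e: "real (fprod m ?w) * real (u i) = real (fprod m u) * real (u j + 1)"
      by (metis of_nat_mult)
    have "sqrt (real (u i * (u j + 1))) / sqrt (real (fprod m ?w)) = real (u i) / sqrt (real (fprod m u))"
    proof -
      have "real (u j + 1) = real (fprod m ?w) * real (u i) / real (fprod m u)"
        using e fprod_pos[of m u] by (simp add: field_simps)
      then have "real (u i * (u j + 1)) / real (fprod m ?w) = (real (u i))\<^sup>2 / real (fprod m u)"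
        unfolding of_nat_mult[of "u i"] using fprod_pos[of m ?w] by (simp only:) (simp add: power2_eq_square)
      then have "sqrt (real (u i * (u j + 1)) / real (fprod m ?w)) = sqrt ((real (u i))\<^sup>2 / real (fprod m u))" by simp
      then show ?thesis by (simp only: real_sqrt_divide real_sqrt_abs abs_of_nat)
    qed
    then have "complex_of_real (sqrt (real (u i * (u j + 1)))) / complex_of_real (sqrt (real (fprod m ?w)))
        = of_nat (u i) / complex_of_real (sqrt (real (fprod m u)))"
      by (metis of_real_divide of_real_of_nat_eq)
    then have "complex_of_real (sqrt (real (u i * (u j + 1)))) * (y / complex_of_real (sqrt (real (fprod m ?w))))
        = of_nat (u i) * y / complex_of_real (sqrt (real (fprod m u)))" for y
      by (metis (no_types, lifting) times_divide_eq_right mult.commute times_divide_eq_left)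
    finally show ?thesis by (simp add: mult.assoc)
  qed
qed

definition rot_gen :: "nat \<Rightarrow> real \<Rightarrow> complex \<Rightarrow> cmat" where
  "rot_gen l c \<beta> = (\<lambda>i j. if i = l \<and> j = l then \<i> * of_real c else if i = l \<and> j = l+1 then \<beta>
     else if i = l+1 \<and> j = l then - cnj \<beta> else if i = l+1 \<and> j = l+1 then - (\<i> * of_real c) else 0)"

lemma rot_has_derivative:
  assumes ij: "i \<in> {1..m}" "j \<in> {1..m}"
  shows "((\<lambda>\<theta>. rot m l c \<beta> \<theta> i j) has_vector_derivative rot_gen l c \<beta> i j) (at 0)"
proof -
  have s: "((\<lambda>\<theta>. complex_of_real (sin \<theta>)) has_vector_derivative 1) (at 0)"
    using has_vector_derivative_of_real[of sin "1" "at 0"] DERIV_sin[of "0::real"]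
    by (simp add: has_real_derivative_iff_has_vector_derivative)
  have k: "((\<lambda>\<theta>. complex_of_real (cos \<theta>)) has_vector_derivative 0) (at 0)"
    using has_vector_derivative_of_real[of cos "0" "at 0"] DERIV_cos[of "0::real"]
    by (simp add: has_real_derivative_iff_has_vector_derivative)
  have a: "((\<lambda>\<theta>. of_real (cos \<theta>) + \<i> * of_real c * of_real (sin \<theta>)) has_vector_derivative \<i> * of_real c) (at 0)"
    using has_vector_derivative_add[OF k has_vector_derivative_mult_right[OF s, of "\<i> * of_real c"]] by simp
  have b: "((\<lambda>\<theta>. \<beta> * of_real (sin \<theta>)) has_vector_derivative \<beta>) (at 0)"
    using has_vector_derivative_mult_right[OF s, of \<beta>] by simp
  have b': "((\<lambda>\<theta>. - (cnj \<beta> * of_real (sin \<theta>))) has_vector_derivative - cnj \<beta>) (at 0)"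
    using has_vector_derivative_mult_right[OF s, of "- cnj \<beta>"] by simp
  have a': "((\<lambda>\<theta>. of_real (cos \<theta>) - \<i> * of_real c * of_real (sin \<theta>)) has_vector_derivative - (\<i> * of_real c)) (at 0)"
    using has_vector_derivative_diff[OF k has_vector_derivative_mult_right[OF s, of "\<i> * of_real c"]] by simp
  show ?thesis
    using a b a' b' ij unfolding rot_def plane_def blk_def rot_gen_def
    by (cases "i = l"; cases "i = l+1"; cases "j = l"; cases "j = l+1") (simp_all add: has_vector_derivative_const)
qed

text \<open>Existence is enough: the value for permanents is identified afterwards on coherent
  vectors.\<close>

lemma has_vector_derivative_prod_exists:
  fixes f :: "'i \<Rightarrow> real \<Rightarrow> complex"
  assumes "finite T" "\<And>t. t \<in> T \<Longrightarrow> \<exists>d. (f t has_vector_derivative d) (at x)"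
  shows "\<exists>d. ((\<lambda>\<theta>. \<Prod>t\<in>T. f t \<theta>) has_vector_derivative d) (at x)"
  using assms
proof (induction T rule: finite_induct)
  case empty
  show ?case by (auto intro: has_vector_derivative_const)
next
  case (insert t T)
  obtain d where "(f t has_vector_derivative d) (at x)" using insert.prems by blast
  moreover obtain d' where "((\<lambda>\<theta>. \<Prod>t\<in>T. f t \<theta>) has_vector_derivative d') (at x)"
    using insert.IH insert.prems by blast
  ultimately show ?case using insert.hyps has_vector_derivative_mult by fastforce
qed

text \<open>Product and chain rule, with the result kept in the shape of
  \<open>sum_adag_a_coh\<close> so that the entries of \<open>rot_gen\<close> become coefficients of
  hopping operators.\<close>

lemma coh_rot_derivative:
  assumes l: "l \<in> {1..<m}"
  shows "((\<lambda>\<theta>. coh m (\<lambda>i. \<Sum>j\<in>{1..m}. rot m l c \<beta> \<theta> i j * x j) u) has_vector_derivative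
    (\<Sum>i\<in>{1..m}. of_nat (u i) * (\<Sum>j\<in>{1..m}. rot_gen l c \<beta> i j * x j) * x i ^ (u i - 1) * (\<Prod>k\<in>{1..m} - {i}. x k ^ u k))
     / complex_of_real (sqrt (real (fprod m u)))) (at 0)"
proof -
  let ?y = "\<lambda>i \<theta>. \<Sum>j\<in>{1..m}. rot m l c \<beta> \<theta> i j * x j" and ?y' = "\<lambda>i. \<Sum>j\<in>{1..m}. rot_gen l c \<beta> i j * x j"
  have y: "(?y i has_vector_derivative ?y' i) (at 0)" if "i \<in> {1..m}" for i
    by (intro has_vector_derivative_sum has_vector_derivative_mult_left rot_has_derivative that)
  have y0: "?y i 0 = x i" if i: "i \<in> {1..m}" for i
  proof -
    have "?y i 0 = (\<Sum>j\<in>{1..m}. (if i = j then 1 else 0) * x j)"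
      unfolding rot_0[OF l] using i by (intro sum.cong refl) (simp add: id_mat_def)
    then show ?thesis using i by (simp add: sum_mult_delta)
  qed
  have "((\<lambda>\<theta>. \<Prod>i\<in>{1..m}. ?y i \<theta> ^ u i) has_derivative
      (\<lambda>h. \<Sum>i\<in>{1..m}. (of_nat (u i) * (h *\<^sub>R ?y' i) * ?y i 0 ^ (u i - 1)) * (\<Prod>k\<in>{1..m} - {i}. ?y k 0 ^ u k))) (at 0)"
    by (intro has_derivative_prod has_derivative_power y[unfolded has_vector_derivative_def])
  also have "(\<lambda>h. \<Sum>i\<in>{1..m}. (of_nat (u i) * (h *\<^sub>R ?y' i) * ?y i 0 ^ (u i - 1)) * (\<Prod>k\<in>{1..m} - {i}. ?y k 0 ^ u k))
     = (\<lambda>h. h *\<^sub>R (\<Sum>i\<in>{1..m}. of_nat (u i) * ?y' i * x i ^ (u i - 1) * (\<Prod>k\<in>{1..m} - {i}. x k ^ u k)))"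
  proof
    fix h :: real
    have "(of_nat (u i) * (h *\<^sub>R ?y' i) * ?y i 0 ^ (u i - 1)) * (\<Prod>k\<in>{1..m} - {i}. ?y k 0 ^ u k)
       = h *\<^sub>R (of_nat (u i) * ?y' i * x i ^ (u i - 1) * (\<Prod>k\<in>{1..m} - {i}. x k ^ u k))" if i: "i \<in> {1..m}" for i
    proof -
      have "(\<Prod>k\<in>{1..m} - {i}. ?y k 0 ^ u k) = (\<Prod>k\<in>{1..m} - {i}. x k ^ u k)"
        using y0 by (intro prod.cong refl) auto
      then show ?thesis unfolding y0[OF i] by simp
    qed
    then show "(\<Sum>i\<in>{1..m}. (of_nat (u i) * (h *\<^sub>R ?y' i) * ?y i 0 ^ (u i - 1)) * (\<Prod>k\<in>{1..m} - {i}. ?y k 0 ^ u k))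
      = h *\<^sub>R (\<Sum>i\<in>{1..m}. of_nat (u i) * ?y' i * x i ^ (u i - 1) * (\<Prod>k\<in>{1..m} - {i}. x k ^ u k))"
      unfolding scaleR_sum_right by (rule sum.cong[OF refl])
  qed
  finally have "((\<lambda>\<theta>. \<Prod>i\<in>{1..m}. ?y i \<theta> ^ u i) has_vector_derivative
      (\<Sum>i\<in>{1..m}. of_nat (u i) * ?y' i * x i ^ (u i - 1) * (\<Prod>k\<in>{1..m} - {i}. x k ^ u k))) (at 0)"
    unfolding has_vector_derivative_def .
  then show ?thesis unfolding coh_def by (rule has_vector_derivative_divide)
qed

text \<open>Matrix elements are polynomials in the entries of the rotation, hence differentiable.
  Their derivatives \<open>d\<close> are found without expanding permanents: applied to any coherent
  vector they agree with the combination of generators, by uniqueness of derivatives.\<close>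

lemma su_rep_tau:
  "su_rep m (fock m n) (tau m n) (\<lambda>l. adag_a l (l+1)) (\<lambda>l. adag_a (l+1) l)
     (\<lambda>l u w. adag_a l l u w - adag_a (l+1) (l+1) u w)"
proof
  fix l c \<beta> u v assume l: "l \<in> {1..<m}" and u: "u \<in> fock m n" and v: "v \<in> fock m n"
  have "\<exists>d. ((\<lambda>\<theta>. tau m n (rot m l c \<beta> \<theta>) u w) has_vector_derivative d) (at 0)" if w: "w \<in> fock m n" for w
  proof -
    have "\<exists>d. ((\<lambda>\<theta>. \<Prod>t<n. rot m l c \<beta> \<theta> (modeseq m u ! t) (modeseq m w ! \<sigma> t)) has_vector_derivative d) (at 0)"
      if \<sigma>: "\<sigma> permutes {..<n}" for \<sigma>
    proof (rule has_vector_derivative_prod_exists)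
      fix t assume t: "t \<in> {..<n}"
      then have "\<sigma> t < n" using permutes_in_image[OF \<sigma>] by blast
      then have "modeseq m u ! t \<in> {1..m}" "modeseq m w ! \<sigma> t \<in> {1..m}"
        using t length_modeseq[OF u] length_modeseq[OF w] set_modeseq by (metis lessThan_iff nth_mem subsetD)+
      then show "\<exists>d. ((\<lambda>\<theta>. rot m l c \<beta> \<theta> (modeseq m u ! t) (modeseq m w ! \<sigma> t)) has_vector_derivative d) (at 0)"
        using rot_has_derivative by blast
    qed simp
    then have "\<forall>\<sigma>. \<exists>d. \<sigma> permutes {..<n} \<longrightarrow>
        ((\<lambda>\<theta>. \<Prod>t<n. rot m l c \<beta> \<theta> (modeseq m u ! t) (modeseq m w ! \<sigma> t)) has_vector_derivative d) (at 0)"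
      by simp
    from choice[OF this] obtain d where d: "\<And>\<sigma>. \<sigma> permutes {..<n} \<Longrightarrow>
        ((\<lambda>\<theta>. \<Prod>t<n. rot m l c \<beta> \<theta> (modeseq m u ! t) (modeseq m w ! \<sigma> t)) has_vector_derivative d \<sigma>) (at 0)"
      by blast
    have "((\<lambda>\<theta>. \<Sum>\<sigma> | \<sigma> permutes {..<n}. \<Prod>t<n. rot m l c \<beta> \<theta> (modeseq m u ! t) (modeseq m w ! \<sigma> t)) has_vector_derivative
        (\<Sum>\<sigma> | \<sigma> permutes {..<n}. d \<sigma>)) (at 0)"
      by (rule has_vector_derivative_sum) (use d in auto)
    from has_vector_derivative_divide[OF this] show ?thesis unfolding tau_def by blast
  qed
  then have "\<forall>w. \<exists>d. w \<in> fock m n \<longrightarrow> ((\<lambda>\<theta>. tau m n (rot m l c \<beta> \<theta>) u w) has_vector_derivative d) (at 0)"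
    by simp
  from choice[OF this] obtain d where d: "\<And>w. w \<in> fock m n \<Longrightarrow> ((\<lambda>\<theta>. tau m n (rot m l c \<beta> \<theta>) u w) has_vector_derivative d w) (at 0)"
    by blast
  let ?G = "\<lambda>w. \<i> * c * (adag_a l l u w - adag_a (l+1) (l+1) u w) + \<beta> * adag_a l (l+1) u w - cnj \<beta> * adag_a (l+1) l u w"
  have "d v = ?G v"
  proof (rule coh_matrix_eqI[OF _ v])
    fix x
    let ?s = "complex_of_real (sqrt (real (fprod m u)))"
    let ?T = "\<lambda>i j. of_nat (u i) * x j * x i ^ (u i - 1) * (\<Prod>k\<in>{1..m} - {i}. x k ^ u k) / ?s"
    have "((\<lambda>\<theta>. \<Sum>w\<in>fock m n. tau m n (rot m l c \<beta> \<theta>) u w * coh m x w) has_vector_derivative (\<Sum>w\<in>fock m n. d w * coh m x w)) (at 0)"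
      by (intro has_vector_derivative_sum has_vector_derivative_mult_left d)
    then have "(\<Sum>w\<in>fock m n. d w * coh m x w)
       = (\<Sum>i\<in>{1..m}. of_nat (u i) * (\<Sum>j\<in>{1..m}. rot_gen l c \<beta> i j * x j) * x i ^ (u i - 1) * (\<Prod>k\<in>{1..m} - {i}. x k ^ u k)) / ?s"
      unfolding tau_coh[OF u] using coh_rot_derivative[OF l] vector_derivative_unique_at by blast
    also have "\<dots> = (\<Sum>i\<in>{1..m}. \<Sum>j\<in>{1..m}. rot_gen l c \<beta> i j * ?T i j)"
      unfolding sum_divide_distrib sum_distrib_left sum_distrib_right by (intro sum.cong refl) simp
    also have "\<dots> = (\<Sum>i\<in>{l, l+1}. \<Sum>j\<in>{l, l+1}. rot_gen l c \<beta> i j * ?T i j)"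
    proof -
      have "(\<Sum>i\<in>{1..m}. \<Sum>j\<in>{1..m}. rot_gen l c \<beta> i j * ?T i j) = (\<Sum>i\<in>{l, l+1}. \<Sum>j\<in>{1..m}. rot_gen l c \<beta> i j * ?T i j)"
        by (rule sum.mono_neutral_right) (use l in \<open>auto simp: rot_gen_def\<close>)
      also have "\<dots> = (\<Sum>i\<in>{l, l+1}. \<Sum>j\<in>{l, l+1}. rot_gen l c \<beta> i j * ?T i j)"
        by (rule sum.cong[OF refl], rule sum.mono_neutral_right) (use l in \<open>auto simp: rot_gen_def\<close>)
      finally show ?thesis .
    qed
    also have "\<dots> = \<i> * c * (?T l l - ?T (l+1) (l+1)) + \<beta> * ?T l (l+1) - cnj \<beta> * ?T (l+1) l"
      by (simp add: rot_gen_def algebra_simps)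
    also have "\<dots> = (\<Sum>w\<in>fock m n. ?G w * coh m x w)"
    proof -
      have A: "?T i j = (\<Sum>w\<in>fock m n. adag_a i j u w * coh m x w)" if "i \<in> {l, l+1}" "j \<in> {l, l+1}" for i j
        by (rule sum_adag_a_coh[symmetric, OF u]) (use that l in auto)
      show ?thesis using A[of l l] A[of "l+1" "l+1"] A[of l "l+1"] A[of "l+1" l]
        by (simp add: sum_distrib_left sum.distrib sum_subtractf algebra_simps)
    qed
    finally show "(\<Sum>w\<in>fock m n. d w * coh m x w) = (\<Sum>w\<in>fock m n. ?G w * coh m x w)" .
  qed
  then show "((\<lambda>\<theta>. tau m n (rot m l c \<beta> \<theta>) u v) has_vector_derivative ?G v) (at 0)" using d[OF v] by simp
next
  fix u v assume "u \<in> fock m n" "v \<in> fock m n"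
  then show "tau m n (id_mat m) u v = (if u = v then 1 else 0)" by (intro tau_id) (auto simp: id_mat_def)
next
  fix g u v assume "g \<in> SU m" "u \<in> fock m n" "v \<in> fock m n"
  then show "(\<Sum>w\<in>fock m n. cnj (tau m n g w u) * tau m n g w v) = (if u = v then 1 else 0)" by (rule tau_unitary)
qed (auto intro: tau_mult tau_measurable)

section \<open>Equivariant families and isotypic components\<close>

lemma intertwines_scale:
  assumes "intertwines B A \<Gamma> \<alpha> v"
  shows "intertwines B A \<Gamma> \<alpha> (\<lambda>M a. v M a * t)"
  unfolding intertwines_def
proof (intro ballI)
  fix M a assume M: "M \<in> \<Gamma>" and a: "a \<in> B"
  have "(\<Sum>b\<in>B. A a b * (v M b * t)) = (\<Sum>b\<in>B. A a b * v M b) * t"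
    by (simp add: sum_distrib_right mult.assoc)
  also have "\<dots> = (\<Sum>M'\<in>\<Gamma>. \<alpha> M' M * (v M' a * t))"
    unfolding intertwinesD[OF assms M a] by (simp add: sum_distrib_right mult.assoc)
  finally show "(\<Sum>b\<in>B. A a b * (v M b * t)) = (\<Sum>M'\<in>\<Gamma>. \<alpha> M' M * (v M' a * t))" .
qed

lemma gt_map_scale: "gt_map m B U D H lam v \<Longrightarrow> gt_map m B U D H lam (\<lambda>M a. v M a * t)"
  unfolding gt_map_def by (intro ballI conjI intertwines_scale) auto

lemma intertwines_cong:
  assumes "\<And>M a. M \<in> \<Gamma> \<Longrightarrow> a \<in> B \<Longrightarrow> v M a = w M a"
  shows "intertwines B A \<Gamma> \<alpha> v \<longleftrightarrow> intertwines B A \<Gamma> \<alpha> w"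
  unfolding intertwines_def using assms by simp

text \<open>By Schur's lemma the Gram matrix is r times the identity. If r = 0 the family vanishes
  and the empty combination represents it; otherwise division by the root of r gives a genuine GT
  family.\<close>

lemma gt_map_in_isotypic:
  assumes adj: "adjoint_gens m B U D H" and mx: "max_pat m lam \<in> GT m lam"
    and v: "gt_map m B U D H lam v" and supp: "\<And>M a. M \<in> GT m lam \<Longrightarrow> a \<notin> B \<Longrightarrow> v M a = 0"
    and R: "R \<in> GT m lam"
  shows "v R \<in> isotypic m B U D H lam"
proof -
  have fin: "finite B" using adj unfolding adjoint_gens_def by blast
  let ?s = "cinner B (v (max_pat m lam)) (v (max_pat m lam))"
  define r where "r = (\<Sum>a\<in>B. (cmod (v (max_pat m lam) a))\<^sup>2)"
  have s: "?s = complex_of_real r"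
    by (simp add: cinner_def r_def complex_norm_square mult.commute flip: of_real_power)
  have gram: "cinner B (v M) (v P) = (if M = P then complex_of_real r else 0)"
    if "M \<in> GT m lam" "P \<in> GT m lam" for M P
    using gram_scalar[OF adj mx v v that] unfolding s .
  have r0: "r \<ge> 0" unfolding r_def by (intro sum_nonneg) simp
  show ?thesis
  proof (cases "r = 0")
    case True
    have "v R a = 0" for a
    proof (cases "a \<in> B")
      case a: True
      show ?thesis by (rule cinner_self_eq_0[OF fin _ a]) (use gram[OF R R] True in simp)
    qed (rule supp[OF R])
    then have "v R = (\<lambda>a. \<Sum>w\<in>{}. 0 * w a)" by auto
    then show ?thesis unfolding isotypic_def cspan_def mem_Collect_eq
      by (intro exI[of _ "{}"] exI[of _ "\<lambda>_. 0"] conjI finite.emptyI empty_subsetI)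
  next
    case False
    define t where "t = sqrt r"
    have t: "t > 0" "t * t = r" using False r0 by (simp_all add: t_def)
    define w where "w M a = v M a * complex_of_real (1 / t)" for M a
    have "gt_map m B U D H lam w" unfolding w_def by (rule gt_map_scale[OF v])
    moreover have "cinner B (w M) (w P) = (if M = P then 1 else 0)" if MP: "M \<in> GT m lam" "P \<in> GT m lam" for M P
    proof -
      have "cinner B (w M) (w P) = cinner B (v M) (v P) * complex_of_real (1 / (t * t))"
        by (simp add: cinner_def w_def sum_distrib_right ac_simps sum_divide_distrib)
      then show ?thesis unfolding gram[OF MP] t(2) using False by simp
    qed
    moreover have "w M a = 0" if "M \<in> GT m lam" "a \<notin> B" for M a using supp[OF that] by (simp add: w_def)
    ultimately have "gt_family m B U D H lam w" unfolding gt_family_iff by blast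
    then have mem: "w R \<in> {w M |w M. gt_family m B U D H lam w \<and> M \<in> GT m lam}"
      using R by (intro CollectI exI[of _ w] exI[of _ R] conjI refl)
    have "v R = (\<lambda>a. \<Sum>M\<in>{R}. complex_of_real t * w M a)" 
      by (rule ext) (use t(1) in \<open>simp add: w_def\<close>)
    also have "\<dots> \<in> cspan {w M |w M. gt_family m B U D H lam w \<and> M \<in> GT m lam}"
    proof (rule cspan_sum)
      fix M assume "M \<in> {R}"
      then show "w M \<in> {w M |w M. gt_family m B U D H lam w \<and> M \<in> GT m lam}"
        using mem unfolding singleton_iff by simp
    qed simp_all
    finally show ?thesis unfolding isotypic_def .
  qed
qed

text \<open>The weight of the highest vector of \<^term>\<open>lam_k m l\<close> exceeds all weights of the tensor square.\<close>
lemma gt_map_tens_zero: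
  assumes m: "m \<ge> 2" and kl: "2 * k < l"
    and v: "gt_map m (tens_B m (lam_k m k)) (\<lambda>j. tens_mat (gt_up m (lam_k m k) j))
         (\<lambda>j. tens_mat (gt_down m (lam_k m k) j)) (\<lambda>j. tens_mat (gt_h m (lam_k m k) j)) (lam_k m l) v"
    and R: "R \<in> GT m (lam_k m l)" and z: "z \<in> tens_B m (lam_k m k)"
  shows "v R z = 0"
proof -
  let ?G = "GT m (lam_k m k)" and ?T = "max_pat m (lam_k m l)"
  have T: "?T \<in> GT m (lam_k m l)" using m by simp
  have top: "v ?T (M, M') = 0" if M: "M \<in> ?G" and M': "M' \<in> ?G" for M M'
  proof (rule ccontr)
    assume nz: "v ?T (M, M') \<noteq> 0"
    have "(gt_wt M j - gt_wt M (j+1)) + (gt_wt M' j - gt_wt M' (j+1)) = gt_wt ?T j - gt_wt ?T (j+1)"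
      if j: "j \<in> {1..<m}" for j
    proof -
      let ?h = "\<lambda>M. of_int (gt_wt M j - gt_wt M (j+1)) :: complex"
      have h: "(\<Sum>P\<in>GT m lam. gt_h m lam j M P * f P) = ?h M * f M" if "M \<in> GT m lam" for lam M f
      proof -
        have "(\<Sum>P\<in>GT m lam. gt_h m lam j M P * f P) = (\<Sum>P\<in>{M}. gt_h m lam j M P * f P)"
          by (rule sum.mono_neutral_right) (use that in \<open>auto simp: gt_h_def\<close>)
        then show ?thesis using that by (simp add: gt_h_def)
      qed
      have "intertwines (?G \<times> ?G) (tprod (gt_h m (lam_k m k) j) (gt_h m (lam_k m k) j)) (GT m (lam_k m l)) (gt_h m (lam_k m l) j) v"
        using v j unfolding gt_map_def tens_B_def tens_mat_eq_tprod by blast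
      from intertwinesD[OF this T, of "(M, M')"]
      have "?h M * v ?T (M, M') + ?h M' * v ?T (M, M') = (\<Sum>P\<in>GT m (lam_k m l). gt_h m (lam_k m l) j P ?T * v P (M, M'))"
        using M M' by (simp only: sum_tprod[OF finite_GT finite_GT] h mem_Times_iff fst_conv snd_conv simp_thms)
      also have "\<dots> = (\<Sum>P\<in>{?T}. gt_h m (lam_k m l) j P ?T * v P (M, M'))"
        by (rule sum.mono_neutral_right) (use T in \<open>auto simp: gt_h_def\<close>)
      also have "\<dots> = ?h ?T * v ?T (M, M')" using T by (simp add: gt_h_def)
      finally have "(?h M + ?h M') * v ?T (M, M') = ?h ?T * v ?T (M, M')" by (simp only: distrib_right)
      then have "?h M + ?h M' = ?h ?T" using nz by (simp only: mult_cancel_right) simp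
      then show ?thesis by (simp only: of_int_add[symmetric] of_int_eq_iff)
    qed
    then have "(\<Sum>j\<in>{1..<m}. (gt_wt M j - gt_wt M (j+1)) + (gt_wt M' j - gt_wt M' (j+1)))
        = (\<Sum>j\<in>{1..<m}. gt_wt ?T j - gt_wt ?T (j+1))" by (intro sum.cong) auto
    then have "(gt_wt M 1 - gt_wt M m) + (gt_wt M' 1 - gt_wt M' m) = 2 * int l"
      unfolding sum.distrib using m sum_gt_wt_diff[of m] gt_wt_max_pat_lam_k[OF m] by simp
    moreover have bound: "gt_wt P 1 - gt_wt P m \<le> 2 * int k" if "P \<in> ?G" for P
      using gt_wt_bounds[OF that] m by (simp add: lam_k_def)
    ultimately show False using kl bound[OF M] bound[OF M'] by linarith
  qed
  \<comment> \<open>Schur's lemma gives all members of the family the norm of the top one.\<close>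
  have "cinner (tens_B m (lam_k m k)) (v R) (v R) = cinner (tens_B m (lam_k m k)) (v ?T) (v ?T)"
    using gram_scalar[OF adjoint_gens_tens T v v R R] by simp
  also have "\<dots> = 0" unfolding cinner_def using top by (intro sum.neutral) (auto simp: tens_B_def)
  finally show ?thesis
    by (rule cinner_self_eq_0[rotated]) (use z in \<open>auto simp: tens_B_def\<close>)
qed

section \<open>The representation on operators and its triple tensor product\<close>

definition om_rep :: "nat \<Rightarrow> nat \<Rightarrow> cmat \<Rightarrow> (nat \<Rightarrow> nat) \<times> (nat \<Rightarrow> nat) \<Rightarrow> (nat \<Rightarrow> nat) \<times> (nat \<Rightarrow> nat) \<Rightarrow> complex" where
  "om_rep m n g = (\<lambda>(u, v) (u', v'). tau m n g u u' * cnj (tau m n g v v'))"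

lemma su_rep_om: "su_rep m (om_B m n) (om_rep m n) om_U om_D om_H"
proof -
  have "om_U = (\<lambda>l. tprod (adag_a l (l+1)) (\<lambda>a b. - cnj (adag_a (l+1) l a b)))"
    "om_D = (\<lambda>l. tprod (adag_a (l+1) l) (\<lambda>a b. - cnj (adag_a l (l+1) a b)))"
    by (rule ext, simp only: om_U_def om_D_def ad_mat_eq_tprod cnj_adag_a, subst adag_a_flip, rule refl)+
  moreover have "om_H = (\<lambda>l. tprod (\<lambda>u w. adag_a l l u w - adag_a (l+1) (l+1) u w)
       (\<lambda>a b. - cnj (adag_a l l a b - adag_a (l+1) (l+1) a b)))"
  proof
    fix l
    have "adag_a i i a b = adag_a i i b a" for i a b by (rule adag_a_flip)
    then show "om_H l = tprod (\<lambda>u w. adag_a l l u w - adag_a (l+1) (l+1) u w)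
       (\<lambda>a b. - cnj (adag_a l l a b - adag_a (l+1) (l+1) a b))"
      unfolding om_H_def ad_mat_eq_tprod by (metis (no_types, lifting) complex_cnj_diff cnj_adag_a)
  qed
  ultimately show ?thesis
    using su_rep_tensor[OF su_rep_tau su_rep_cnj[OF su_rep_tau], of m n n]
    unfolding om_B_def om_rep_def by simp
qed

definition tri_B :: "nat \<Rightarrow> nat \<Rightarrow> ((((nat \<Rightarrow> nat) \<times> (nat \<Rightarrow> nat)) \<times> ((nat \<Rightarrow> nat) \<times> (nat \<Rightarrow> nat))) \<times> ((nat \<Rightarrow> nat) \<times> (nat \<Rightarrow> nat))) set" where
  "tri_B m n = (om_B m n \<times> om_B m n) \<times> om_B m n"

text \<open>The third slot has the dual action, minus the transpose. Because lowering is adjoint to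
  raising, this is the differential of the conjugated representation.\<close>

definition tri_gen :: "(((nat \<Rightarrow> nat) \<times> (nat \<Rightarrow> nat)) \<Rightarrow> ((nat \<Rightarrow> nat) \<times> (nat \<Rightarrow> nat)) \<Rightarrow> complex) \<Rightarrow> _" where
  "tri_gen A = tprod (tprod A A) (\<lambda>c c'. - A c' c)"

definition tri_rep where
  "tri_rep m n g = (\<lambda>((a, b), c) ((a', b'), c'). om_rep m n g a a' * om_rep m n g b b' * cnj (om_rep m n g c c'))"

lemma su_rep_tri:
  "su_rep m (tri_B m n) (tri_rep m n) (\<lambda>l. tri_gen (om_U l)) (\<lambda>l. tri_gen (om_D l)) (\<lambda>l. tri_gen (om_H l))"
proof -
  have e: "(\<lambda>a b. - cnj (om_D l a b)) = (\<lambda>a b. - om_U l b a)" "(\<lambda>a b. - cnj (om_U l a b)) = (\<lambda>a b. - om_D l b a)"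
    "(\<lambda>a b. - cnj (om_H l a b)) = (\<lambda>a b. - om_H l b a)" for l
    by (simp_all only: om_D_cnj complex_cnj_cnj om_H_cnj[of l, symmetric])
  have "tri_rep m n = (\<lambda>g (a, b) (c, d). (case a of (a, b) \<Rightarrow> \<lambda>(c, d). om_rep m n g a c * om_rep m n g b d) c * cnj (om_rep m n g b d))"
    by (simp add: tri_rep_def fun_eq_iff case_prod_beta)
  then show ?thesis
    using su_rep_tensor[OF su_rep_tensor[OF su_rep_om su_rep_om] su_rep_cnj[OF su_rep_om], of m n n n]
    unfolding tri_B_def tri_gen_def by (simp only: e)
qed

section \<open>The second moment\<close>

definition dens :: "(nat \<Rightarrow> nat) \<Rightarrow> (nat \<Rightarrow> nat) \<times> (nat \<Rightarrow> nat) \<Rightarrow> complex" where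
  "dens n0 = (\<lambda>(x, y). if x = n0 \<and> y = n0 then 1 else 0)"

text \<open>Component of the invariant of copy r of the l-th irrep at the diagonal Fock index (v, v)
  in all three slots. The sum in g_k is a product of two of these, up to signs.\<close>

definition diag_amp where
  "diag_amp m k X W l r v = (\<Sum>M\<in>GT m (lam_k m k). \<Sum>M'\<in>GT m (lam_k m k). \<Sum>R\<in>GT m (lam_k m l).
     W l r R (M, M') * X k M (v, v) * X k M' (v, v) * X l R (v, v :: nat \<Rightarrow> nat) :: complex)"

context
  fixes m n k :: nat and \<mu> :: "cmat measure"
    and X :: "nat \<Rightarrow> gtpat \<Rightarrow> ((nat \<Rightarrow> nat) \<times> (nat \<Rightarrow> nat)) \<Rightarrow> complex"
    and W :: "nat \<Rightarrow> nat \<Rightarrow> gtpat \<Rightarrow> (gtpat \<times> gtpat) \<Rightarrow> complex"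
    and mult :: "nat \<Rightarrow> nat"
  assumes m2: "m \<ge> 2"
    and kn: "k \<le> n"
    and haar: "haar_SU m \<mu>"
    and X_gt: "\<And>l. l \<le> n \<Longrightarrow> gt_family m (om_B m n) om_U om_D om_H (lam_k m l) (X l)"
    and X_real: "\<And>l M a. l \<le> n \<Longrightarrow> cnj (X l M a) = X l M a"
    and W_gt: "\<And>l r. l \<le> min n (2*k) \<Longrightarrow> r \<in> {1..mult l} \<Longrightarrow>
       gt_family m (tens_B m (lam_k m k)) (\<lambda>j. tens_mat (gt_up m (lam_k m k) j))
         (\<lambda>j. tens_mat (gt_down m (lam_k m k) j)) (\<lambda>j. tens_mat (gt_h m (lam_k m k) j))
         (lam_k m l) (W l r)"
    and W_orth: "\<And>l r r' R R'. l \<le> min n (2*k) \<Longrightarrow> r \<in> {1..mult l} \<Longrightarrow> r' \<in> {1..mult l} \<Longrightarrow> r \<noteq> r' \<Longrightarrow>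
       R \<in> GT m (lam_k m l) \<Longrightarrow> R' \<in> GT m (lam_k m l) \<Longrightarrow>
          cinner (tens_B m (lam_k m k)) (W l r R) (W l r' R') = 0"
    and W_span: "\<And>l. l \<le> min n (2*k) \<Longrightarrow>
       cspan {W l r R | r R. r \<in> {1..mult l} \<and> R \<in> GT m (lam_k m l)} =
       isotypic m (tens_B m (lam_k m k)) (\<lambda>j. tens_mat (gt_up m (lam_k m k) j))
         (\<lambda>j. tens_mat (gt_down m (lam_k m k) j)) (\<lambda>j. tens_mat (gt_h m (lam_k m k) j))
         (lam_k m l)"
    and W_real: "\<And>l r R a. cnj (W l r R a) = W l r R a"
begin

interpretation tri: su_rep_haar m "tri_B m n" "tri_rep m n" "\<lambda>l. tri_gen (om_U l)" "\<lambda>l. tri_gen (om_D l)" "\<lambda>l. tri_gen (om_H l)" \<mu>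
  by (intro su_rep_haar.intro su_rep_tri su_rep_haar_axioms.intro haar)

private abbreviation (input) "O_B \<equiv> om_B m n"
private abbreviation (input) "G \<equiv> GT m (lam_k m k)"
private abbreviation (input) "GL l \<equiv> GT m (lam_k m l)"

lemma X_intertwines:
  assumes "l \<le> n" "j \<in> {1..<m}"
  shows "intertwines O_B (om_U j) (GL l) (gt_up m (lam_k m l) j) (X l)"
    "intertwines O_B (om_D j) (GL l) (gt_down m (lam_k m l) j) (X l)"
    "intertwines O_B (om_H j) (GL l) (gt_h m (lam_k m l) j) (X l)"
  using X_map[OF m2 X_gt assms(1)] assms(2) unfolding gt_map_def by blast+

text \<open>GT basis of copy r inside the square of the k-th component, expressed in Fock
  indices.\<close>

definition pairvec :: "nat \<Rightarrow> nat \<Rightarrow> gtpat \<Rightarrow> _ \<Rightarrow> complex" where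
  "pairvec l r R = (\<lambda>(a, b). \<Sum>M\<in>G. \<Sum>M'\<in>G. W l r R (M, M') * X k M a * X k M' b)"

text \<open>The intertwiner sending \<open>X l R\<close> to \<open>pairvec l r R\<close>, written as
  a vector: the dual basis is attached as the conjugated one.\<close>

definition invvec :: "nat \<Rightarrow> nat \<Rightarrow> _ \<Rightarrow> complex" where
  "invvec l r = (\<lambda>(ab, c). \<Sum>R\<in>GL l. pairvec l r R ab * cnj (X l R c))"

lemma W_intertwines:
  assumes "l \<le> min n (2*k)" "r \<in> {1..mult l}" "j \<in> {1..<m}"
  shows "intertwines (G \<times> G) (tprod (gt_up m (lam_k m k) j) (gt_up m (lam_k m k) j)) (GL l) (gt_up m (lam_k m l) j) (W l r)"
    "intertwines (G \<times> G) (tprod (gt_down m (lam_k m k) j) (gt_down m (lam_k m k) j)) (GL l) (gt_down m (lam_k m l) j) (W l r)"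
    "intertwines (G \<times> G) (tprod (gt_h m (lam_k m k) j) (gt_h m (lam_k m k) j)) (GL l) (gt_h m (lam_k m l) j) (W l r)"
proof -
  have "gt_map m (tens_B m (lam_k m k)) (\<lambda>j. tens_mat (gt_up m (lam_k m k) j))
         (\<lambda>j. tens_mat (gt_down m (lam_k m k) j)) (\<lambda>j. tens_mat (gt_h m (lam_k m k) j)) (lam_k m l) (W l r)"
    using W_gt[OF assms(1,2)] unfolding gt_family_iff by (elim conjE)
  then show "intertwines (G \<times> G) (tprod (gt_up m (lam_k m k) j) (gt_up m (lam_k m k) j)) (GL l) (gt_up m (lam_k m l) j) (W l r)"
    "intertwines (G \<times> G) (tprod (gt_down m (lam_k m k) j) (gt_down m (lam_k m k) j)) (GL l) (gt_down m (lam_k m l) j) (W l r)"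
    "intertwines (G \<times> G) (tprod (gt_h m (lam_k m k) j) (gt_h m (lam_k m k) j)) (GL l) (gt_h m (lam_k m l) j) (W l r)"
    using assms(3) unfolding gt_map_def tens_B_def tens_mat_eq_tprod by blast+
qed

lemma om_gens_cnj:
  "om_U l a b = cnj (om_D l b a)" "om_D l a b = cnj (om_U l b a)" "om_H l a b = cnj (om_H l b a)"
  by (metis om_D_cnj complex_cnj_cnj om_H_cnj)+

lemma invvec_invariant:
  assumes l: "l \<le> min n (2*k)" and r: "r \<in> {1..mult l}"
  shows "tri.lie_invariant (invvec l r)"
  unfolding tri.lie_invariant_def
proof (intro ballI)
  fix j z assume j: "j \<in> {1..<m}" and z: "z \<in> tri_B m n"
  have ln: "l \<le> n" using l by simp
  have fin: "finite (O_B \<times> O_B)" "finite O_B" by simp_all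
  have z': "z \<in> (O_B \<times> O_B) \<times> O_B" using z by (simp add: tri_B_def)
  have "(\<Sum>b\<in>tri_B m n. tri_gen A z b * invvec l r b) = 0"
    if "\<And>a b. A' a b = cnj (A b a)" "\<And>P Q. \<alpha>' Q P = cnj (\<alpha> P Q)"
      "intertwines O_B A G \<beta> (X k)" "intertwines O_B A' (GL l) \<alpha>' (X l)"
      "intertwines (G \<times> G) (tprod \<beta> \<beta>) (GL l) \<alpha> (W l r)" for A A' \<alpha> \<alpha>' \<beta>
  proof -
    have "intertwines (O_B \<times> O_B) (tprod A A) (GL l) \<alpha> (pairvec l r)"
      unfolding pairvec_def by (rule intertwines_tensor[OF fin(2) finite_GT that(3) that(5)])
    from invariant_of_intertwines[OF fin finite_GT that(1,2,4) this z']
    show ?thesis unfolding tri_B_def tri_gen_def invvec_def by simp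
  qed
  note * = this
  show "(\<Sum>b\<in>tri_B m n. tri_gen (om_U j) z b * invvec l r b) = 0 \<and>
      (\<Sum>b\<in>tri_B m n. tri_gen (om_D j) z b * invvec l r b) = 0 \<and>
      (\<Sum>b\<in>tri_B m n. tri_gen (om_H j) z b * invvec l r b) = 0"
    by (intro conjI
      *[OF om_gens_cnj(2) gt_down_cnj(1) X_intertwines(1)[OF kn j] X_intertwines(2)[OF ln j] W_intertwines(1)[OF l r j]]
      *[OF om_gens_cnj(1) gt_down_cnj(2) X_intertwines(2)[OF kn j] X_intertwines(1)[OF ln j] W_intertwines(2)[OF l r j]]
      *[OF om_gens_cnj(3) gt_h_cnj X_intertwines(3)[OF kn j] X_intertwines(3)[OF ln j] W_intertwines(3)[OF l r j]])
qed

text \<open>There is no conjugation, since the third slot is dual and its pairing with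
  \<open>X l R\<close> is bilinear.\<close>

definition slice where
  "slice y l R = (\<lambda>ab. \<Sum>c\<in>O_B. X l R c * y (ab, c))"

text \<open>Coordinates of the slice in the product basis of the k-th component. The value 0 off
  patterns supplies the support that membership in the isotypic component demands.\<close>

definition coeffs where
  "coeffs y l R = (\<lambda>(M, M'). if M \<in> G \<and> M' \<in> G
     then \<Sum>a\<in>O_B. \<Sum>b\<in>O_B. cnj (X k M a) * cnj (X k M' b) * slice y l R (a, b) else 0)"

text \<open>Contraction of the third slot gives an equivariant family in the first two, and passing
  to coordinates is the adjoint of an intertwiner.\<close>

lemma coeffs_gt_map:
  assumes y: "tri.lie_invariant y" and l: "l \<le> n"
  shows "gt_map m (tens_B m (lam_k m k)) (\<lambda>j. tens_mat (gt_up m (lam_k m k) j))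
         (\<lambda>j. tens_mat (gt_down m (lam_k m k) j)) (\<lambda>j. tens_mat (gt_h m (lam_k m k) j)) (lam_k m l) (coeffs y l)"
  unfolding gt_map_def tens_B_def tens_mat_eq_tprod
proof (intro ballI)
  fix j assume j: "j \<in> {1..<m}"
  have fin: "finite (O_B \<times> O_B)" "finite O_B" by simp_all
  have *: "intertwines (G \<times> G) (tprod \<beta> \<beta>) (GL l) \<alpha> (coeffs y l)"
    if "\<And>a b. A' a b = cnj (A b a)" "\<And>P Q. \<beta>' Q P = cnj (\<beta> P Q)"
      "intertwines O_B A' G \<beta>' (X k)" "intertwines O_B A (GL l) \<alpha> (X l)"
      "\<And>z. z \<in> tri_B m n \<Longrightarrow> (\<Sum>b\<in>tri_B m n. tri_gen A z b * y b) = 0" for A A' \<alpha> \<beta> \<beta>'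
  proof -
    have "intertwines (O_B \<times> O_B) (tprod A A) (GL l) \<alpha> (slice y l)"
      unfolding slice_def
      by (rule intertwines_contract[OF fin that(4)]) (use that(5) in \<open>simp add: tri_B_def tri_gen_def\<close>)
    from intertwines_cotensor[OF fin(2) finite_GT that(1,2,3) this]
    show ?thesis
      by (subst intertwines_cong[where w = "\<lambda>R (M, M'). \<Sum>a\<in>O_B. \<Sum>b\<in>O_B. cnj (X k M a) * cnj (X k M' b) * slice y l R (a, b)"])
        (auto simp: coeffs_def)
  qed
  have y': "\<And>z. z \<in> tri_B m n \<Longrightarrow> (\<Sum>b\<in>tri_B m n. tri_gen (om_U j) z b * y b) = 0"
    "\<And>z. z \<in> tri_B m n \<Longrightarrow> (\<Sum>b\<in>tri_B m n. tri_gen (om_D j) z b * y b) = 0"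
    "\<And>z. z \<in> tri_B m n \<Longrightarrow> (\<Sum>b\<in>tri_B m n. tri_gen (om_H j) z b * y b) = 0"
    using y j unfolding tri.lie_invariant_def by blast+
  show "intertwines (G \<times> G) (tprod (gt_up m (lam_k m k) j) (gt_up m (lam_k m k) j)) (GL l) (gt_up m (lam_k m l) j) (coeffs y l) \<and>
    intertwines (G \<times> G) (tprod (gt_down m (lam_k m k) j) (gt_down m (lam_k m k) j)) (GL l) (gt_down m (lam_k m l) j) (coeffs y l) \<and>
    intertwines (G \<times> G) (tprod (gt_h m (lam_k m k) j) (gt_h m (lam_k m k) j)) (GL l) (gt_h m (lam_k m l) j) (coeffs y l)"
    by (intro conjI
      *[OF om_gens_cnj(2) gt_down_cnj(1) X_intertwines(2)[OF kn j] X_intertwines(1)[OF l j] y'(1)]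
      *[OF om_gens_cnj(1) gt_down_cnj(2) X_intertwines(1)[OF kn j] X_intertwines(2)[OF l j] y'(2)]
      *[OF om_gens_cnj(3) gt_h_cnj X_intertwines(3)[OF kn j] X_intertwines(3)[OF l j] y'(3)])
qed

text \<open>All three families \<open>X\<close> move to the other side of the inner product, and the
  sum over R assembles them to \<open>invvec\<close>. The left-hand side is the trace of a Schur
  scalar.\<close>

lemma sum_cinner_W_coeffs:
  assumes l: "l \<le> min n (2*k)" and r: "r \<in> {1..mult l}"
  shows "(\<Sum>R\<in>GL l. cinner (tens_B m (lam_k m k)) (W l r R) (coeffs y l R)) = cinner (tri_B m n) (invvec l r) y"
proof -
  have 1: "cinner (tens_B m (lam_k m k)) (W l r R) (coeffs y l R) = (\<Sum>ab\<in>O_B \<times> O_B. cnj (pairvec l r R ab) * slice y l R ab)" for R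
  proof -
    have "cinner (tens_B m (lam_k m k)) (W l r R) (coeffs y l R)
      = (\<Sum>M\<in>G. \<Sum>M'\<in>G. \<Sum>a\<in>O_B. \<Sum>b\<in>O_B. cnj (W l r R (M, M') * X k M a * X k M' b) * slice y l R (a, b))"
      by (simp add: cinner_def tens_B_def coeffs_def sum.cartesian_product' sum_distrib_left mult.assoc cong: sum.cong_simp)
    also have "\<dots> = (\<Sum>a\<in>O_B. \<Sum>b\<in>O_B. \<Sum>M\<in>G. \<Sum>M'\<in>G. cnj (W l r R (M, M') * X k M a * X k M' b) * slice y l R (a, b))"
    proof -
      have "(\<Sum>M\<in>G. \<Sum>M'\<in>G. \<Sum>a\<in>O_B. \<Sum>b\<in>O_B. f M M' a b) = (\<Sum>a\<in>O_B. \<Sum>b\<in>O_B. \<Sum>M\<in>G. \<Sum>M'\<in>G. f M M' a b)" for f :: "_ \<Rightarrow> _ \<Rightarrow> _ \<Rightarrow> _ \<Rightarrow> complex"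
      proof -
        have "(\<Sum>M\<in>G. \<Sum>M'\<in>G. \<Sum>a\<in>O_B. \<Sum>b\<in>O_B. f M M' a b) = (\<Sum>p\<in>G \<times> G. \<Sum>q\<in>O_B \<times> O_B. f (fst p) (snd p) (fst q) (snd q))"
          by (simp add: sum.cartesian_product' case_prod_beta)
        also have "\<dots> = (\<Sum>q\<in>O_B \<times> O_B. \<Sum>p\<in>G \<times> G. f (fst p) (snd p) (fst q) (snd q))" by (rule sum.swap)
        finally show ?thesis by (simp add: sum.cartesian_product' case_prod_beta)
      qed
      then show ?thesis .
    qed
    also have "\<dots> = (\<Sum>ab\<in>O_B \<times> O_B. cnj (pairvec l r R ab) * slice y l R ab)"
      by (simp add: sum.cartesian_product' pairvec_def sum_distrib_right)
    finally show ?thesis .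
  qed
  have "(\<Sum>R\<in>GL l. cinner (tens_B m (lam_k m k)) (W l r R) (coeffs y l R))
     = (\<Sum>R\<in>GL l. \<Sum>ab\<in>O_B \<times> O_B. \<Sum>c\<in>O_B. cnj (pairvec l r R ab * cnj (X l R c)) * y (ab, c))"
    unfolding 1 slice_def by (simp add: sum_distrib_left mult.assoc)
  also have "\<dots> = (\<Sum>ab\<in>O_B \<times> O_B. \<Sum>c\<in>O_B. \<Sum>R\<in>GL l. cnj (pairvec l r R ab * cnj (X l R c)) * y (ab, c))"
    by (subst sum.swap, rule sum.cong[OF refl], rule sum.swap)
  also have "\<dots> = (\<Sum>ab\<in>O_B \<times> O_B. \<Sum>c\<in>O_B. cnj (invvec l r (ab, c)) * y (ab, c))"
    by (simp add: invvec_def sum_distrib_right)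
  also have "\<dots> = cinner (tri_B m n) (invvec l r) y"
    unfolding cinner_def tri_B_def sum.cartesian_product by (simp add: case_prod_beta)
  finally show ?thesis .
qed

text \<open>Invariance of y turns its coefficients into an intertwiner from the l-th component to the
  tensor square, so Schur's lemma leaves one scalar for each copy r.\<close>
lemma coeffs_expand:
  assumes y: "tri.lie_invariant y" and l: "l \<le> n" and R: "R \<in> GL l" and z: "z \<in> G \<times> G"
  shows "coeffs y l R z = (if l \<le> 2 * k then
     \<Sum>r\<in>{1..mult l}. cinner (tri_B m n) (invvec l r) y / of_nat (dim_irrep m (lam_k m l)) * W l r R z else 0)"
proof (cases "l \<le> 2 * k")
  case False
  then show ?thesis using gt_map_tens_zero[OF m2 _ coeffs_gt_map[OF y l] R] z by (simp add: tens_B_def)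
next
  case True
  then have lm: "l \<le> min n (2*k)" using l by simp
  let ?T = "tens_B m (lam_k m k)" and ?top = "max_pat m (lam_k m l)"
  note cmap = coeffs_gt_map[OF y l]
  have top: "?top \<in> GL l" using m2 by simp
  have Wf: "gt_map m ?T (\<lambda>j. tens_mat (gt_up m (lam_k m k) j))
         (\<lambda>j. tens_mat (gt_down m (lam_k m k) j)) (\<lambda>j. tens_mat (gt_h m (lam_k m k) j)) (lam_k m l) (W l r)"
    and Wo: "\<And>P Q. P \<in> GL l \<Longrightarrow> Q \<in> GL l \<Longrightarrow> cinner ?T (W l r P) (W l r Q) = (if P = Q then 1 else 0)"
    if "r \<in> {1..mult l}" for r
    using W_gt[OF lm that] unfolding gt_family_iff by (elim conjE; assumption | blast)+
  define \<kappa> where "\<kappa> r = cinner ?T (W l r ?top) (coeffs y l ?top)" for r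
  have gram: "cinner ?T (W l r P) (coeffs y l Q) = (if P = Q then \<kappa> r else 0)"
    if "r \<in> {1..mult l}" "P \<in> GL l" "Q \<in> GL l" for r P Q
    unfolding \<kappa>_def by (rule gram_scalar[OF adjoint_gens_tens top Wf[OF that(1)] cmap that(2,3)])
  \<comment> \<open>The same scalar occurs for every R, so it is the trace divided by the dimension:
    the origin of 1/d.\<close>
  have \<kappa>: "\<kappa> r = cinner (tri_B m n) (invvec l r) y / of_nat (dim_irrep m (lam_k m l))" if r: "r \<in> {1..mult l}" for r
  proof -
    have "cinner (tri_B m n) (invvec l r) y = (\<Sum>P\<in>GL l. \<kappa> r)"
      unfolding sum_cinner_W_coeffs[OF lm r, symmetric] using gram[OF r] by (intro sum.cong refl) simp
    also have "\<dots> = of_nat (dim_irrep m (lam_k m l)) * \<kappa> r" by (simp add: dim_irrep_def)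
    finally have "cinner (tri_B m n) (invvec l r) y = of_nat (dim_irrep m (lam_k m l)) * \<kappa> r" .
    moreover have "dim_irrep m (lam_k m l) \<noteq> 0" using top by (auto simp: dim_irrep_def)
    ultimately show ?thesis by simp
  qed
  have "coeffs y l R \<in> isotypic m ?T (\<lambda>j. tens_mat (gt_up m (lam_k m k) j))
         (\<lambda>j. tens_mat (gt_down m (lam_k m k) j)) (\<lambda>j. tens_mat (gt_h m (lam_k m k) j)) (lam_k m l)"
    by (rule gt_map_in_isotypic[OF adjoint_gens_tens top cmap _ R]) (auto simp: coeffs_def tens_B_def split: if_splits)
  also have "\<dots> = cspan ((\<lambda>(r, P). W l r P) ` ({1..mult l} \<times> GL l))"
    unfolding W_span[OF lm, symmetric]
  proof (rule arg_cong[where f = cspan], rule set_eqI, rule iffI)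
    fix x assume "x \<in> {W l r R |r R. r \<in> {1..mult l} \<and> R \<in> GL l}"
    then obtain r R where "x = W l r R" "r \<in> {1..mult l}" "R \<in> GL l" by blast
    then show "x \<in> (\<lambda>(r, P). W l r P) ` ({1..mult l} \<times> GL l)" by (intro image_eqI[of _ _ "(r, R)"]) auto
  next
    fix x assume "x \<in> (\<lambda>(r, P). W l r P) ` ({1..mult l} \<times> GL l)"
    then obtain r R where "x = W l r R" "r \<in> {1..mult l}" "R \<in> GL l" by auto
    then show "x \<in> {W l r R |r R. r \<in> {1..mult l} \<and> R \<in> GL l}"
      by (intro CollectI exI[of _ r] exI[of _ R] conjI)
  qed
  finally have mem: "coeffs y l R \<in> cspan ((\<lambda>(r, P). W l r P) ` ({1..mult l} \<times> GL l))" .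
  have "coeffs y l R z = (\<Sum>rP\<in>{1..mult l} \<times> GL l.
      cinner ?T ((\<lambda>(r, P). W l r P) rP) (coeffs y l R) * (\<lambda>(r, P). W l r P) rP z)"
  proof (rule cspan_orthonormal[OF _ _ mem])
    fix p q assume "p \<in> {1..mult l} \<times> GL l" "q \<in> {1..mult l} \<times> GL l"
    then obtain r P r' P' where pq: "p = (r, P)" "q = (r', P')" "r \<in> {1..mult l}" "r' \<in> {1..mult l}" "P \<in> GL l" "P' \<in> GL l"
      by blast
    show "cinner ?T ((\<lambda>(r, P). W l r P) p) ((\<lambda>(r, P). W l r P) q) = (if p = q then 1 else 0)"
      unfolding pq(1,2) using Wo[OF pq(3) pq(5,6)] W_orth[OF lm pq(3,4) _ pq(5,6)] by (cases "r = r'") auto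
  qed simp
  also have "\<dots> = (\<Sum>r\<in>{1..mult l}. \<Sum>P\<in>GL l. cinner ?T (W l r P) (coeffs y l R) * W l r P z)"
    by (simp add: sum.cartesian_product' case_prod_beta)
  also have "\<dots> = (\<Sum>r\<in>{1..mult l}. \<Sum>P\<in>GL l. (if P = R then \<kappa> r else 0) * W l r P z)"
    using gram R by (intro sum.cong refl) simp
  also have "\<dots> = (\<Sum>r\<in>{1..mult l}. \<kappa> r * W l r R z)"
    using R by (simp add: sum_mult_delta)
  also have "\<dots> = (\<Sum>r\<in>{1..mult l}. cinner (tri_B m n) (invvec l r) y / of_nat (dim_irrep m (lam_k m l)) * W l r R z)"
    using \<kappa> by (intro sum.cong refl) simp
  finally show ?thesis using True by simp
qed

private abbreviation (input) "amp \<equiv> diag_amp m k X W"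

lemma invvec_diag:
  assumes "l \<le> n"
  shows "invvec l r (((v, v), (v, v)), (v, v)) = amp l r v"
proof -
  have "invvec l r (((v, v), (v, v)), (v, v)) = (\<Sum>R\<in>GL l. \<Sum>M\<in>G. \<Sum>M'\<in>G. W l r R (M, M') * X k M (v, v) * X k M' (v, v) * X l R (v, v))"
    by (simp add: invvec_def pairvec_def X_real[OF assms] sum_distrib_right)
  also have "\<dots> = amp l r v" unfolding diag_amp_def
    by (subst sum.swap, rule sum.cong[OF refl], rule sum.swap)
  finally show ?thesis .
qed

lemma amp_real:
  assumes "l \<le> n"
  shows "cnj (amp l r v) = amp l r v"
  unfolding diag_amp_def by (simp add: W_real X_real[OF assms] X_real[OF kn])

lemma P_lam_dens:
  assumes n0: "n0 \<in> fock m n"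
  shows "P_lam m n k (dens n0) a = (\<Sum>M\<in>G. X k M (n0, n0) * X k M a)"
proof -
  have "cinner O_B (X k M) (dens n0) = X k M (n0, n0)" for M
  proof -
    have "cinner O_B (X k M) (dens n0) = (\<Sum>a\<in>O_B. cnj (X k M a) * (if a = (n0, n0) then 1 else 0))"
      unfolding cinner_def by (intro sum.cong refl) (auto simp: dens_def split: if_splits)
    also have "\<dots> = X k M (n0, n0)"
      using n0 by (simp add: sum_mult_delta om_B_def X_real[OF kn])
    finally show ?thesis .
  qed
  then show ?thesis using P_lam_eq[OF m2 X_gt kn, of "dens n0"] by simp
qed

text \<open>The column y of the averaging operator at the diagonal index is invariant, so
  \<open>coeffs_expand\<close> applies to it. The averaging operator is selfadjoint and fixes
  \<open>invvec l r\<close>; hence the inner product of \<open>invvec l r\<close> with y is just the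
  value of \<open>invvec l r\<close> at that index, which is real.\<close>

lemma avg_evaluation:
  assumes v: "v \<in> fock m n" and n0: "n0 \<in> fock m n"
  shows "(\<Sum>a\<in>O_B. \<Sum>b\<in>O_B. P_lam m n k (dens n0) a * P_lam m n k (dens n0) b
      * tri.avg (((v, v), (v, v)), (v, v)) ((a, b), (n0, n0)))
    = (\<Sum>l\<in>{0..min n (2*k)}. 1 / of_nat (dim_irrep m (lam_k m l)) * (\<Sum>r\<in>{1..mult l}. amp l r n0 * amp l r v))"
proof -
  let ?z = "(((v, v), (v, v)), (v, v))" and ?c = "(n0, n0)"
  have z: "?z \<in> tri_B m n" using v by (simp add: tri_B_def om_B_def)
  have c: "?c \<in> O_B" using n0 by (simp add: om_B_def)
  define y where "y b = tri.avg b ?z" for b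
  have y: "tri.lie_invariant y" unfolding y_def by (rule tri.avg_lie_invariant[OF z])
  have inner: "cinner (tri_B m n) (invvec l r) y = amp l r v" if l: "l \<le> min n (2*k)" and r: "r \<in> {1..mult l}" for l r
  proof -
    have ln: "l \<le> n" using l by simp
    have "cinner (tri_B m n) (invvec l r) y = cnj (\<Sum>b\<in>tri_B m n. tri.avg ?z b * invvec l r b)"
      unfolding cinner_def y_def cnj_sum
    proof (intro sum.cong refl)
      fix b assume "b \<in> tri_B m n"
      then have "tri.avg b ?z = cnj (tri.avg ?z b)" using tri.avg_hermitian z by blast
      then show "cnj (invvec l r b) * tri.avg b ?z = cnj (tri.avg ?z b * invvec l r b)" by (simp add: mult.commute)
    qed
    also have "\<dots> = cnj (invvec l r ?z)"
      using tri.avg_fixes_lie_invariant[OF _ invvec_invariant[OF l r] z] m2 by simp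
    finally show ?thesis unfolding invvec_diag[OF ln] amp_real[OF ln] .
  qed
  \<comment> \<open>The third slot is not projected, so it is expanded in the complete family
    \<open>X\<close>; this brings in the sum over l.\<close>
  have exp: "tri.avg ?z ((a, b), ?c) = (\<Sum>l\<le>n. \<Sum>R\<in>GL l. X l R ?c * cnj (slice y l R (a, b)))"
    if ab: "a \<in> O_B" "b \<in> O_B" for a b
  proof -
    let ?f = "\<lambda>c. tri.avg ?z ((a, b), c)"
    have "?f ?c = (\<Sum>l\<le>n. \<Sum>R\<in>GL l. cinner O_B (X l R) ?f * X l R ?c)"
      by (rule X_expand[OF m2 X_gt c])
    also have "\<dots> = (\<Sum>l\<le>n. \<Sum>R\<in>GL l. X l R ?c * cnj (slice y l R (a, b)))"
    proof (intro sum.cong refl)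
      fix l R
      have "cnj (slice y l R (a, b)) = (\<Sum>c\<in>O_B. cnj (X l R c) * cnj (tri.avg ((a, b), c) ?z))"
        by (simp add: slice_def y_def)
      also have "\<dots> = cinner O_B (X l R) ?f" unfolding cinner_def
      proof (intro sum.cong refl)
        fix c assume "c \<in> O_B"
        then have "((a, b), c) \<in> tri_B m n" using ab by (simp add: tri_B_def)
        then have "?f c = cnj (tri.avg ((a, b), c) ?z)" by (rule tri.avg_hermitian[OF z])
        then show "cnj (X l R c) * cnj (tri.avg ((a, b), c) ?z) = cnj (X l R c) * ?f c" by simp
      qed
      finally show "cinner O_B (X l R) ?f * X l R ?c = X l R ?c * cnj (slice y l R (a, b))" by simp
    qed
    finally show ?thesis .
  qed
  let ?P = "P_lam m n k (dens n0)"
  \<comment> \<open>The projected input restricts the first two slots to the k-th component, which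
    leaves the coordinates \<open>coeffs\<close> of the slice.\<close>
  have slice_sum: "(\<Sum>a\<in>O_B. \<Sum>b\<in>O_B. ?P a * ?P b * cnj (slice y l R (a, b)))
      = (\<Sum>M\<in>G. \<Sum>M'\<in>G. X k M ?c * X k M' ?c * cnj (coeffs y l R (M, M')))" for l R
  proof -
    have "(\<Sum>a\<in>O_B. \<Sum>b\<in>O_B. ?P a * ?P b * cnj (slice y l R (a, b)))
      = (\<Sum>q\<in>O_B \<times> O_B. \<Sum>p\<in>G \<times> G. X k (fst p) ?c * X k (snd p) ?c * (X k (fst p) (fst q) * X k (snd p) (snd q) * cnj (slice y l R q)))"
    proof -
      have "?P a * ?P b * t = (\<Sum>p\<in>G \<times> G. X k (fst p) ?c * X k (snd p) ?c * (X k (fst p) a * X k (snd p) b * t))" for a b t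
        unfolding P_lam_dens[OF n0]
        by (subst sum_product) (simp add: sum_distrib_left sum_distrib_right sum.cartesian_product' ac_simps)
      then show ?thesis by (simp add: sum.cartesian_product'[of _ O_B O_B])
    qed
    also have "\<dots> = (\<Sum>p\<in>G \<times> G. \<Sum>q\<in>O_B \<times> O_B. X k (fst p) ?c * X k (snd p) ?c * (X k (fst p) (fst q) * X k (snd p) (snd q) * cnj (slice y l R q)))"
      by (rule sum.swap)
    also have "\<dots> = (\<Sum>p\<in>G \<times> G. X k (fst p) ?c * X k (snd p) ?c * cnj (coeffs y l R p))"
    proof (intro sum.cong refl)
      fix p assume "p \<in> G \<times> G"
      then have "cnj (coeffs y l R p) = (\<Sum>q\<in>O_B \<times> O_B. X k (fst p) (fst q) * X k (snd p) (snd q) * cnj (slice y l R q))"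
        by (auto simp: coeffs_def sum.cartesian_product')
      then show "(\<Sum>q\<in>O_B \<times> O_B. X k (fst p) ?c * X k (snd p) ?c * (X k (fst p) (fst q) * X k (snd p) (snd q) * cnj (slice y l R q)))
          = X k (fst p) ?c * X k (snd p) ?c * cnj (coeffs y l R p)"
        by (simp only: sum_distrib_left)
    qed
    finally show ?thesis by (simp add: sum.cartesian_product' case_prod_beta)
  qed
  let ?Q = "\<lambda>l. 1 / of_nat (dim_irrep m (lam_k m l)) * (\<Sum>r\<in>{1..mult l}. amp l r n0 * amp l r v)"
  have comp: "(\<Sum>R\<in>GL l. X l R ?c * (\<Sum>M\<in>G. \<Sum>M'\<in>G. X k M ?c * X k M' ?c * cnj (coeffs y l R (M, M'))))
      = (if l \<le> 2 * k then ?Q l else 0)" if l: "l \<le> n" for l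
  proof (cases "l \<le> 2 * k")
    case False
    have "coeffs y l R (M, M') = 0" if "R \<in> GL l" "M \<in> G" "M' \<in> G" for R M M'
      using coeffs_expand[OF y l that(1), of "(M, M')"] that False by simp
    then show ?thesis using False by simp
  next
    case True
    then have lm: "l \<le> min n (2*k)" using l by simp
    let ?d = "1 / of_nat (dim_irrep m (lam_k m l)) :: complex"
    have co: "cnj (coeffs y l R (M, M')) = (\<Sum>r\<in>{1..mult l}. ?d * amp l r v * W l r R (M, M'))"
      if "R \<in> GL l" "M \<in> G" "M' \<in> G" for R M M'
    proof -
      have "coeffs y l R (M, M') = (\<Sum>r\<in>{1..mult l}. ?d * amp l r v * W l r R (M, M'))"
        using coeffs_expand[OF y l that(1), of "(M, M')"] that True inner[OF lm] by simp
      then show ?thesis by (simp add: W_real amp_real[OF l])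
    qed
    have "(\<Sum>R\<in>GL l. X l R ?c * (\<Sum>M\<in>G. \<Sum>M'\<in>G. X k M ?c * X k M' ?c * cnj (coeffs y l R (M, M'))))
      = (\<Sum>R\<in>GL l. \<Sum>M\<in>G. \<Sum>M'\<in>G. \<Sum>r\<in>{1..mult l}. ?d * amp l r v * (W l r R (M, M') * X k M ?c * X k M' ?c * X l R ?c))"
      unfolding sum_distrib_left by (intro sum.cong refl) (simp only: co sum_distrib_left, simp add: sum_distrib_left ac_simps)
    also have "\<dots> = (\<Sum>r\<in>{1..mult l}. \<Sum>M\<in>G. \<Sum>M'\<in>G. \<Sum>R\<in>GL l. ?d * amp l r v * (W l r R (M, M') * X k M ?c * X k M' ?c * X l R ?c))"
    proof -
      have "(\<Sum>R\<in>GL l. \<Sum>M\<in>G. \<Sum>M'\<in>G. \<Sum>r\<in>{1..mult l}. f R M M' r) = (\<Sum>r\<in>{1..mult l}. \<Sum>M\<in>G. \<Sum>M'\<in>G. \<Sum>R\<in>GL l. f R M M' r)"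
        for f :: "_ \<Rightarrow> _ \<Rightarrow> _ \<Rightarrow> _ \<Rightarrow> complex"
      proof -
        have "(\<Sum>R\<in>GL l. \<Sum>M\<in>G. \<Sum>M'\<in>G. \<Sum>r\<in>{1..mult l}. f R M M' r) = (\<Sum>R\<in>GL l. \<Sum>p\<in>G \<times> G. \<Sum>r\<in>{1..mult l}. f R (fst p) (snd p) r)"
          by (simp add: sum.cartesian_product' case_prod_beta)
        also have "\<dots> = (\<Sum>R\<in>GL l. \<Sum>r\<in>{1..mult l}. \<Sum>p\<in>G \<times> G. f R (fst p) (snd p) r)"
          by (intro sum.cong refl sum.swap)
        also have "\<dots> = (\<Sum>r\<in>{1..mult l}. \<Sum>R\<in>GL l. \<Sum>p\<in>G \<times> G. f R (fst p) (snd p) r)" by (rule sum.swap)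
        also have "\<dots> = (\<Sum>r\<in>{1..mult l}. \<Sum>p\<in>G \<times> G. \<Sum>R\<in>GL l. f R (fst p) (snd p) r)"
          by (intro sum.cong refl sum.swap)
        finally show ?thesis by (simp add: sum.cartesian_product' case_prod_beta)
      qed
      then show ?thesis .
    qed
    also have "\<dots> = (\<Sum>r\<in>{1..mult l}. ?d * amp l r v * amp l r n0)"
      by (simp only: diag_amp_def[of _ _ _ _ l _ n0] sum_distrib_left)
    also have "\<dots> = ?Q l" unfolding sum_distrib_left by (intro sum.cong refl) (simp add: ac_simps)
    finally show ?thesis using True by simp
  qed
  have "(\<Sum>a\<in>O_B. \<Sum>b\<in>O_B. ?P a * ?P b * tri.avg ?z ((a, b), ?c))
     = (\<Sum>a\<in>O_B. \<Sum>b\<in>O_B. \<Sum>l\<le>n. \<Sum>R\<in>GL l. X l R ?c * (?P a * ?P b * cnj (slice y l R (a, b))))"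
    by (intro sum.cong refl) (simp only: exp sum_distrib_left, simp add: ac_simps)
  also have "\<dots> = (\<Sum>q\<in>O_B \<times> O_B. \<Sum>l\<le>n. \<Sum>R\<in>GL l. X l R ?c * (?P (fst q) * ?P (snd q) * cnj (slice y l R q)))"
    by (simp add: sum.cartesian_product' case_prod_beta)
  also have "\<dots> = (\<Sum>l\<le>n. \<Sum>q\<in>O_B \<times> O_B. \<Sum>R\<in>GL l. X l R ?c * (?P (fst q) * ?P (snd q) * cnj (slice y l R q)))"
    by (rule sum.swap)
  also have "\<dots> = (\<Sum>l\<le>n. \<Sum>R\<in>GL l. \<Sum>q\<in>O_B \<times> O_B. X l R ?c * (?P (fst q) * ?P (snd q) * cnj (slice y l R q)))"
    by (intro sum.cong refl sum.swap)
  also have "\<dots> = (\<Sum>l\<le>n. \<Sum>R\<in>GL l. X l R ?c * (\<Sum>a\<in>O_B. \<Sum>b\<in>O_B. ?P a * ?P b * cnj (slice y l R (a, b))))"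
    by (simp add: sum.cartesian_product' case_prod_beta sum_distrib_left)
  also have "\<dots> = (\<Sum>l\<le>n. if l \<le> 2 * k then ?Q l else 0)"
    unfolding slice_sum using comp by (intro sum.cong refl) simp
  also have "\<dots> = (\<Sum>l\<in>{0..min n (2*k)}. ?Q l)"
    by (rule sum.mono_neutral_cong_right) auto
  finally show ?thesis .
qed

lemma second_moment_eq:
  assumes n0: "n0 \<in> fock m n"
  shows "second_moment m n k n0 \<mu> = 1 / (s_lam m n k)\<^sup>2 * (\<Sum>v\<in>fock m n.
    \<Sum>l\<in>{0..min n (2*k)}. 1 / of_nat (dim_irrep m (lam_k m l)) * (\<Sum>r\<in>{1..mult l}. amp l r n0 * amp l r v))"
proof -
  let ?P = "P_lam m n k (dens n0)" and ?s = "s_lam m n k"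
  let ?z = "\<lambda>v. (((v, v), (v, v)), (v, v))"
  have pt: "complex_of_real (prob_out m n n0 v g) * (filt m n k n0 v g)\<^sup>2
     = 1 / ?s\<^sup>2 * (\<Sum>a\<in>O_B. \<Sum>b\<in>O_B. ?P a * ?P b * tri_rep m n g (?z v) ((a, b), (n0, n0)))" for v g
  proof -
    let ?w = "\<lambda>a. om_rep m n g (v, v) a"
    have f: "filt m n k n0 v g = (\<Sum>a\<in>O_B. ?w a * ?P a) / ?s"
      unfolding filt_def om_B_def dens_def[symmetric] sum.cartesian_product
      by (simp add: om_rep_def case_prod_beta ac_simps)
    \<comment> \<open>A real number equals its conjugate; in this form the probability fits the dual
      third slot.\<close>
    have "complex_of_real (prob_out m n n0 v g) = cnj (?w (n0, n0))"
      by (simp add: prob_out_def om_rep_def complex_norm_square mult.commute flip: of_real_power)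
    then have "complex_of_real (prob_out m n n0 v g) * (filt m n k n0 v g)\<^sup>2
       = 1 / ?s\<^sup>2 * ((\<Sum>a\<in>O_B. ?w a * ?P a) * (\<Sum>b\<in>O_B. ?w b * ?P b) * cnj (?w (n0, n0)))"
      unfolding f by (simp add: power2_eq_square)
    also have "(\<Sum>a\<in>O_B. ?w a * ?P a) * (\<Sum>b\<in>O_B. ?w b * ?P b) * cnj (?w (n0, n0))
       = (\<Sum>a\<in>O_B. \<Sum>b\<in>O_B. ?P a * ?P b * tri_rep m n g (?z v) ((a, b), (n0, n0)))"
      by (subst sum_product) (simp add: sum_distrib_left sum_distrib_right tri_rep_def ac_simps)
    finally show ?thesis .
  qed
  have mem: "?z v \<in> tri_B m n" if "v \<in> fock m n" for v
    using that by (simp add: tri_B_def om_B_def)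
  have mem': "((a, b), (n0, n0)) \<in> tri_B m n" if "a \<in> O_B" "b \<in> O_B" for a b
    using that n0 by (simp add: tri_B_def om_B_def)
  have "second_moment m n k n0 \<mu> = (\<integral>g. (\<Sum>v\<in>fock m n. 1 / ?s\<^sup>2 * (\<Sum>a\<in>O_B. \<Sum>b\<in>O_B. ?P a * ?P b * tri_rep m n g (?z v) ((a, b), (n0, n0)))) \<partial>\<mu>)"
    unfolding second_moment_def pt ..
  also have "\<dots> = (\<Sum>v\<in>fock m n. 1 / ?s\<^sup>2 * (\<Sum>a\<in>O_B. \<Sum>b\<in>O_B. ?P a * ?P b * tri.avg (?z v) ((a, b), (n0, n0))))"
  proof -
    have int: "integrable \<mu> (\<lambda>g. ?P a * ?P b * tri_rep m n g (?z v) ((a, b), (n0, n0)))"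
      if "v \<in> fock m n" "a \<in> O_B" "b \<in> O_B" for v a b
      by (intro integrable_mult_right tri.integrable_entry mem mem' that)
    have i1: "(\<integral>g. (\<Sum>a\<in>O_B. \<Sum>b\<in>O_B. ?P a * ?P b * tri_rep m n g (?z v) ((a, b), (n0, n0))) \<partial>\<mu>)
       = (\<Sum>a\<in>O_B. \<Sum>b\<in>O_B. ?P a * ?P b * tri.avg (?z v) ((a, b), (n0, n0)))" if v: "v \<in> fock m n" for v
    proof -
      have "(\<integral>g. (\<Sum>a\<in>O_B. \<Sum>b\<in>O_B. ?P a * ?P b * tri_rep m n g (?z v) ((a, b), (n0, n0))) \<partial>\<mu>)
         = (\<Sum>a\<in>O_B. \<integral>g. (\<Sum>b\<in>O_B. ?P a * ?P b * tri_rep m n g (?z v) ((a, b), (n0, n0))) \<partial>\<mu>)"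
        by (rule Bochner_Integration.integral_sum) (intro Bochner_Integration.integrable_sum int v)
      also have "\<dots> = (\<Sum>a\<in>O_B. \<Sum>b\<in>O_B. \<integral>g. ?P a * ?P b * tri_rep m n g (?z v) ((a, b), (n0, n0)) \<partial>\<mu>)"
        by (intro sum.cong refl Bochner_Integration.integral_sum int v)
      also have "\<dots> = (\<Sum>a\<in>O_B. \<Sum>b\<in>O_B. ?P a * ?P b * tri.avg (?z v) ((a, b), (n0, n0)))"
        unfolding tri.avg_def by (intro sum.cong refl integral_mult_right_zero)
      finally show ?thesis .
    qed
    have "(\<integral>g. (\<Sum>v\<in>fock m n. 1 / ?s\<^sup>2 * (\<Sum>a\<in>O_B. \<Sum>b\<in>O_B. ?P a * ?P b * tri_rep m n g (?z v) ((a, b), (n0, n0)))) \<partial>\<mu>)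
      = (\<Sum>v\<in>fock m n. \<integral>g. 1 / ?s\<^sup>2 * (\<Sum>a\<in>O_B. \<Sum>b\<in>O_B. ?P a * ?P b * tri_rep m n g (?z v) ((a, b), (n0, n0))) \<partial>\<mu>)"
      by (intro Bochner_Integration.integral_sum integrable_mult_right Bochner_Integration.integrable_sum int)
    also have "\<dots> = (\<Sum>v\<in>fock m n. 1 / ?s\<^sup>2 * (\<Sum>a\<in>O_B. \<Sum>b\<in>O_B. ?P a * ?P b * tri.avg (?z v) ((a, b), (n0, n0))))"
    proof (intro sum.cong refl)
      fix v assume v: "v \<in> fock m n"
      show "(\<integral>g. 1 / ?s\<^sup>2 * (\<Sum>a\<in>O_B. \<Sum>b\<in>O_B. ?P a * ?P b * tri_rep m n g (?z v) ((a, b), (n0, n0))) \<partial>\<mu>)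
         = 1 / ?s\<^sup>2 * (\<Sum>a\<in>O_B. \<Sum>b\<in>O_B. ?P a * ?P b * tri.avg (?z v) ((a, b), (n0, n0)))"
        unfolding i1[OF v, symmetric] by (rule integral_mult_right_zero)
    qed
    finally show ?thesis .
  qed
  also have "\<dots> = (\<Sum>v\<in>fock m n. 1 / ?s\<^sup>2 *
     (\<Sum>l\<in>{0..min n (2*k)}. 1 / of_nat (dim_irrep m (lam_k m l)) * (\<Sum>r\<in>{1..mult l}. amp l r n0 * amp l r v)))"
    by (intro sum.cong refl arg_cong2[where f = "(*)"] avg_evaluation n0)
  finally show ?thesis by (simp only: sum_distrib_left)
qed

end

section \<open>Fock states as patterns, and the signs\<close>

lemma fock_of_pat_of_fock:
  assumes "v \<in> fock m n"
  shows "fock_of_pat m (pat_of_fock m v) = v"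
proof
  fix t
  show "fock_of_pat m (pat_of_fock m v) t = v t"
  proof (cases "t \<in> {1..m}")
    case True
    then obtain s where s: "t = Suc s" by (cases t) auto
    have "pat_of_fock m v 1 s = (\<Sum>i\<in>{1..s}. v i)" using True s by (cases s) (auto simp: pat_of_fock_def)
    then show ?thesis using True s by (simp add: fock_of_pat_def pat_of_fock_def)
  next
    case False
    then show ?thesis using fock_support[OF assms False] by (auto simp: fock_of_pat_def)
  qed
qed

text \<open>Rows below the first vanish together with their top entries, so a pattern is the
  sequence of partial sums of occupation numbers.\<close>

lemma fock_of_pat_bij: "bij_betw (fock_of_pat m) (GT m (lam_tau n)) (fock m n)" if m: "1 \<le> m"
proof (rule bij_betwI[where g = "pat_of_fock m"])
  \<comment> \<open>\<open>fock_of_pat\<close> subtracts naturals, so recovering the row needs its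
    monotonicity.\<close>
  have psum: "(\<Sum>t\<in>{1..j}. fock_of_pat m N t) = N 1 j" if N: "N \<in> GT m (lam_tau n)" and j: "j \<le> m" for N j
    using j
  proof (induction j)
    case 0
    have "N 1 0 = 0" using GT_support[OF N, of 1 0] by auto
    then show ?case by simp
  next
    case (Suc j)
    have "N 1 j \<le> N 1 (Suc j)"
    proof (cases "j = 0")
      case True
      have "N 1 0 = 0" using GT_support[OF N, of 1 0] by auto
      then show ?thesis using True by simp
    next
      case False
      then show ?thesis using GT_interlace(1)[OF N, of 1 j] Suc.prems by simp
    qed
    then show ?case using Suc by (simp add: fock_of_pat_def)
  qed
  show "fock_of_pat m \<in> GT m (lam_tau n) \<rightarrow> fock m n"
  proof
    fix N assume N: "N \<in> GT m (lam_tau n)"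
    have "(\<Sum>t\<in>{1..m}. fock_of_pat m N t) = n"
      using psum[OF N, of m] GT_top[OF N, of 1] m by (simp add: lam_tau_def)
    moreover have "\<forall>t. fock_of_pat m N t \<noteq> 0 \<longrightarrow> t \<in> {1..m}" by (simp add: fock_of_pat_def)
    ultimately show "fock_of_pat m N \<in> fock m n" by (simp add: fock_def)
  qed
  show "pat_of_fock m \<in> fock m n \<rightarrow> GT m (lam_tau n)"
  proof
    fix v assume v: "v \<in> fock m n"
    let ?M = "pat_of_fock m v"
    have "\<forall>i j. ?M i j \<noteq> 0 \<longrightarrow> 1 \<le> i \<and> i \<le> j \<and> j \<le> m" by (auto simp: pat_of_fock_def)
    moreover have "\<forall>i\<in>{1..m}. ?M i m = lam_tau n i" using fock_sum[OF v] m by (auto simp: pat_of_fock_def lam_tau_def)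
    moreover have "\<forall>i j. 1 \<le> i \<and> i \<le> j \<and> j < m \<longrightarrow> ?M i j \<le> ?M i (j+1) \<and> ?M (i+1) (j+1) \<le> ?M i j"
      by (auto simp: pat_of_fock_def)
    ultimately show "?M \<in> GT m (lam_tau n)" unfolding GT_def by blast
  qed
  show "fock_of_pat m (pat_of_fock m v) = v" if "v \<in> fock m n" for v by (rule fock_of_pat_of_fock[OF that])
  show "pat_of_fock m (fock_of_pat m N) = N" if N: "N \<in> GT m (lam_tau n)" for N
  proof (rule ext, rule ext)
    fix i j
    show "pat_of_fock m (fock_of_pat m N) i j = N i j"
    proof (cases "i = 1 \<and> 1 \<le> j \<and> j \<le> m")
      case True
      then show ?thesis using psum[OF N, of j] by (simp add: pat_of_fock_def)
    next
      case False
      have "N i j = 0"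
      proof (rule ccontr)
        assume nz: "N i j \<noteq> 0"
        then have ij: "1 \<le> i" "i \<le> j" "j \<le> m" using GT_support[OF N] by blast+
        have "N i j \<le> N i m" by (rule GT_mono_level[OF N ij(1,2,3)]) simp
        also have "\<dots> = 0" using GT_top[OF N, of i] ij False by (simp add: lam_tau_def)
        finally show False using nz by simp
      qed
      then show ?thesis using False by (auto simp: pat_of_fock_def)
    qed
  qed
qed

text \<open>The summand of g_k splits into a part with M, M', R for the input and one with L, L', R'
  for the outcome.\<close>

lemma sum_six_factor:
  fixes f :: "'a \<Rightarrow> 'a \<Rightarrow> 'b \<Rightarrow> complex" and g :: "'a \<Rightarrow> 'a \<Rightarrow> 'b \<Rightarrow> complex"
  shows "(\<Sum>M\<in>A. \<Sum>M'\<in>A. \<Sum>L\<in>A. \<Sum>L'\<in>A. \<Sum>R\<in>B. \<Sum>R'\<in>B. f M M' R * g L L' R')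
    = (\<Sum>M\<in>A. \<Sum>M'\<in>A. \<Sum>R\<in>B. f M M' R) * (\<Sum>L\<in>A. \<Sum>L'\<in>A. \<Sum>R'\<in>B. g L L' R')"
proof -
  have "(\<Sum>L\<in>A. \<Sum>L'\<in>A. \<Sum>R\<in>B. \<Sum>R'\<in>B. f M M' R * g L L' R') = (\<Sum>R\<in>B. f M M' R) * (\<Sum>L\<in>A. \<Sum>L'\<in>A. \<Sum>R'\<in>B. g L L' R')" for M M'
    by (simp only: sum_distrib_left[symmetric] sum_distrib_right[symmetric])
  then show ?thesis by (simp only: sum_distrib_right[symmetric])
qed

theorem theoremT11:
  fixes m n k :: nat and n0 :: "nat \<Rightarrow> nat" and \<mu> :: "cmat measure"
    and X :: "nat \<Rightarrow> gtpat \<Rightarrow> ((nat \<Rightarrow> nat) \<times> (nat \<Rightarrow> nat)) \<Rightarrow> complex"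
    and W :: "nat \<Rightarrow> nat \<Rightarrow> gtpat \<Rightarrow> (gtpat \<times> gtpat) \<Rightarrow> complex"
    and mult :: "nat \<Rightarrow> nat"
  assumes m2: "m \<ge> 2"
    and kn: "k \<le> n"
    and n0: "n0 \<in> fock m n"
    and haar: "haar_SU m \<mu>"
    \<comment> \<open>real GT bases of the components lambda_l of omega (real CG coefficients)\<close>
    and X_gt: "\<forall>l\<le>n. gt_family m (om_B m n) om_U om_D om_H (lam_k m l) (X l)"
    and X_real: "\<forall>l\<le>n. \<forall>M a. X l M a \<in> \<real>"
    \<comment> \<open>a fixed real orthogonal decomposition of the lambda_l-isotypic part of
        lambda_k (x) lambda_k into mult l copies, each with a GT basis\<close>
    and W_gt: "\<forall>l\<le>min n (2*k). \<forall>r\<in>{1..mult l}.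
       gt_family m (tens_B m (lam_k m k)) (\<lambda>j. tens_mat (gt_up m (lam_k m k) j))
         (\<lambda>j. tens_mat (gt_down m (lam_k m k) j)) (\<lambda>j. tens_mat (gt_h m (lam_k m k) j))
         (lam_k m l) (W l r)"
    and W_orth: "\<forall>l\<le>min n (2*k). \<forall>r\<in>{1..mult l}. \<forall>r'\<in>{1..mult l}. r \<noteq> r' \<longrightarrow>
       (\<forall>R\<in>GT m (lam_k m l). \<forall>R'\<in>GT m (lam_k m l).
          cinner (tens_B m (lam_k m k)) (W l r R) (W l r' R') = 0)"
    and W_span: "\<forall>l\<le>min n (2*k).
       cspan {W l r R | r R. r \<in> {1..mult l} \<and> R \<in> GT m (lam_k m l)} =
       isotypic m (tens_B m (lam_k m k)) (\<lambda>j. tens_mat (gt_up m (lam_k m k) j))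
         (\<lambda>j. tens_mat (gt_down m (lam_k m k) j)) (\<lambda>j. tens_mat (gt_h m (lam_k m k) j))
         (lam_k m l)"
    and W_real: "\<forall>l r R a. W l r R a \<in> \<real>"
  shows "second_moment m n k n0 \<mu> =
    1 / (s_lam m n k)\<^sup>2 * (-1) powi (phi m (pat_of_fock m n0)) *
    (\<Sum>N\<in>GT m (lam_tau n). (-1) powi (phi m N) *
      (let N0 = pat_of_fock m n0 in
       \<Sum>l\<in>{0..min n (2*k)}. 1 / of_nat (dim_irrep m (lam_k m l)) *
        (\<Sum>r\<in>{1..mult l}.
          \<Sum>M\<in>GT m (lam_k m k). \<Sum>M'\<in>GT m (lam_k m k).
          \<Sum>L\<in>GT m (lam_k m k). \<Sum>L'\<in>GT m (lam_k m k).
          \<Sum>R\<in>GT m (lam_k m l). \<Sum>R'\<in>GT m (lam_k m l).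
            CG_om m (X k) M N0 N0 * CG_om m (X k) M' N0 N0 * CG_om m (X l) R N0 N0
          * CG_om m (X k) L N N * CG_om m (X k) L' N N * CG_om m (X l) R' N N
          * W l r R (M, M') * W l r R' (L, L'))))"
proof -
  have Xg: "gt_family m (om_B m n) om_U om_D om_H (lam_k m l) (X l)" if "l \<le> n" for l
    using X_gt that by blast
  have Xr: "cnj (X l M a) = X l M a" if "l \<le> n" for l M a
    using X_real that unfolding Reals_cnj_iff by blast
  have Wg: "gt_family m (tens_B m (lam_k m k)) (\<lambda>j. tens_mat (gt_up m (lam_k m k) j))
         (\<lambda>j. tens_mat (gt_down m (lam_k m k) j)) (\<lambda>j. tens_mat (gt_h m (lam_k m k) j)) (lam_k m l) (W l r)"
    if "l \<le> min n (2*k)" "r \<in> {1..mult l}" for l r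
    using W_gt that by blast
  have Wo: "cinner (tens_B m (lam_k m k)) (W l r R) (W l r' R') = 0"
    if "l \<le> min n (2*k)" "r \<in> {1..mult l}" "r' \<in> {1..mult l}" "r \<noteq> r'" "R \<in> GT m (lam_k m l)" "R' \<in> GT m (lam_k m l)"
    for l r r' R R'
    using W_orth that by blast
  have Wr: "cnj (W l r R a) = W l r R a" for l r R a using W_real unfolding Reals_cnj_iff by blast
  let ?amp = "diag_amp m k X W"
  let ?S = "\<lambda>v. \<Sum>l\<in>{0..min n (2*k)}. 1 / of_nat (dim_irrep m (lam_k m l)) * (\<Sum>r\<in>{1..mult l}. ?amp l r n0 * ?amp l r v)"
  have sm: "second_moment m n k n0 \<mu> = 1 / (s_lam m n k)\<^sup>2 * (\<Sum>v\<in>fock m n. ?S v)"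
    by (rule second_moment_eq[OF m2 kn haar Xg Xr Wg Wo W_span[rule_format] Wr n0])
  let ?N0 = "pat_of_fock m n0"
  define q where "q N = ((-1) powi (phi m N) :: complex)" for N
  have q: "q N * q N = 1" for N
    unfolding q_def by (simp add: power_int_minus_left flip: power_int_add)
  have six: "(\<Sum>M\<in>GT m (lam_k m k). \<Sum>M'\<in>GT m (lam_k m k).
          \<Sum>L\<in>GT m (lam_k m k). \<Sum>L'\<in>GT m (lam_k m k).
          \<Sum>R\<in>GT m (lam_k m l). \<Sum>R'\<in>GT m (lam_k m l).
            CG_om m (X k) M ?N0 ?N0 * CG_om m (X k) M' ?N0 ?N0 * CG_om m (X l) R ?N0 ?N0
          * CG_om m (X k) L N N * CG_om m (X k) L' N N * CG_om m (X l) R' N N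
          * W l r R (M, M') * W l r R' (L, L')) = q ?N0 * q N * (?amp l r n0 * ?amp l r (fock_of_pat m N))" for l r N
  proof -
    have cg: "CG_om m Y P N N = q N * Y P (fock_of_pat m N, fock_of_pat m N)" for Y P N
      by (simp add: CG_om_def q_def)
    \<comment> \<open>Each of the three coefficients carries the sign \<open>q N\<close>; two of the
      three cancel.\<close>
    have amp: "(\<Sum>M\<in>GT m (lam_k m k). \<Sum>M'\<in>GT m (lam_k m k). \<Sum>R\<in>GT m (lam_k m l).
        CG_om m (X k) M N N * CG_om m (X k) M' N N * CG_om m (X l) R N N * W l r R (M, M'))
      = q N * ?amp l r (fock_of_pat m N)" for N
    proof -
      have "CG_om m (X k) M N N * CG_om m (X k) M' N N * CG_om m (X l) R N N * W l r R (M, M')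
          = q N * (W l r R (M, M') * X k M (fock_of_pat m N, fock_of_pat m N) * X k M' (fock_of_pat m N, fock_of_pat m N)
             * X l R (fock_of_pat m N, fock_of_pat m N))" for M M' R
      proof -
        have "CG_om m (X k) M N N * CG_om m (X k) M' N N * CG_om m (X l) R N N * W l r R (M, M')
          = (q N * q N) * q N * (W l r R (M, M') * X k M (fock_of_pat m N, fock_of_pat m N) * X k M' (fock_of_pat m N, fock_of_pat m N)
             * X l R (fock_of_pat m N, fock_of_pat m N))"
          unfolding cg by (simp only: ac_simps)
        then show ?thesis by (simp only: q mult_1_left)
      qed
      then show ?thesis by (simp only: diag_amp_def sum_distrib_left)
    qed
    have "(\<Sum>M\<in>GT m (lam_k m k). \<Sum>M'\<in>GT m (lam_k m k).
          \<Sum>L\<in>GT m (lam_k m k). \<Sum>L'\<in>GT m (lam_k m k).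
          \<Sum>R\<in>GT m (lam_k m l). \<Sum>R'\<in>GT m (lam_k m l).
            CG_om m (X k) M ?N0 ?N0 * CG_om m (X k) M' ?N0 ?N0 * CG_om m (X l) R ?N0 ?N0
          * CG_om m (X k) L N N * CG_om m (X k) L' N N * CG_om m (X l) R' N N
          * W l r R (M, M') * W l r R' (L, L'))
        = (\<Sum>M\<in>GT m (lam_k m k). \<Sum>M'\<in>GT m (lam_k m k).
          \<Sum>L\<in>GT m (lam_k m k). \<Sum>L'\<in>GT m (lam_k m k).
          \<Sum>R\<in>GT m (lam_k m l). \<Sum>R'\<in>GT m (lam_k m l).
            (CG_om m (X k) M ?N0 ?N0 * CG_om m (X k) M' ?N0 ?N0 * CG_om m (X l) R ?N0 ?N0 * W l r R (M, M'))
          * (CG_om m (X k) L N N * CG_om m (X k) L' N N * CG_om m (X l) R' N N * W l r R' (L, L')))"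
      by (intro sum.cong refl) (simp only: ac_simps)
    also have "\<dots> = q ?N0 * ?amp l r (fock_of_pat m ?N0) * (q N * ?amp l r (fock_of_pat m N))"
      unfolding sum_six_factor amp ..
    finally show ?thesis by (simp add: fock_of_pat_of_fock[OF n0])
  qed
  \<comment> \<open>The one sign left over for each of the two patterns meets the explicit sign in
    the statement.\<close>
  have "q ?N0 * (q N * (\<Sum>l\<in>{0..min n (2*k)}. 1 / of_nat (dim_irrep m (lam_k m l)) *
        (\<Sum>r\<in>{1..mult l}. q ?N0 * q N * (?amp l r n0 * ?amp l r (fock_of_pat m N))))) = ?S (fock_of_pat m N)" for N
  proof -
    have "q ?N0 * (q N * (\<Sum>l\<in>{0..min n (2*k)}. 1 / of_nat (dim_irrep m (lam_k m l)) *
        (\<Sum>r\<in>{1..mult l}. q ?N0 * q N * (?amp l r n0 * ?amp l r (fock_of_pat m N)))))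
      = (q ?N0 * q ?N0) * (q N * q N) * ?S (fock_of_pat m N)"
      by (simp add: sum_distrib_left ac_simps)
    then show ?thesis by (simp only: q mult_1_left)
  qed
  then have "q ?N0 * (\<Sum>N\<in>GT m (lam_tau n). q N * (\<Sum>l\<in>{0..min n (2*k)}. 1 / of_nat (dim_irrep m (lam_k m l)) *
        (\<Sum>r\<in>{1..mult l}. q ?N0 * q N * (?amp l r n0 * ?amp l r (fock_of_pat m N)))))
      = (\<Sum>N\<in>GT m (lam_tau n). ?S (fock_of_pat m N))"
    unfolding sum_distrib_left[of "q ?N0"] by (intro sum.cong refl)
  also have "\<dots> = (\<Sum>v\<in>fock m n. ?S v)"
    by (rule sum.reindex_bij_betw[OF fock_of_pat_bij]) (use m2 in simp)
  finally show ?thesis unfolding sm Let_def six q_def[symmetric] by (simp only: mult.assoc)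
qed

end
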